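(* If $R$ is a right (or left) artinian, left 1-MacWilliams ring, then $R$ is quasi-Frobenius.
   Context: Rings are associative with identity and modules are unital. For $n\ge 1$, the Hamming weight $wt(x)$ of $x=(x_1,\ldots,x_n)\in R^n$ is the number of non-zero entries $x_i$ of $x$. A homomorphism $f:L\to R^n$ from a left submodule $L$ of $R^n$ is Hamming weight preserving if $wt(f(x))=wt(x)$ for all $x\in L$. A ring $R$ is left $n$-MacWilliams if every Hamming weight preserving homomorphism $f:L\to R^n$ of left $R$-modules from a left submodule $L$ of $R^n$ extends to an automorphism of the left $R$-module $R^n$. Thus $R$ is left 1-MacWilliams if every monomorphism $f:I\to R$ of left $R$-modules from a left ideal $I$ of $R$ extends to an automorphism of ${}_RR$. A ring $R$ is quasi-Frobenius if it is left and right artinian and left and right self-injective (i.e. ${}_RR$ and $R_R$ are injective modules). The hypothesis "right (or left) artinian" means that $R$ is artinian on at least one side. *)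

theory Defs
  imports "HOL-Algebra.Module" "HOL-Library.FuncSet"
begin

text \<open>
  The library locale \<open>module\<close> requires a commutative ring, so unital left modules over an arbitrary
  ring are introduced here, on the library's record type for modules. The fields \<open>mult\<close> and \<open>one\<close>
  of a module record are irrelevant. The library locale \<open>submodule\<close> does not depend on
  commutativity and is used as it is.
\<close>

locale left_module = R?: ring R + M?: abelian_group M for R (structure) and M (structure) +
  assumes smult_closed [simp, intro]:
      "\<lbrakk>a \<in> carrier R; x \<in> carrier M\<rbrakk> \<Longrightarrow> a \<odot>\<^bsub>M\<^esub> x \<in> carrier M"
    and smult_l_distr:
      "\<lbrakk>a \<in> carrier R; b \<in> carrier R; x \<in> carrier M\<rbrakk> \<Longrightarrow>
        (a \<oplus>\<^bsub>R\<^esub> b) \<odot>\<^bsub>M\<^esub> x = a \<odot>\<^bsub>M\<^esub> x \<oplus>\<^bsub>M\<^esub> b \<odot>\<^bsub>M\<^esub> x"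
    and smult_r_distr:
      "\<lbrakk>a \<in> carrier R; x \<in> carrier M; y \<in> carrier M\<rbrakk> \<Longrightarrow>
        a \<odot>\<^bsub>M\<^esub> (x \<oplus>\<^bsub>M\<^esub> y) = a \<odot>\<^bsub>M\<^esub> x \<oplus>\<^bsub>M\<^esub> a \<odot>\<^bsub>M\<^esub> y"
    and smult_assoc:
      "\<lbrakk>a \<in> carrier R; b \<in> carrier R; x \<in> carrier M\<rbrakk> \<Longrightarrow>
        (a \<otimes>\<^bsub>R\<^esub> b) \<odot>\<^bsub>M\<^esub> x = a \<odot>\<^bsub>M\<^esub> (b \<odot>\<^bsub>M\<^esub> x)"
    and smult_one [simp]:
      "x \<in> carrier M \<Longrightarrow> \<one>\<^bsub>R\<^esub> \<odot>\<^bsub>M\<^esub> x = x"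

definition module_hom ::
  "('a, 'r) ring_scheme \<Rightarrow> ('a, 'b, 'm) module_scheme \<Rightarrow> ('a, 'c, 'n) module_scheme \<Rightarrow> ('b \<Rightarrow> 'c) set"
  where "module_hom R M N =
    {f \<in> carrier M \<rightarrow> carrier N.
      (\<forall>x\<in>carrier M. \<forall>y\<in>carrier M. f (x \<oplus>\<^bsub>M\<^esub> y) = f x \<oplus>\<^bsub>N\<^esub> f y) \<and>
      (\<forall>a\<in>carrier R. \<forall>x\<in>carrier M. f (a \<odot>\<^bsub>M\<^esub> x) = a \<odot>\<^bsub>N\<^esub> f x)}"

definition module_auto ::
  "('a, 'r) ring_scheme \<Rightarrow> ('a, 'b, 'm) module_scheme \<Rightarrow> ('b \<Rightarrow> 'b) set"
  where "module_auto R M = {f \<in> module_hom R M M. bij_betw f (carrier M) (carrier M)}"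

definition regular_module :: "('a, 'r) ring_scheme \<Rightarrow> ('a, 'a) module"
  where "regular_module R =
    \<lparr>carrier = carrier R, mult = mult R, one = one R, zero = zero R, add = add R, smult = mult R\<rparr>"

text \<open>
  A right module over \<open>R\<close> is a left module over the opposite ring, with \<open>a \<odot> x\<close> standing
  for \<open>x a\<close>. In particular the right module \<open>R\<close> is \<open>regular_module (opposite_ring R)\<close>, and its
  submodules are the right ideals of \<open>R\<close>.
\<close>

definition opposite_ring :: "('a, 'r) ring_scheme \<Rightarrow> ('a, 'r) ring_scheme"
  where "opposite_ring R = R\<lparr>mult := \<lambda>x y. y \<otimes>\<^bsub>R\<^esub> x\<rparr>"

definition artinian_module :: "('a, 'r) ring_scheme \<Rightarrow> ('a, 'b, 'm) module_scheme \<Rightarrow> bool"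
  where "artinian_module R M \<longleftrightarrow>
    (\<forall>I :: nat \<Rightarrow> 'b set.
      (\<forall>k. submodule (I k) R M) \<and> (\<forall>k. I (Suc k) \<subseteq> I k) \<longrightarrow> (\<exists>n. \<forall>k\<ge>n. I k = I n))"

definition left_artinian :: "('a, 'r) ring_scheme \<Rightarrow> bool"
  where "left_artinian R \<longleftrightarrow> artinian_module R (regular_module R)"

definition right_artinian :: "('a, 'r) ring_scheme \<Rightarrow> bool"
  where "right_artinian R \<longleftrightarrow> left_artinian (opposite_ring R)"

text \<open>
  Injectivity quantifies over all monomorphisms \<open>A \<rightarrow> B\<close>. HOL cannot quantify over the types of
  the elements of \<open>A\<close> and \<open>B\<close> inside a formula, so these types are parameters; a theorem that
  concludes injectivity with \<open>'b\<close> and \<open>'c\<close> left as type variables asserts it for all modules.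
\<close>

definition injective_module ::
  "'b itself \<Rightarrow> 'c itself \<Rightarrow> ('a, 'r) ring_scheme \<Rightarrow> ('a, 'd, 'm) module_scheme \<Rightarrow> bool"
  where "injective_module _ _ R E \<longleftrightarrow>
    left_module R E \<and>
    (\<forall>(A :: ('a, 'b) module) (B :: ('a, 'c) module) i f.
      left_module R A \<and> left_module R B \<and>
      i \<in> module_hom R A B \<and> inj_on i (carrier A) \<and> f \<in> module_hom R A E \<longrightarrow>
      (\<exists>g \<in> module_hom R B E. \<forall>x\<in>carrier A. g (i x) = f x))"

definition left_self_injective ::
  "'b itself \<Rightarrow> 'c itself \<Rightarrow> ('a, 'r) ring_scheme \<Rightarrow> bool"
  where "left_self_injective TB TC R \<longleftrightarrow> injective_module TB TC R (regular_module R)"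

definition right_self_injective ::
  "'b itself \<Rightarrow> 'c itself \<Rightarrow> ('a, 'r) ring_scheme \<Rightarrow> bool"
  where "right_self_injective TB TC R \<longleftrightarrow> left_self_injective TB TC (opposite_ring R)"

definition quasi_frobenius ::
  "'b itself \<Rightarrow> 'c itself \<Rightarrow> ('a, 'r) ring_scheme \<Rightarrow> bool"
  where "quasi_frobenius TB TC R \<longleftrightarrow>
    ring R \<and> left_artinian R \<and> right_artinian R \<and>
    left_self_injective TB TC R \<and> right_self_injective TB TC R"

text \<open>
  Vectors of length \<open>n\<close> are functions on \<open>{..<n}\<close>, made \<open>undefined\<close> elsewhere so that equality
  of vectors is equality of functions.
\<close>

definition free_module :: "('a, 'r) ring_scheme \<Rightarrow> nat \<Rightarrow> ('a, nat \<Rightarrow> 'a) module"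
  where "free_module R n =
    \<lparr>carrier = {..<n} \<rightarrow>\<^sub>E carrier R, mult = undefined, one = undefined,
     zero = (\<lambda>i\<in>{..<n}. \<zero>\<^bsub>R\<^esub>), add = (\<lambda>x y. \<lambda>i\<in>{..<n}. x i \<oplus>\<^bsub>R\<^esub> y i),
     smult = (\<lambda>a x. \<lambda>i\<in>{..<n}. a \<otimes>\<^bsub>R\<^esub> x i)\<rparr>"

definition hamming_weight :: "('a, 'r) ring_scheme \<Rightarrow> nat \<Rightarrow> (nat \<Rightarrow> 'a) \<Rightarrow> nat"
  where "hamming_weight R n x = card {i. i < n \<and> x i \<noteq> \<zero>\<^bsub>R\<^esub>}"

definition left_MacWilliams :: "nat \<Rightarrow> ('a, 'r) ring_scheme \<Rightarrow> bool"
  where "left_MacWilliams n R \<longleftrightarrow>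
    (\<forall>L f. submodule L R (free_module R n) \<and>
      f \<in> module_hom R ((free_module R n)\<lparr>carrier := L\<rparr>) (free_module R n) \<and>
      (\<forall>x\<in>L. hamming_weight R n (f x) = hamming_weight R n x) \<longrightarrow>
      (\<exists>g \<in> module_auto R (free_module R n). \<forall>x\<in>L. g x = f x))"

lemma ring_opposite_ring:
  assumes "ring R"
  shows "ring (opposite_ring R)"
proof -
  interpret ring R by fact
  have inv: "\<exists>y\<in>carrier (opposite_ring R). y \<oplus>\<^bsub>opposite_ring R\<^esub> x = \<zero>\<^bsub>opposite_ring R\<^esub>"
    if "x \<in> carrier (opposite_ring R)" for x
    using that l_neg by (intro bexI[of _ "\<ominus>\<^bsub>R\<^esub> x"]) (auto simp: opposite_ring_def)
  show ?thesis
    by (intro ringI abelian_groupI monoidI inv)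
      (auto simp: opposite_ring_def a_assoc m_assoc l_distr r_distr intro: a_comm)
qed

lemma left_module_regular_module:
  assumes "ring R"
  shows "left_module R (regular_module R)"
proof -
  interpret ring R by fact
  have inv: "\<exists>y\<in>carrier (regular_module R). y \<oplus>\<^bsub>regular_module R\<^esub> x = \<zero>\<^bsub>regular_module R\<^esub>"
    if "x \<in> carrier (regular_module R)" for x
    using that l_neg by (intro bexI[of _ "\<ominus>\<^bsub>R\<^esub> x"]) (auto simp: regular_module_def)
  show ?thesis
    by (intro left_module.intro left_module_axioms.intro assms abelian_groupI inv)
      (auto simp: regular_module_def a_assoc m_assoc l_distr r_distr intro: a_comm)
qed

lemma left_module_free_module:
  assumes "ring R"
  shows "left_module R (free_module R n)"
proof -
  interpret ring R by fact
  have inv: "\<exists>y\<in>carrier (free_module R n). y \<oplus>\<^bsub>free_module R n\<^esub> x = \<zero>\<^bsub>free_module R n\<^esub>"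
    if "x \<in> carrier (free_module R n)" for x
    using that l_neg
    by (intro bexI[of _ "\<lambda>i\<in>{..<n}. \<ominus>\<^bsub>R\<^esub> x i"])
      (auto simp: free_module_def PiE_iff fun_eq_iff restrict_def extensional_def)
  show ?thesis
    by (intro left_module.intro left_module_axioms.intro assms abelian_groupI inv)
      (auto simp: free_module_def PiE_iff fun_eq_iff restrict_def extensional_def
        a_assoc m_assoc l_distr r_distr intro: a_comm)
qed

end

theory Submission
  imports Defs
begin

text \<open>
  An artinian ring has a nilpotent ideal \<open>J\<close> with \<open>R / J\<close> semisimple, so both socles are essential. By
  hypothesis a monomorphism from a left ideal to \<open>R\<close> is right multiplication by a unit. Hence a
  generator \<open>a\<close> of a minimal left ideal also generates a minimal right ideal, and the left type of
  \<open>Ra\<close> determines the right type of \<open>aR\<close>; there are equally many left and right types, so this is a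
  bijection. This shows that \<open>b\<close> is separated from any left ideal \<open>T\<close> of the left socle
  avoiding the minimal left ideal \<open>Rb\<close> by some \<open>x\<close> with \<open>T x = 0\<close> and \<open>b x \<noteq> 0\<close>, and so every map from a
  semisimple left ideal to \<open>R\<close> is a right multiplication. For an arbitrary \<open>f\<close> on a left ideal \<open>I\<close>, let
  \<open>c\<close> induce \<open>f\<close> on the socle of \<open>I\<close>: then \<open>x \<mapsto> x + f x - x c\<close> is the identity on that socle,
  hence injective on \<open>I\<close> and multiplication by a unit, which gives left self-injectivity. As every simple left module
  embeds in \<open>R\<close>, left ideals are double annihilators, and the remaining properties
  follow from the duality between left and right ideals.
\<close>

section \<open>One-sided ideals and linear maps\<close>

text \<open>The chain condition holds on one unspecified side, while the extension hypothesis speaks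
  of left ideals only. The argument therefore keeps from the artinian hypothesis just the data that
  an artinian ring of either side provides symmetrically: a nilpotent two-sided \<open>J\<close> and
  a finite set \<open>E\<close> of idempotents modulo \<open>J\<close>. The opposite ring inherits
  this data, and R/J satisfies the descending chain condition on both sides; left self-injectivity
  is derived from this alone, and only afterwards do annihilators carry the chain condition across.

  The hypothesis compares left ideals, so it shows directly that left types determine right types.
  Separation needs the converse. The critical case is \<open>b\<close> with bR = {0, b}, where no
  unit moves \<open>b\<close>: then an idempotent of \<open>E\<close> must do the separating, and it
  fails to kill \<open>T\<close> only if \<open>T\<close> contains a minimal element of the right
  type of \<open>b\<close>.\<close>

definition left_ideal :: "('a, 'r) ring_scheme \<Rightarrow> 'a set \<Rightarrow> bool"
  where "left_ideal R I \<longleftrightarrow>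
    I \<subseteq> carrier R \<and> \<zero>\<^bsub>R\<^esub> \<in> I \<and> (\<forall>x\<in>I. \<forall>y\<in>I. x \<oplus>\<^bsub>R\<^esub> y \<in> I) \<and>
    (\<forall>a\<in>carrier R. \<forall>x\<in>I. a \<otimes>\<^bsub>R\<^esub> x \<in> I)"

text \<open>Reading right ideals as left ideals of the opposite ring lets a one-sided lemma be
  proved once and reused by interpretation at \<open>opposite_ring R\<close>.\<close>

abbreviation right_ideal :: "('a, 'r) ring_scheme \<Rightarrow> 'a set \<Rightarrow> bool"
  where "right_ideal R \<equiv> left_ideal (opposite_ring R)"

definition left_linear :: "('a, 'r) ring_scheme \<Rightarrow> 'a set \<Rightarrow> ('a \<Rightarrow> 'a) \<Rightarrow> bool"
  where "left_linear R I f \<longleftrightarrow>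
    f \<in> I \<rightarrow> carrier R \<and> (\<forall>x\<in>I. \<forall>y\<in>I. f (x \<oplus>\<^bsub>R\<^esub> y) = f x \<oplus>\<^bsub>R\<^esub> f y) \<and>
    (\<forall>a\<in>carrier R. \<forall>x\<in>I. f (a \<otimes>\<^bsub>R\<^esub> x) = a \<otimes>\<^bsub>R\<^esub> f x)"

text \<open>A left linear map on all of R is right multiplication by its value at 1, so this is the
  extension property for inclusions of left ideals into R, written with elements.\<close>

definition left_baer :: "('a, 'r) ring_scheme \<Rightarrow> bool"
  where "left_baer R \<longleftrightarrow>
    (\<forall>I f. left_ideal R I \<and> left_linear R I f \<longrightarrow>
      (\<exists>c\<in>carrier R. \<forall>x\<in>I. f x = x \<otimes>\<^bsub>R\<^esub> c))"

lemma left_baerE: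
  assumes "left_baer R" "left_ideal R I" "left_linear R I f"
  obtains c where "c \<in> carrier R" "\<And>x. x \<in> I \<Longrightarrow> f x = x \<otimes>\<^bsub>R\<^esub> c"
proof -
  have "\<exists>c\<in>carrier R. \<forall>x\<in>I. f x = x \<otimes>\<^bsub>R\<^esub> c"
    using assms(1)[unfolded left_baer_def, THEN spec, THEN spec, of I f] assms(2,3) by simp
  then show thesis
    using that by auto
qed

lemma opposite_ring_simps [simp]:
  "carrier (opposite_ring R) = carrier R"
  "add (opposite_ring R) = add R"
  "zero (opposite_ring R) = zero R"
  "one (opposite_ring R) = one R"
  "x \<otimes>\<^bsub>opposite_ring R\<^esub> y = y \<otimes>\<^bsub>R\<^esub> x"
  "a_inv (opposite_ring R) = a_inv R"
  "a_minus (opposite_ring R) = a_minus R"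
  "opposite_ring (opposite_ring R) = R"
  by (simp_all add: opposite_ring_def a_inv_def m_inv_def a_minus_def fun_eq_iff)

lemma regular_module_simps [simp]:
  "carrier (regular_module R) = carrier R"
  "add (regular_module R) = add R"
  "zero (regular_module R) = zero R"
  "smult (regular_module R) = mult R"
  "a_inv (regular_module R) = a_inv R"
  by (simp_all add: regular_module_def a_inv_def m_inv_def fun_eq_iff)

context ring
begin

text \<open>Sorting summands by \<open>a_ac\<close> can leave other terms between an element and its
  negative. These equations cancel across gaps of one or two terms, so that
  \<open>ring_normalize\<close> can be used to verify ring identities by rewriting.\<close>

lemma add_cancel:
  assumes "x \<in> carrier R" "y \<in> carrier R" "z \<in> carrier R" "w \<in> carrier R"
  shows "x \<oplus> (y \<oplus> \<ominus> x) = y" "\<ominus> x \<oplus> (y \<oplus> x) = y"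
    "x \<oplus> (y \<oplus> (\<ominus> x \<oplus> z)) = y \<oplus> z" "\<ominus> x \<oplus> (y \<oplus> (x \<oplus> z)) = y \<oplus> z"
    "x \<oplus> (y \<oplus> (z \<oplus> \<ominus> x)) = y \<oplus> z" "\<ominus> x \<oplus> (y \<oplus> (z \<oplus> x)) = y \<oplus> z"
    "x \<oplus> (y \<oplus> (z \<oplus> (\<ominus> x \<oplus> w))) = y \<oplus> (z \<oplus> w)"
    "\<ominus> x \<oplus> (y \<oplus> (z \<oplus> (x \<oplus> w))) = y \<oplus> (z \<oplus> w)"
proof -
  have a: "x \<oplus> (y \<oplus> t) = y \<oplus> (x \<oplus> t)" "\<ominus> x \<oplus> (y \<oplus> t) = y \<oplus> (\<ominus> x \<oplus> t)"
    "x \<oplus> (z \<oplus> t) = z \<oplus> (x \<oplus> t)" "\<ominus> x \<oplus> (z \<oplus> t) = z \<oplus> (\<ominus> x \<oplus> t)"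
    if "t \<in> carrier R" for t
    using that assms by (simp_all add: a_lcomm)
  show "x \<oplus> (y \<oplus> \<ominus> x) = y" "\<ominus> x \<oplus> (y \<oplus> x) = y"
    "x \<oplus> (y \<oplus> (\<ominus> x \<oplus> z)) = y \<oplus> z" "\<ominus> x \<oplus> (y \<oplus> (x \<oplus> z)) = y \<oplus> z"
    "x \<oplus> (y \<oplus> (z \<oplus> \<ominus> x)) = y \<oplus> z" "\<ominus> x \<oplus> (y \<oplus> (z \<oplus> x)) = y \<oplus> z"
    "x \<oplus> (y \<oplus> (z \<oplus> (\<ominus> x \<oplus> w))) = y \<oplus> (z \<oplus> w)"
    "\<ominus> x \<oplus> (y \<oplus> (z \<oplus> (x \<oplus> w))) = y \<oplus> (z \<oplus> w)"
    using assms by (simp_all add: a r_neg l_neg r_neg1 r_neg2)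
qed

lemmas ring_normalize = add_cancel
  a_ac m_assoc l_distr r_distr minus_eq minus_add l_minus r_minus r_neg l_neg r_neg1 r_neg2
  minus_minus

lemma left_idealD:
  assumes "left_ideal R I"
  shows "x \<in> I \<Longrightarrow> x \<in> carrier R" "\<zero> \<in> I" "\<lbrakk>x \<in> I; y \<in> I\<rbrakk> \<Longrightarrow> x \<oplus> y \<in> I"
    "\<lbrakk>a \<in> carrier R; x \<in> I\<rbrakk> \<Longrightarrow> a \<otimes> x \<in> I"
  using assms unfolding left_ideal_def by auto

lemma left_ideal_minus:
  assumes "left_ideal R I" "x \<in> I"
  shows "\<ominus> x \<in> I"
proof -
  have "\<ominus> \<one> \<otimes> x \<in> I"
    using assms by (intro left_idealD(4)) auto
  then show ?thesis
    using assms left_idealD(1)[OF assms] by (simp add: l_minus)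
qed

lemma left_ideal_diff:
  assumes "left_ideal R I" "x \<in> I" "y \<in> I"
  shows "x \<ominus> y \<in> I"
  using assms left_ideal_minus left_idealD(3) by (simp add: minus_eq)

lemma diff_eq_zeroD: "\<lbrakk>x \<in> carrier R; y \<in> carrier R; x \<ominus> y = \<zero>\<rbrakk> \<Longrightarrow> x = y"
  using minus_equality[of x "\<ominus> y"] by (simp add: minus_eq minus_minus)

lemma left_ideal_diffD:
  assumes "left_ideal R I" "y \<in> I" "x \<ominus> y \<in> I" "x \<in> carrier R"
  shows "x \<in> I"
proof -
  have "x \<ominus> y \<oplus> y \<in> I"
    using assms by (intro left_idealD(3)[OF assms(1)])
  moreover have "x \<ominus> y \<oplus> y = x"
    using assms left_idealD(1)[OF assms(1,2)] by (simp add: ring_normalize)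
  ultimately show ?thesis by simp
qed

lemma left_ideal_diffD':
  assumes "left_ideal R I" "x \<in> I" "x \<ominus> y \<in> I" "y \<in> carrier R"
  shows "y \<in> I"
proof -
  have "x \<ominus> (x \<ominus> y) \<in> I"
    using assms by (auto intro: left_ideal_diff)
  moreover have "x \<ominus> (x \<ominus> y) = y"
    using assms left_idealD(1)[OF assms(1,2)] by (simp add: ring_normalize)
  ultimately show ?thesis by simp
qed

lemma submodule_iff_left_ideal: "submodule I R (regular_module R) \<longleftrightarrow> left_ideal R I"
proof
  assume "submodule I R (regular_module R)"
  then interpret submodule I R "regular_module R" .
  show "left_ideal R I"
    using subset one_closed m_closed smult_closed unfolding left_ideal_def by simp
next
  assume I: "left_ideal R I"
  show "submodule I R (regular_module R)"
  proof (intro submodule.intro subgroup.intro submodule_axioms.intro)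
    fix x assume "x \<in> I"
    then have "a_inv (regular_module R) x \<in> I"
      using left_ideal_minus[OF I] by simp
    then show "inv\<^bsub>add_monoid (regular_module R)\<^esub> x \<in> I"
      by (simp only: a_inv_def)
  qed (use I in \<open>auto simp: left_ideal_def\<close>)
qed

lemma left_ideal_carrier: "left_ideal R (carrier R)"
  by (simp add: left_ideal_def)

lemma left_ideal_zero: "left_ideal R {\<zero>}"
  by (simp add: left_ideal_def)

lemma left_ideal_Int: "\<lbrakk>left_ideal R I; left_ideal R K\<rbrakk> \<Longrightarrow> left_ideal R (I \<inter> K)"
  by (auto simp: left_ideal_def)

lemma left_ideal_sum:
  assumes "left_ideal R I" "left_ideal R K"
  shows "left_ideal R {x \<oplus> y |x y. x \<in> I \<and> y \<in> K}"
  unfolding left_ideal_def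
proof (intro conjI ballI)
  show "{x \<oplus> y |x y. x \<in> I \<and> y \<in> K} \<subseteq> carrier R"
    using left_idealD(1)[OF assms(1)] left_idealD(1)[OF assms(2)] by auto
  show "\<zero> \<in> {x \<oplus> y |x y. x \<in> I \<and> y \<in> K}"
    using left_idealD(2)[OF assms(1)] left_idealD(2)[OF assms(2)] by force
next
  fix u v
  assume "u \<in> {x \<oplus> y |x y. x \<in> I \<and> y \<in> K}" "v \<in> {x \<oplus> y |x y. x \<in> I \<and> y \<in> K}"
  then obtain x y x' y' where *: "u = x \<oplus> y" "v = x' \<oplus> y'" "x \<in> I" "x' \<in> I" "y \<in> K" "y' \<in> K"
    by auto
  then have "u \<oplus> v = (x \<oplus> x') \<oplus> (y \<oplus> y')"
    using left_idealD(1)[OF assms(1)] left_idealD(1)[OF assms(2)] by (simp add: a_ac)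
  then show "u \<oplus> v \<in> {x \<oplus> y |x y. x \<in> I \<and> y \<in> K}"
    using * left_idealD(3)[OF assms(1)] left_idealD(3)[OF assms(2)] by blast
next
  fix a u
  assume a: "a \<in> carrier R" and "u \<in> {x \<oplus> y |x y. x \<in> I \<and> y \<in> K}"
  then obtain x y where *: "u = x \<oplus> y" "x \<in> I" "y \<in> K"
    by auto
  then have "a \<otimes> u = a \<otimes> x \<oplus> a \<otimes> y"
    using a left_idealD(1)[OF assms(1)] left_idealD(1)[OF assms(2)] by (simp add: r_distr)
  then show "a \<otimes> u \<in> {x \<oplus> y |x y. x \<in> I \<and> y \<in> K}"
    using * a left_idealD(4)[OF assms(1)] left_idealD(4)[OF assms(2)] by blast
qed

lemma left_ideal_mult:
  assumes "left_ideal R I" "x \<in> carrier R"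
  shows "left_ideal R {a \<otimes> x |a. a \<in> I}"
  unfolding left_ideal_def
proof (intro conjI ballI)
  note I = left_idealD[OF assms(1)]
  show "{a \<otimes> x |a. a \<in> I} \<subseteq> carrier R"
    using I(1) assms by auto
  show "\<zero> \<in> {a \<otimes> x |a. a \<in> I}"
    using I(2) assms by force
  fix u v
  assume "u \<in> {a \<otimes> x |a. a \<in> I}" "v \<in> {a \<otimes> x |a. a \<in> I}"
  then obtain a b where *: "u = a \<otimes> x" "v = b \<otimes> x" "a \<in> I" "b \<in> I"
    by auto
  then have "u \<oplus> v = (a \<oplus> b) \<otimes> x"
    using I(1) assms by (simp add: l_distr)
  then show "u \<oplus> v \<in> {a \<otimes> x |a. a \<in> I}"
    using * I(3) by auto
next
  note I = left_idealD[OF assms(1)]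
  fix r u
  assume "r \<in> carrier R" "u \<in> {a \<otimes> x |a. a \<in> I}"
  then obtain a where *: "u = a \<otimes> x" "a \<in> I" "r \<in> carrier R"
    by auto
  then have "r \<otimes> u = (r \<otimes> a) \<otimes> x"
    using I(1) assms by (simp add: m_assoc)
  then show "r \<otimes> u \<in> {a \<otimes> x |a. a \<in> I}"
    using * I(4) by auto
qed

definition adjoin :: "'a set \<Rightarrow> 'a \<Rightarrow> 'a set"
  where "adjoin I x = {a \<oplus> r \<otimes> x |a r. a \<in> I \<and> r \<in> carrier R}"

lemma left_ideal_adjoin:
  assumes "left_ideal R I" "x \<in> carrier R"
  shows "left_ideal R (adjoin I x)"
proof -
  have "adjoin I x = {u \<oplus> v |u v. u \<in> I \<and> v \<in> {a \<otimes> x |a. a \<in> carrier R}}"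
    unfolding adjoin_def by blast
  then show ?thesis
    using left_ideal_sum[OF assms(1) left_ideal_mult[OF left_ideal_carrier assms(2)]] by simp
qed

lemma adjoin_base:
  assumes "left_ideal R I" "x \<in> carrier R"
  shows "I \<subseteq> adjoin I x"
proof
  fix a assume a: "a \<in> I"
  then have "a = a \<oplus> \<zero> \<otimes> x"
    using assms left_idealD(1)[OF assms(1)] by simp
  then show "a \<in> adjoin I x"
    using a unfolding adjoin_def by blast
qed

lemma adjoin_elem:
  assumes "left_ideal R I" "x \<in> carrier R"
  shows "x \<in> adjoin I x"
proof -
  have "x = \<zero> \<oplus> \<one> \<otimes> x"
    using assms by simp
  then show ?thesis
    using left_idealD(2)[OF assms(1)] unfolding adjoin_def by blast
qed

lemma adjoin_subset:
  assumes "left_ideal R K" "I \<subseteq> K" "x \<in> K"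
  shows "adjoin I x \<subseteq> K"
  using assms left_idealD(3,4)[OF assms(1)] unfolding adjoin_def by blast

lemma left_ideal_annihilator:
  assumes "X \<subseteq> carrier R"
  shows "left_ideal R {r \<in> carrier R. \<forall>x\<in>X. r \<otimes> x = \<zero>}"
  using assms by (auto simp: left_ideal_def l_distr m_assoc subset_iff)

lemma left_linearD:
  assumes "left_linear R I f"
  shows "x \<in> I \<Longrightarrow> f x \<in> carrier R" "\<lbrakk>x \<in> I; y \<in> I\<rbrakk> \<Longrightarrow> f (x \<oplus> y) = f x \<oplus> f y"
    "\<lbrakk>a \<in> carrier R; x \<in> I\<rbrakk> \<Longrightarrow> f (a \<otimes> x) = a \<otimes> f x"
  using assms unfolding left_linear_def by auto

lemma left_linear_minus:
  assumes "left_ideal R I" "left_linear R I f" "x \<in> I"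
  shows "f (\<ominus> x) = \<ominus> f x"
proof -
  have "f (\<ominus> \<one> \<otimes> x) = \<ominus> \<one> \<otimes> f x"
    using assms by (intro left_linearD(3)) auto
  then show ?thesis
    using assms left_idealD(1)[OF assms(1,3)] left_linearD(1)[OF assms(2,3)] by (simp add: l_minus)
qed

lemma left_linear_zero:
  assumes "left_ideal R I" "left_linear R I f"
  shows "f \<zero> = \<zero>"
proof -
  have "f (\<zero> \<otimes> \<zero>) = \<zero> \<otimes> f \<zero>"
    using assms left_idealD(2) by (intro left_linearD(3)) auto
  then show ?thesis
    using assms left_idealD(2)[OF assms(1)] left_linearD(1)[OF assms(2)] by simp
qed

text \<open>The map \<open>f\<close> on I and the map taking r x to r y glue to I + Rx when they
  agree on the intersection of I and Rx, which is what \<open>rel\<close> expresses.\<close>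

lemma extend_adjoin:
  assumes I: "left_ideal R I" and f: "left_linear R I f"
    and x: "x \<in> carrier R" and y: "y \<in> carrier R"
    and rel: "\<And>r. \<lbrakk>r \<in> carrier R; r \<otimes> x \<in> I\<rbrakk> \<Longrightarrow> f (r \<otimes> x) = r \<otimes> y"
  obtains g where "left_linear R (adjoin I x) g"
    "\<And>a r. \<lbrakk>a \<in> I; r \<in> carrier R\<rbrakk> \<Longrightarrow> g (a \<oplus> r \<otimes> x) = f a \<oplus> r \<otimes> y"
proof -
  note ID = left_idealD[OF I] and fD = left_linearD[OF f]
  define g where "g z = (THE w. \<exists>a\<in>I. \<exists>r\<in>carrier R. z = a \<oplus> r \<otimes> x \<and> w = f a \<oplus> r \<otimes> y)" for z
  have g: "g (a \<oplus> r \<otimes> x) = f a \<oplus> r \<otimes> y" if "a \<in> I" "r \<in> carrier R" for a r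
    unfolding g_def
  proof (rule the_equality)
    show "\<exists>a'\<in>I. \<exists>r'\<in>carrier R. a \<oplus> r \<otimes> x = a' \<oplus> r' \<otimes> x \<and> f a \<oplus> r \<otimes> y = f a' \<oplus> r' \<otimes> y"
      using that by blast
    fix w
    assume "\<exists>a'\<in>I. \<exists>r'\<in>carrier R. a \<oplus> r \<otimes> x = a' \<oplus> r' \<otimes> x \<and> w = f a' \<oplus> r' \<otimes> y"
    then obtain a' r' where *: "a' \<in> I" "r' \<in> carrier R" "a \<oplus> r \<otimes> x = a' \<oplus> r' \<otimes> x"
      "w = f a' \<oplus> r' \<otimes> y"
      by blast
    have C: "a \<in> carrier R" "a' \<in> carrier R" "r \<in> carrier R" "r' \<in> carrier R"
      "f a \<in> carrier R" "f a' \<in> carrier R"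
      using that * ID(1) fD(1) by auto
    \<comment> \<open>Two representations of one element differ by a multiple of \<open>x\<close>
      that lies in \<open>I\<close>, and there \<open>rel\<close> compares \<open>f\<close> with
      multiplication by \<open>y\<close>.\<close>
    have "(r' \<ominus> r) \<otimes> x = (a' \<oplus> r' \<otimes> x) \<ominus> a' \<ominus> r \<otimes> x"
      using C x by (simp add: ring_normalize)
    also have "\<dots> = a \<ominus> a'"
      using C x by (simp add: *(3)[symmetric] ring_normalize)
    finally have 1: "(r' \<ominus> r) \<otimes> x = a \<ominus> a'" .
    have "f a \<ominus> f a' = f (a \<ominus> a')"
      using that * fD(2)[of a "\<ominus> a'"] left_linear_minus[OF I f, of a'] left_ideal_minus[OF I, of a']
      by (simp add: minus_eq)
    also have "\<dots> = (r' \<ominus> r) \<otimes> y"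
      using rel[of "r' \<ominus> r"] C 1 left_ideal_diff[OF I, of a a'] that * by simp
    finally have 2: "f a \<ominus> f a' = r' \<otimes> y \<ominus> r \<otimes> y"
      using C y by (simp add: ring_normalize)
    have "f a' \<oplus> r' \<otimes> y = f a' \<oplus> (r' \<otimes> y \<ominus> r \<otimes> y) \<oplus> r \<otimes> y"
      using C y by (simp add: ring_normalize)
    also have "\<dots> = f a' \<oplus> (f a \<ominus> f a') \<oplus> r \<otimes> y"
      by (simp only: 2)
    also have "\<dots> = f a \<oplus> r \<otimes> y"
      using C y by (simp add: ring_normalize)
    finally show "w = f a \<oplus> r \<otimes> y"
      using * by simp
  qed
  have "left_linear R (adjoin I x) g"
    unfolding left_linear_def
  proof (intro conjI ballI)
    show "g \<in> adjoin I x \<rightarrow> carrier R"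
      using g fD(1) y by (auto simp: adjoin_def)
    fix u v
    assume "u \<in> adjoin I x" "v \<in> adjoin I x"
    then obtain a r b s where *: "u = a \<oplus> r \<otimes> x" "v = b \<oplus> s \<otimes> x" "a \<in> I" "b \<in> I"
      "r \<in> carrier R" "s \<in> carrier R"
      unfolding adjoin_def by blast
    have "u \<oplus> v = (a \<oplus> b) \<oplus> (r \<oplus> s) \<otimes> x"
      using * x ID(1) by (simp add: ring_normalize)
    then have "g (u \<oplus> v) = f a \<oplus> f b \<oplus> (r \<oplus> s) \<otimes> y"
      using * ID(3) fD(2) g by simp
    then show "g (u \<oplus> v) = g u \<oplus> g v"
      using * fD(1) y by (simp add: g ring_normalize)
  next
    fix t u
    assume t: "t \<in> carrier R" and "u \<in> adjoin I x"
    then obtain a r where *: "u = a \<oplus> r \<otimes> x" "a \<in> I" "r \<in> carrier R"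
      unfolding adjoin_def by blast
    have "t \<otimes> u = t \<otimes> a \<oplus> (t \<otimes> r) \<otimes> x"
      using * t x ID(1) by (simp add: ring_normalize)
    then have "g (t \<otimes> u) = t \<otimes> f a \<oplus> (t \<otimes> r) \<otimes> y"
      using * t ID(4) fD(3) g by simp
    then show "g (t \<otimes> u) = t \<otimes> g u"
      using * t fD(1) y by (simp add: g ring_normalize)
  qed
  then show thesis
    using that g by blast
qed

end

section \<open>Baer's criterion\<close>

lemma (in left_module) smult_zero_left:
  assumes "x \<in> carrier M"
  shows "\<zero>\<^bsub>R\<^esub> \<odot>\<^bsub>M\<^esub> x = \<zero>\<^bsub>M\<^esub>"
proof -
  have "\<zero>\<^bsub>R\<^esub> \<odot>\<^bsub>M\<^esub> x \<oplus>\<^bsub>M\<^esub> \<zero>\<^bsub>R\<^esub> \<odot>\<^bsub>M\<^esub> x = \<zero>\<^bsub>R\<^esub> \<odot>\<^bsub>M\<^esub> x"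
    using assms smult_l_distr[of "\<zero>\<^bsub>R\<^esub>" "\<zero>\<^bsub>R\<^esub>" x] by simp
  then show ?thesis
    using assms M.add.l_cancel_one'[of "\<zero>\<^bsub>R\<^esub> \<odot>\<^bsub>M\<^esub> x" "\<zero>\<^bsub>R\<^esub> \<odot>\<^bsub>M\<^esub> x"] by auto
qed

lemma (in left_module) smult_minus_one:
  assumes "x \<in> carrier M"
  shows "x \<oplus>\<^bsub>M\<^esub> (\<ominus>\<^bsub>R\<^esub> \<one>\<^bsub>R\<^esub>) \<odot>\<^bsub>M\<^esub> x = \<zero>\<^bsub>M\<^esub>"
  using assms smult_l_distr[of "\<one>\<^bsub>R\<^esub>" "\<ominus>\<^bsub>R\<^esub> \<one>\<^bsub>R\<^esub>" x] smult_zero_left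
  by (simp add: R.r_neg)

lemma module_hom_zero:
  assumes "left_module R M" "left_module R N" "f \<in> module_hom R M N"
  shows "f \<zero>\<^bsub>M\<^esub> = \<zero>\<^bsub>N\<^esub>"
proof -
  interpret M: left_module R M by fact
  interpret N: left_module R N by fact
  have "f \<zero>\<^bsub>M\<^esub> \<in> carrier N"
    using assms(3) unfolding module_hom_def by auto
  moreover have "f (\<zero>\<^bsub>M\<^esub> \<oplus>\<^bsub>M\<^esub> \<zero>\<^bsub>M\<^esub>) = f \<zero>\<^bsub>M\<^esub> \<oplus>\<^bsub>N\<^esub> f \<zero>\<^bsub>M\<^esub>"
    using assms(3) unfolding module_hom_def by blast
  ultimately show ?thesis
    using N.M.add.l_cancel_one'[of "f \<zero>\<^bsub>M\<^esub>" "f \<zero>\<^bsub>M\<^esub>"] by auto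
qed

text \<open>A partial homomorphism from B to R is stored as its graph, so that extension is
  inclusion and a chain is bounded by its union. With closure under sums and multiples,
  single-valuedness only has to be asked over zero, as in the last clause.\<close>

definition hom_graph :: "('a, 'r) ring_scheme \<Rightarrow> ('a, 'b, 'm) module_scheme \<Rightarrow> ('b \<times> 'a) set \<Rightarrow> bool"
  where "hom_graph R B G \<longleftrightarrow>
    G \<subseteq> carrier B \<times> carrier R \<and> (\<zero>\<^bsub>B\<^esub>, \<zero>\<^bsub>R\<^esub>) \<in> G \<and>
    (\<forall>x y x' y'. (x, y) \<in> G \<longrightarrow> (x', y') \<in> G \<longrightarrow> (x \<oplus>\<^bsub>B\<^esub> x', y \<oplus>\<^bsub>R\<^esub> y') \<in> G) \<and>
    (\<forall>r\<in>carrier R. \<forall>x y. (x, y) \<in> G \<longrightarrow> (r \<odot>\<^bsub>B\<^esub> x, r \<otimes>\<^bsub>R\<^esub> y) \<in> G) \<and>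
    (\<forall>y. (\<zero>\<^bsub>B\<^esub>, y) \<in> G \<longrightarrow> y = \<zero>\<^bsub>R\<^esub>)"

lemma hom_graphD:
  assumes "hom_graph R B G"
  shows "(x, y) \<in> G \<Longrightarrow> x \<in> carrier B" "(x, y) \<in> G \<Longrightarrow> y \<in> carrier R"
    "\<lbrakk>(x, y) \<in> G; (x', y') \<in> G\<rbrakk> \<Longrightarrow> (x \<oplus>\<^bsub>B\<^esub> x', y \<oplus>\<^bsub>R\<^esub> y') \<in> G"
    "\<lbrakk>r \<in> carrier R; (x, y) \<in> G\<rbrakk> \<Longrightarrow> (r \<odot>\<^bsub>B\<^esub> x, r \<otimes>\<^bsub>R\<^esub> y) \<in> G"
    "(\<zero>\<^bsub>B\<^esub>, y) \<in> G \<Longrightarrow> y = \<zero>\<^bsub>R\<^esub>" "(\<zero>\<^bsub>B\<^esub>, \<zero>\<^bsub>R\<^esub>) \<in> G"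
  using assms unfolding hom_graph_def by auto

lemma hom_graph_unique:
  assumes "left_module R B" "hom_graph R B G" "(x, y) \<in> G" "(x, y') \<in> G"
  shows "y = y'"
proof -
  interpret B: left_module R B by fact
  note G = hom_graphD[OF assms(2)]
  have m: "\<ominus>\<^bsub>R\<^esub> \<one>\<^bsub>R\<^esub> \<in> carrier R"
    by simp
  have "(x \<oplus>\<^bsub>B\<^esub> (\<ominus>\<^bsub>R\<^esub> \<one>\<^bsub>R\<^esub>) \<odot>\<^bsub>B\<^esub> x, y \<oplus>\<^bsub>R\<^esub> (\<ominus>\<^bsub>R\<^esub> \<one>\<^bsub>R\<^esub>) \<otimes>\<^bsub>R\<^esub> y') \<in> G"
    using assms by (intro G(3) G(4) m)
  then have "y \<oplus>\<^bsub>R\<^esub> (\<ominus>\<^bsub>R\<^esub> \<one>\<^bsub>R\<^esub>) \<otimes>\<^bsub>R\<^esub> y' = \<zero>\<^bsub>R\<^esub>"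
    using G(1)[OF assms(3)] B.smult_minus_one G(5) by simp
  then have "y \<ominus>\<^bsub>R\<^esub> y' = \<zero>\<^bsub>R\<^esub>"
    using G(2)[OF assms(4)] by (simp add: B.R.l_minus B.R.minus_eq)
  then show ?thesis
    using G(2) assms B.R.diff_eq_zeroD by blast
qed

text \<open>The scalars taking \<open>b\<close> into the domain form a left ideal, and sending such
  an r to the value at r b is left linear. By \<open>left_baer\<close> this value is r c for a fixed
  \<open>c\<close>, which is therefore an admissible image of \<open>b\<close>.\<close>

lemma hom_graph_extend:
  assumes B: "left_module R B" and G: "hom_graph R B G" and b: "b \<in> carrier B"
    and baer: "left_baer R"
  obtains G' where "hom_graph R B G'" "G \<subseteq> G'" "b \<in> Domain G'"
proof -
  interpret B: left_module R B by fact
  note GD = hom_graphD[OF G]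
  define I where "I = {r \<in> carrier R. r \<odot>\<^bsub>B\<^esub> b \<in> Domain G}"
  define g where "g r = (THE y. (r \<odot>\<^bsub>B\<^esub> b, y) \<in> G)" for r
  have g_eq: "g r = y" if "(r \<odot>\<^bsub>B\<^esub> b, y) \<in> G" for r y
    unfolding g_def using that hom_graph_unique[OF B G] by blast
  have g: "(r \<odot>\<^bsub>B\<^esub> b, g r) \<in> G" if "r \<in> I" for r
    using that g_eq unfolding I_def by auto
  note zero = GD(6)
  have I: "left_ideal R I"
    unfolding left_ideal_def
  proof (intro conjI ballI)
    show "I \<subseteq> carrier R"
      by (auto simp: I_def)
    show "\<zero>\<^bsub>R\<^esub> \<in> I"
      using zero b by (auto simp: I_def B.smult_zero_left)
  next
    fix r s assume *: "r \<in> I" "s \<in> I"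
    then show "r \<oplus>\<^bsub>R\<^esub> s \<in> I"
      using GD(3)[OF g[OF *(1)] g[OF *(2)]] b by (auto simp: I_def B.smult_l_distr)
  next
    fix a r assume *: "a \<in> carrier R" "r \<in> I"
    then show "a \<otimes>\<^bsub>R\<^esub> r \<in> I"
      using GD(4)[OF *(1) g[OF *(2)]] b by (auto simp: I_def B.smult_assoc)
  qed
  have "left_linear R I g"
    unfolding left_linear_def
  proof (intro conjI ballI)
    show "g \<in> I \<rightarrow> carrier R"
      using g GD(2) by blast
  next
    fix r s assume *: "r \<in> I" "s \<in> I"
    then show "g (r \<oplus>\<^bsub>R\<^esub> s) = g r \<oplus>\<^bsub>R\<^esub> g s"
      using GD(3)[OF g[OF *(1)] g[OF *(2)]] b by (auto simp: I_def B.smult_l_distr intro: g_eq)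
  next
    fix a r assume *: "a \<in> carrier R" "r \<in> I"
    then show "g (a \<otimes>\<^bsub>R\<^esub> r) = a \<otimes>\<^bsub>R\<^esub> g r"
      using GD(4)[OF *(1) g[OF *(2)]] b by (auto simp: I_def B.smult_assoc intro: g_eq)
  qed
  then obtain c where c: "c \<in> carrier R" "\<And>r. r \<in> I \<Longrightarrow> g r = r \<otimes>\<^bsub>R\<^esub> c"
    using left_baerE[OF baer I] by metis
  define G' where "G' = {(x \<oplus>\<^bsub>B\<^esub> r \<odot>\<^bsub>B\<^esub> b, y \<oplus>\<^bsub>R\<^esub> r \<otimes>\<^bsub>R\<^esub> c) |x y r. (x, y) \<in> G \<and> r \<in> carrier R}"
  have G'I: "(x \<oplus>\<^bsub>B\<^esub> r \<odot>\<^bsub>B\<^esub> b, y \<oplus>\<^bsub>R\<^esub> r \<otimes>\<^bsub>R\<^esub> c) \<in> G'" if "(x, y) \<in> G" "r \<in> carrier R" for x y r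
    unfolding G'_def using that by auto
  have "hom_graph R B G'"
    unfolding hom_graph_def
  proof (intro conjI allI impI ballI)
    show "G' \<subseteq> carrier B \<times> carrier R"
      using GD(1,2) b c by (auto simp: G'_def)
  next
    show "(\<zero>\<^bsub>B\<^esub>, \<zero>\<^bsub>R\<^esub>) \<in> G'"
      using G'I[OF zero B.R.zero_closed] b c by (simp add: B.smult_zero_left)
  next
    fix x y x' y' assume "(x, y) \<in> G'" "(x', y') \<in> G'"
    then obtain u v r u' v' r' where *: "x = u \<oplus>\<^bsub>B\<^esub> r \<odot>\<^bsub>B\<^esub> b" "y = v \<oplus>\<^bsub>R\<^esub> r \<otimes>\<^bsub>R\<^esub> c" "(u, v) \<in> G"
      "x' = u' \<oplus>\<^bsub>B\<^esub> r' \<odot>\<^bsub>B\<^esub> b" "y' = v' \<oplus>\<^bsub>R\<^esub> r' \<otimes>\<^bsub>R\<^esub> c" "(u', v') \<in> G" "r \<in> carrier R" "r' \<in> carrier R"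
      unfolding G'_def by blast
    have "x \<oplus>\<^bsub>B\<^esub> x' = (u \<oplus>\<^bsub>B\<^esub> u') \<oplus>\<^bsub>B\<^esub> (r \<oplus>\<^bsub>R\<^esub> r') \<odot>\<^bsub>B\<^esub> b"
      using * GD(1)[OF *(3)] GD(1)[OF *(6)] b by (simp add: B.smult_l_distr B.M.a_ac)
    moreover have "y \<oplus>\<^bsub>R\<^esub> y' = (v \<oplus>\<^bsub>R\<^esub> v') \<oplus>\<^bsub>R\<^esub> (r \<oplus>\<^bsub>R\<^esub> r') \<otimes>\<^bsub>R\<^esub> c"
      using * GD(2)[OF *(3)] GD(2)[OF *(6)] c by (simp add: B.R.l_distr B.R.a_ac)
    ultimately show "(x \<oplus>\<^bsub>B\<^esub> x', y \<oplus>\<^bsub>R\<^esub> y') \<in> G'"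
      using G'I[OF GD(3)[OF *(3,6)]] *(7,8) by simp
  next
    fix a x y assume a: "a \<in> carrier R" and "(x, y) \<in> G'"
    then obtain u v r where *: "x = u \<oplus>\<^bsub>B\<^esub> r \<odot>\<^bsub>B\<^esub> b" "y = v \<oplus>\<^bsub>R\<^esub> r \<otimes>\<^bsub>R\<^esub> c" "(u, v) \<in> G" "r \<in> carrier R"
      unfolding G'_def by blast
    have "a \<odot>\<^bsub>B\<^esub> x = a \<odot>\<^bsub>B\<^esub> u \<oplus>\<^bsub>B\<^esub> (a \<otimes>\<^bsub>R\<^esub> r) \<odot>\<^bsub>B\<^esub> b"
      using a * GD(1)[OF *(3)] b by (simp add: B.smult_r_distr B.smult_assoc)
    moreover have "a \<otimes>\<^bsub>R\<^esub> y = a \<otimes>\<^bsub>R\<^esub> v \<oplus>\<^bsub>R\<^esub> (a \<otimes>\<^bsub>R\<^esub> r) \<otimes>\<^bsub>R\<^esub> c"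
      using a * GD(2)[OF *(3)] c by (simp add: B.R.r_distr B.R.m_assoc)
    ultimately show "(a \<odot>\<^bsub>B\<^esub> x, a \<otimes>\<^bsub>R\<^esub> y) \<in> G'"
      using G'I[OF GD(4)[OF a *(3)]] a *(4) by simp
  next
    fix y assume "(\<zero>\<^bsub>B\<^esub>, y) \<in> G'"
    then obtain u v r where *: "\<zero>\<^bsub>B\<^esub> = u \<oplus>\<^bsub>B\<^esub> r \<odot>\<^bsub>B\<^esub> b" "y = v \<oplus>\<^bsub>R\<^esub> r \<otimes>\<^bsub>R\<^esub> c" "(u, v) \<in> G" "r \<in> carrier R"
      unfolding G'_def by blast
    have m: "\<ominus>\<^bsub>R\<^esub> \<one>\<^bsub>R\<^esub> \<in> carrier R"
      by simp
    have u: "u \<in> carrier B" and v: "v \<in> carrier R"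
      using GD(1,2)[OF *(3)] .
    have "u \<oplus>\<^bsub>B\<^esub> r \<odot>\<^bsub>B\<^esub> b = u \<oplus>\<^bsub>B\<^esub> (\<ominus>\<^bsub>R\<^esub> \<one>\<^bsub>R\<^esub>) \<odot>\<^bsub>B\<^esub> u"
      using B.smult_minus_one[OF u] *(1) by simp
    then have "r \<odot>\<^bsub>B\<^esub> b = (\<ominus>\<^bsub>R\<^esub> \<one>\<^bsub>R\<^esub>) \<odot>\<^bsub>B\<^esub> u"
      using u b *(4) B.smult_closed[OF m u] by simp
    then have rG: "(r \<odot>\<^bsub>B\<^esub> b, \<ominus>\<^bsub>R\<^esub> v) \<in> G"
      using GD(4)[OF m *(3)] v by (simp add: B.R.l_minus)
    then have "r \<in> I"
      using *(4) by (auto simp: I_def)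
    then have "r \<otimes>\<^bsub>R\<^esub> c = \<ominus>\<^bsub>R\<^esub> v"
      using c(2) g_eq[OF rG] by simp
    then show "y = \<zero>\<^bsub>R\<^esub>"
      using *(2) v by (simp add: B.R.r_neg)
  qed
  moreover have "G \<subseteq> G'"
  proof clarify
    fix x y assume xy: "(x, y) \<in> G"
    then show "(x, y) \<in> G'"
      using G'I[OF xy B.R.zero_closed] GD(1,2)[OF xy] b c by (simp add: B.smult_zero_left)
  qed
  moreover have "b \<in> Domain G'"
    using G'I[OF zero B.R.one_closed] b by auto
  ultimately show thesis
    using that by blast
qed

theorem baer_criterion:
  assumes R: "ring R" and baer: "left_baer R"
  shows "left_self_injective TYPE('b) TYPE('c) R"
  unfolding left_self_injective_def injective_module_def
proof (intro conjI allI impI)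
  show "left_module R (regular_module R)"
    by (rule left_module_regular_module[OF R])
next
  fix A :: "('a, 'b) module" and B :: "('a, 'c) module" and i f
  assume *: "left_module R A \<and> left_module R B \<and> i \<in> module_hom R A B \<and>
    inj_on i (carrier A) \<and> f \<in> module_hom R A (regular_module R)"
  then have A: "left_module R A" and B: "left_module R B" by auto
  interpret A: left_module R A by fact
  interpret B: left_module R B by fact
  have i: "i \<in> module_hom R A B" "inj_on i (carrier A)"
    and f: "f \<in> module_hom R A (regular_module R)" using * by auto
  have iD: "\<And>x. x \<in> carrier A \<Longrightarrow> i x \<in> carrier B"
    "\<And>x y. \<lbrakk>x \<in> carrier A; y \<in> carrier A\<rbrakk> \<Longrightarrow> i (x \<oplus>\<^bsub>A\<^esub> y) = i x \<oplus>\<^bsub>B\<^esub> i y"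
    "\<And>a x. \<lbrakk>a \<in> carrier R; x \<in> carrier A\<rbrakk> \<Longrightarrow> i (a \<odot>\<^bsub>A\<^esub> x) = a \<odot>\<^bsub>B\<^esub> i x"
    using i unfolding module_hom_def by auto
  have fD: "\<And>x. x \<in> carrier A \<Longrightarrow> f x \<in> carrier R"
    "\<And>x y. \<lbrakk>x \<in> carrier A; y \<in> carrier A\<rbrakk> \<Longrightarrow> f (x \<oplus>\<^bsub>A\<^esub> y) = f x \<oplus>\<^bsub>R\<^esub> f y"
    "\<And>a x. \<lbrakk>a \<in> carrier R; x \<in> carrier A\<rbrakk> \<Longrightarrow> f (a \<odot>\<^bsub>A\<^esub> x) = a \<otimes>\<^bsub>R\<^esub> f x"
    using f unfolding module_hom_def by auto
  have i0: "i \<zero>\<^bsub>A\<^esub> = \<zero>\<^bsub>B\<^esub>" and f0: "f \<zero>\<^bsub>A\<^esub> = \<zero>\<^bsub>R\<^esub>"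
    using module_hom_zero[OF A B i(1)] module_hom_zero[OF A left_module_regular_module[OF R] f] by auto
  \<comment> \<open>This is \<open>f\<close> transported to the image of \<open>i\<close>;
    injectivity of \<open>i\<close> gives the clause on the fibre over zero. A maximal graph above
    it has full domain by \<open>hom_graph_extend\<close>.\<close>
  define G0 where "G0 = {(i a, f a) |a. a \<in> carrier A}"
  have G0I: "(i a, f a) \<in> G0" if "a \<in> carrier A" for a
    using that unfolding G0_def by blast
  have G0: "hom_graph R B G0"
    unfolding hom_graph_def
  proof (intro conjI allI impI ballI)
    show "G0 \<subseteq> carrier B \<times> carrier R"
      using iD(1) fD(1) by (auto simp: G0_def)
  next
    show "(\<zero>\<^bsub>B\<^esub>, \<zero>\<^bsub>R\<^esub>) \<in> G0"
      using G0I[OF A.M.zero_closed] i0 f0 by simp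
  next
    fix x y x' y' assume "(x, y) \<in> G0" "(x', y') \<in> G0"
    then obtain a a' where "x = i a" "y = f a" "x' = i a'" "y' = f a'" "a \<in> carrier A" "a' \<in> carrier A"
      unfolding G0_def by blast
    then show "(x \<oplus>\<^bsub>B\<^esub> x', y \<oplus>\<^bsub>R\<^esub> y') \<in> G0"
      using G0I[of "a \<oplus>\<^bsub>A\<^esub> a'"] iD(2) fD(2) by simp
  next
    fix r x y assume "r \<in> carrier R" "(x, y) \<in> G0"
    then obtain a where "x = i a" "y = f a" "a \<in> carrier A" "r \<in> carrier R"
      unfolding G0_def by blast
    then show "(r \<odot>\<^bsub>B\<^esub> x, r \<otimes>\<^bsub>R\<^esub> y) \<in> G0"
      using G0I[of "r \<odot>\<^bsub>A\<^esub> a"] iD(3) fD(3) by simp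
  next
    fix y assume "(\<zero>\<^bsub>B\<^esub>, y) \<in> G0"
    then obtain a where a: "\<zero>\<^bsub>B\<^esub> = i a" "y = f a" "a \<in> carrier A"
      unfolding G0_def by blast
    then have "a = \<zero>\<^bsub>A\<^esub>"
      using i(2) i0 by (auto simp: inj_on_def)
    then show "y = \<zero>\<^bsub>R\<^esub>"
      using a f0 by simp
  qed
  have "\<exists>M\<in>{G. hom_graph R B G \<and> G0 \<subseteq> G}. \<forall>X\<in>{G. hom_graph R B G \<and> G0 \<subseteq> G}. M \<subseteq> X \<longrightarrow> X = M"
  proof (rule subset_Zorn_nonempty)
    show "{G. hom_graph R B G \<and> G0 \<subseteq> G} \<noteq> {}"
      using G0 by auto
    fix \<C> assume ne: "\<C> \<noteq> {}" and ch: "subset.chain {G. hom_graph R B G \<and> G0 \<subseteq> G} \<C>"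
    then have C: "\<And>G. G \<in> \<C> \<Longrightarrow> hom_graph R B G \<and> G0 \<subseteq> G"
      and lin: "\<And>G H. \<lbrakk>G \<in> \<C>; H \<in> \<C>\<rbrakk> \<Longrightarrow> G \<subseteq> H \<or> H \<subseteq> G"
      by (auto simp: subset_chain_def)
    have CD: "G \<in> \<C> \<Longrightarrow> hom_graph R B G" for G
      using C by blast
    have "hom_graph R B (\<Union>\<C>)"
      unfolding hom_graph_def
    proof (intro conjI allI impI ballI)
      show "\<Union>\<C> \<subseteq> carrier B \<times> carrier R"
      proof clarify
        fix x y G assume "(x, y) \<in> G" "G \<in> \<C>"
        then show "x \<in> carrier B \<and> y \<in> carrier R"
          using hom_graphD(1,2)[OF CD] by blast
      qed
    next
      show "(\<zero>\<^bsub>B\<^esub>, \<zero>\<^bsub>R\<^esub>) \<in> \<Union>\<C>"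
        using hom_graphD(6)[OF CD] ne by blast
    next
      fix x y x' y' assume "(x, y) \<in> \<Union>\<C>" "(x', y') \<in> \<Union>\<C>"
      then obtain G H where "G \<in> \<C>" "(x, y) \<in> G" "H \<in> \<C>" "(x', y') \<in> H"
        by blast
      then obtain G where "G \<in> \<C>" "(x, y) \<in> G" "(x', y') \<in> G"
        using lin[of G H] by blast
      then show "(x \<oplus>\<^bsub>B\<^esub> x', y \<oplus>\<^bsub>R\<^esub> y') \<in> \<Union>\<C>"
        using hom_graphD(3)[OF CD] by blast
    next
      fix r x y assume "r \<in> carrier R" "(x, y) \<in> \<Union>\<C>"
      then show "(r \<odot>\<^bsub>B\<^esub> x, r \<otimes>\<^bsub>R\<^esub> y) \<in> \<Union>\<C>"
        using hom_graphD(4)[OF CD] by blast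
    next
      fix y assume "(\<zero>\<^bsub>B\<^esub>, y) \<in> \<Union>\<C>"
      then show "y = \<zero>\<^bsub>R\<^esub>"
        using hom_graphD(5)[OF CD] by blast
    qed
    then show "\<Union>\<C> \<in> {G. hom_graph R B G \<and> G0 \<subseteq> G}"
      using C ne by blast
  qed
  then obtain G where G_mem: "G \<in> {G. hom_graph R B G \<and> G0 \<subseteq> G}"
    and G_max: "\<forall>X\<in>{G. hom_graph R B G \<and> G0 \<subseteq> G}. G \<subseteq> X \<longrightarrow> X = G"
    by (elim bexE)
  have G: "hom_graph R B G" "G0 \<subseteq> G"
    using G_mem by simp_all
  have max: "X = G" if "hom_graph R B X" "G0 \<subseteq> X" "G \<subseteq> X" for X
    using G_max that by simp
  note GD = hom_graphD[OF G(1)]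
  define g where "g x = (THE y. (x, y) \<in> G)" for x
  have g_eq: "g x = y" if "(x, y) \<in> G" for x y
    unfolding g_def using that hom_graph_unique[OF B G(1)] by blast
  have g: "(b, g b) \<in> G" if b: "b \<in> carrier B" for b
  proof -
    obtain X where X: "hom_graph R B X" "G \<subseteq> X" "b \<in> Domain X"
      using hom_graph_extend[OF B G(1) b baer] by blast
    then have "X = G"
      using max G(2) by blast
    then show ?thesis
      using X g_eq by auto
  qed
  have "g \<in> module_hom R B (regular_module R)"
    unfolding module_hom_def
  proof (intro CollectI conjI ballI)
    show "g \<in> carrier B \<rightarrow> carrier (regular_module R)"
      using g GD(2) by auto
  next
    fix x y assume "x \<in> carrier B" "y \<in> carrier B"
    then show "g (x \<oplus>\<^bsub>B\<^esub> y) = g x \<oplus>\<^bsub>regular_module R\<^esub> g y"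
      using GD(3)[OF g g] g_eq by simp
  next
    fix a x assume "a \<in> carrier R" "x \<in> carrier B"
    then show "g (a \<odot>\<^bsub>B\<^esub> x) = a \<odot>\<^bsub>regular_module R\<^esub> g x"
      using GD(4)[OF _ g] g_eq by simp
  qed
  moreover have "g (i x) = f x" if "x \<in> carrier A" for x
    using g_eq G(2) G0I[OF that] by blast
  ultimately show "\<exists>g\<in>module_hom R B (regular_module R). \<forall>x\<in>carrier A. g (i x) = f x"
    by blast
qed

section \<open>Semiprimary rings\<close>

text \<open>A power of an ideal is additively generated by these products, so it vanishes exactly
  when they all do. Nilpotency can thus be stated without forming sums.\<close>

fun products :: "('a, 'r) ring_scheme \<Rightarrow> 'a set \<Rightarrow> nat \<Rightarrow> 'a set"
  where "products R X 0 = {\<one>\<^bsub>R\<^esub>}"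
  | "products R X (Suc k) = {x \<otimes>\<^bsub>R\<^esub> p |x p. x \<in> X \<and> p \<in> products R X k}"

lemma left_artinian_minimal:
  assumes "ring R" "left_artinian R" and S: "\<And>I. I \<in> S \<Longrightarrow> left_ideal R I" and "I\<^sub>0 \<in> S"
  shows "\<exists>I\<in>S. \<forall>K\<in>S. K \<subseteq> I \<longrightarrow> K = I"
proof -
  interpret ring R by fact
  show ?thesis
  proof (rule ccontr)
    assume neg: "\<not> (\<exists>I\<in>S. \<forall>K\<in>S. K \<subseteq> I \<longrightarrow> K = I)"
    have "\<exists>f. \<forall>n. f n \<in> S \<and> f (Suc n) \<subset> f n"
      using neg \<open>I\<^sub>0 \<in> S\<close> by (intro dependent_nat_choice) blast+
    then obtain f where f: "\<And>n. f n \<in> S" "\<And>n. f (Suc n) \<subset> f n"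
      by blast
    have "(\<forall>k. submodule (f k) R (regular_module R)) \<and> (\<forall>k. f (Suc k) \<subseteq> f k)"
      using S[OF f(1)] f(2) submodule_iff_left_ideal by auto
    then have "\<exists>n. \<forall>k\<ge>n. f k = f n"
      by (rule assms(2)[unfolded left_artinian_def artinian_module_def, THEN spec, THEN mp])
    then obtain n where n: "\<forall>k\<ge>n. f k = f n" ..
    have "f (Suc n) = f n"
      using n[THEN spec, of "Suc n"] by simp
    then show False
      using f(2)[of n] by simp
  qed
qed

context ring
begin

lemma right_idealD:
  assumes "right_ideal R I"
  shows "x \<in> I \<Longrightarrow> x \<in> carrier R" "\<zero> \<in> I" "\<lbrakk>x \<in> I; y \<in> I\<rbrakk> \<Longrightarrow> x \<oplus> y \<in> I"
    "\<lbrakk>a \<in> carrier R; x \<in> I\<rbrakk> \<Longrightarrow> x \<otimes> a \<in> I"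
  using assms unfolding left_ideal_def by auto

text \<open>Equality in R/I expressed on representatives, used in place of a quotient ring.\<close>

definition cong_mod :: "'a set \<Rightarrow> 'a \<Rightarrow> 'a \<Rightarrow> bool"
  where "cong_mod I x y \<longleftrightarrow> x \<in> carrier R \<and> y \<in> carrier R \<and> x \<ominus> y \<in> I"

lemma cong_mod_refl: "\<lbrakk>left_ideal R I; x \<in> carrier R\<rbrakk> \<Longrightarrow> cong_mod I x x"
  using left_idealD(2) by (simp add: cong_mod_def ring_normalize)

lemma cong_mod_sym: "\<lbrakk>left_ideal R I; cong_mod I x y\<rbrakk> \<Longrightarrow> cong_mod I y x"
  using left_ideal_minus[of I "x \<ominus> y"] by (simp add: cong_mod_def ring_normalize)

lemma cong_mod_trans:
  assumes "left_ideal R I" "cong_mod I x y" "cong_mod I y z"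
  shows "cong_mod I x z"
proof -
  have "x \<ominus> z = (x \<ominus> y) \<oplus> (y \<ominus> z)"
    using assms by (simp add: cong_mod_def ring_normalize)
  then show ?thesis
    using assms left_idealD(3)[OF assms(1)] by (auto simp: cong_mod_def)
qed

lemma cong_mod_mult_left:
  assumes "left_ideal R I" "cong_mod I x y" "a \<in> carrier R"
  shows "cong_mod I (a \<otimes> x) (a \<otimes> y)"
proof -
  have "a \<otimes> x \<ominus> a \<otimes> y = a \<otimes> (x \<ominus> y)"
    using assms by (simp add: cong_mod_def ring_normalize)
  then show ?thesis
    using assms left_idealD(4)[OF assms(1)] by (auto simp: cong_mod_def)
qed

lemma cong_mod_mult_right:
  assumes "right_ideal R I" "cong_mod I x y" "a \<in> carrier R"
  shows "cong_mod I (x \<otimes> a) (y \<otimes> a)"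
proof -
  have "x \<otimes> a \<ominus> y \<otimes> a = (x \<ominus> y) \<otimes> a"
    using assms by (simp add: cong_mod_def ring_normalize)
  then show ?thesis
    using assms right_idealD(4)[OF assms(1)] by (auto simp: cong_mod_def)
qed

lemma cong_mod_mem:
  assumes "left_ideal R I" "cong_mod I x y"
  shows "x \<in> I \<longleftrightarrow> y \<in> I"
  using assms(2) left_ideal_diffD[OF assms(1), of y x] left_ideal_diffD'[OF assms(1), of x y]
  by (auto simp: cong_mod_def)

lemma products_closed: "X \<subseteq> carrier R \<Longrightarrow> products R X k \<subseteq> carrier R"
  by (induction k) auto

lemma products_add:
  assumes "X \<subseteq> carrier R"
  shows "products R X (k + l) = {p \<otimes> q |p q. p \<in> products R X k \<and> q \<in> products R X l}"
proof (induction k)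
  case 0
  then show ?case
    using products_closed[OF assms, of l] by (force simp: subset_iff)
next
  case (Suc k)
  have "products R X (Suc k + l) =
    {x \<otimes> (p \<otimes> q) |x p q. x \<in> X \<and> p \<in> products R X k \<and> q \<in> products R X l}"
    using Suc by auto
  also have "\<dots> = {(x \<otimes> p) \<otimes> q |x p q. x \<in> X \<and> p \<in> products R X k \<and> q \<in> products R X l}"
    using assms products_closed[OF assms, of k] products_closed[OF assms, of l]
    by (auto simp: subset_iff) (metis m_assoc)+
  finally show ?case
    by auto
qed

lemma products_Suc_right:
  assumes "X \<subseteq> carrier R"
  shows "products R X (Suc k) = {p \<otimes> x |p x. p \<in> products R X k \<and> x \<in> X}"
proof -
  have "products R X (Suc 0) = X"
    using assms by (force simp: subset_iff)
  then show ?thesis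
    using products_add[OF assms, of k "Suc 0"] by simp
qed

lemma products_opposite:
  assumes "X \<subseteq> carrier R"
  shows "products (opposite_ring R) X k = products R X k"
proof (induction k)
  case (Suc k)
  then show ?case
    unfolding products_Suc_right[OF assms] by auto
qed simp

end

text \<open>In R/J each element of \<open>E\<close> is a nonzero idempotent that generates a minimal
  left and a minimal right ideal. By \<open>one_generated\<close>, 1 is an integer combination of
  \<open>E\<close> modulo \<open>J\<close>, so R/J is the sum of these minimal ideals on either
  side. That assumption is phrased with additive subgroups so that it reads the same in the opposite
  ring.\<close>

locale semiprimary = ring +
  fixes J E :: "'a set"
  assumes J_left: "left_ideal R J"
    and J_right: "right_ideal R J"
    and nilpotent: "\<exists>n. products R J n \<subseteq> {\<zero>}"
    and E_finite: "finite E"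
    and E_closed: "E \<subseteq> carrier R"
    and E_notin: "e \<in> E \<Longrightarrow> e \<notin> J"
    and E_idem: "e \<in> E \<Longrightarrow> cong_mod J (e \<otimes> e) e"
    and E_left_simple: "\<lbrakk>e \<in> E; r \<in> carrier R; r \<otimes> e \<notin> J\<rbrakk> \<Longrightarrow>
      \<exists>s\<in>carrier R. cong_mod J (s \<otimes> (r \<otimes> e)) e"
    and E_right_simple: "\<lbrakk>e \<in> E; r \<in> carrier R; e \<otimes> r \<notin> J\<rbrakk> \<Longrightarrow>
      \<exists>s\<in>carrier R. cong_mod J ((e \<otimes> r) \<otimes> s) e"
    and one_generated: "\<lbrakk>subgroup G (add_monoid R); J \<subseteq> G; E \<subseteq> G\<rbrakk> \<Longrightarrow> \<one> \<in> G"

lemma (in ring) opposite_ring: "ring (opposite_ring R)"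
  by (rule ring_opposite_ring[OF ring_axioms])

lemma (in ring) cong_mod_opposite: "ring.cong_mod (opposite_ring R) = cong_mod"
  by (simp add: fun_eq_iff cong_mod_def ring.cong_mod_def[OF opposite_ring])

lemma (in semiprimary) opposite: "semiprimary (opposite_ring R) J E"
proof -
  have "J \<subseteq> carrier R"
    using J_left by (simp add: left_ideal_def)
  note prods = products_opposite[OF this]
  show ?thesis
  proof (intro semiprimary.intro semiprimary_axioms.intro)
    show "ring (opposite_ring R)"
      by (rule opposite_ring)
    show "left_ideal (opposite_ring (opposite_ring R)) J"
      using J_left by simp
    show "\<exists>n. products (opposite_ring R) J n \<subseteq> {\<zero>\<^bsub>opposite_ring R\<^esub>}"
      using nilpotent by (simp add: prods)
  qed (use J_right E_finite E_closed E_notin E_idem E_left_simple E_right_simple one_generated in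
      \<open>simp_all add: cong_mod_opposite\<close>)
qed

section \<open>Artinian rings are semiprimary\<close>

context ring
begin

definition maximal_left :: "'a set \<Rightarrow> bool"
  where "maximal_left m \<longleftrightarrow>
    left_ideal R m \<and> \<one> \<notin> m \<and> (\<forall>x\<in>carrier R. x \<notin> m \<longrightarrow> \<one> \<in> adjoin m x)"

definition jacobson :: "'a set"
  where "jacobson = {x \<in> carrier R. \<forall>m. maximal_left m \<longrightarrow> x \<in> m}"

lemma exists_maximal_left:
  assumes I: "left_ideal R I" "\<one> \<notin> I"
  obtains m where "maximal_left m" "I \<subseteq> m"
proof -
  let ?A = "{K. left_ideal R K \<and> \<one> \<notin> K \<and> I \<subseteq> K}"
  have "\<exists>M\<in>?A. \<forall>X\<in>?A. M \<subseteq> X \<longrightarrow> X = M"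
  proof (rule subset_Zorn_nonempty)
    show "?A \<noteq> {}"
      using I by auto
    fix \<C> assume ne: "\<C> \<noteq> {}" and "subset.chain ?A \<C>"
    then have C: "\<And>K. K \<in> \<C> \<Longrightarrow> left_ideal R K \<and> \<one> \<notin> K \<and> I \<subseteq> K"
      and lin: "\<And>K L. \<lbrakk>K \<in> \<C>; L \<in> \<C>\<rbrakk> \<Longrightarrow> K \<subseteq> L \<or> L \<subseteq> K"
      by (auto simp: subset_chain_def)
    have C': "left_ideal R K" if "K \<in> \<C>" for K
      using C[OF that] by simp
    have "left_ideal R (\<Union>\<C>)"
      unfolding left_ideal_def
    proof (intro conjI ballI)
      show "\<Union>\<C> \<subseteq> carrier R"
      proof (rule Union_least)
        fix K assume "K \<in> \<C>"
        then show "K \<subseteq> carrier R"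
          using C'[of K] by (simp add: left_ideal_def)
      qed
      show "\<zero> \<in> \<Union>\<C>"
        using left_idealD(2)[OF C'] ne by auto
      show "x \<oplus> y \<in> \<Union>\<C>" if xy: "x \<in> \<Union>\<C>" "y \<in> \<Union>\<C>" for x y
      proof -
        obtain K L where KL: "K \<in> \<C>" "x \<in> K" "L \<in> \<C>" "y \<in> L"
          using xy by (elim UnionE)
        have "K \<subseteq> L \<or> L \<subseteq> K"
          using lin KL by simp
        then obtain M where "M \<in> \<C>" "x \<in> M" "y \<in> M"
          using KL by (elim disjE) auto
        then show ?thesis
          using left_idealD(3)[OF C', of M x y] by blast
      qed
      show "a \<otimes> x \<in> \<Union>\<C>" if ax: "a \<in> carrier R" "x \<in> \<Union>\<C>" for a x
      proof -
        obtain K where "K \<in> \<C>" "x \<in> K"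
          using ax(2) by (elim UnionE)
        then show ?thesis
          using left_idealD(4)[OF C', of K a x] ax(1) by blast
      qed
    qed
    then show "\<Union>\<C> \<in> ?A"
      using C ne by auto
  qed
  then obtain m where m: "m \<in> ?A" "\<forall>X\<in>?A. m \<subseteq> X \<longrightarrow> X = m"
    by (elim bexE)
  have "\<one> \<in> adjoin m x" if x: "x \<in> carrier R" "x \<notin> m" for x
  proof (rule ccontr)
    assume *: "\<one> \<notin> adjoin m x"
    have lm: "left_ideal R m"
      using m(1) by simp
    have "adjoin m x \<in> ?A"
      using * m(1) left_ideal_adjoin[OF lm x(1)] adjoin_base[OF lm x(1)] by auto
    then have "adjoin m x = m"
      using m(2) adjoin_base[OF lm x(1)] by simp
    then show False
      using adjoin_elem[OF lm x(1)] x(2) by simp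
  qed
  then show thesis
    using m(1) by (intro that[of m]) (auto simp: maximal_left_def)
qed

lemma maximal_leftD:
  assumes "maximal_left m"
  shows "left_ideal R m" "\<one> \<notin> m"
  using assms by (auto simp: maximal_left_def)

lemma maximal_leftE:
  assumes "maximal_left m" "x \<in> carrier R" "x \<notin> m"
  obtains r where "r \<in> carrier R" "\<one> \<ominus> r \<otimes> x \<in> m"
proof -
  have "\<one> \<in> adjoin m x"
    using assms by (auto simp: maximal_left_def)
  then obtain a r where *: "a \<in> m" "r \<in> carrier R" "\<one> = a \<oplus> r \<otimes> x"
    unfolding adjoin_def by blast
  then have "\<one> \<ominus> r \<otimes> x = a"
    using assms left_idealD(1)[OF maximal_leftD(1)[OF assms(1)] *(1)] by (simp add: ring_normalize)
  then show thesis
    using * that by simp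
qed

lemma jacobsonD: "\<lbrakk>x \<in> jacobson; maximal_left m\<rbrakk> \<Longrightarrow> x \<in> m"
  by (simp add: jacobson_def)

lemma left_ideal_jacobson: "left_ideal R jacobson"
  unfolding left_ideal_def jacobson_def
  using left_idealD[OF maximal_leftD(1)] by auto

text \<open>For \<open>r\<close> outside \<open>m\<close>, the map taking y to y r from R to the
  simple module R/m is onto. Its kernel \<open>m'\<close> is again a maximal left ideal, so it
  contains \<open>x\<close>.\<close>

lemma right_ideal_jacobson: "right_ideal R jacobson"
proof -
  have "x \<otimes> r \<in> m" if x: "x \<in> jacobson" and r: "r \<in> carrier R" and m: "maximal_left m" for x r m
  proof (cases "r \<in> m")
    case True
    then show ?thesis
      using left_idealD(4)[OF maximal_leftD(1)[OF m]] left_idealD(1)[OF left_ideal_jacobson x] by simp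
  next
    case False
    note lm = left_idealD[OF maximal_leftD(1)[OF m]]
    define m' where "m' = {y \<in> carrier R. y \<otimes> r \<in> m}"
    have lm': "left_ideal R m'"
      using lm r by (auto simp: left_ideal_def m'_def l_distr m_assoc)
    have "\<one> \<in> adjoin m' y" if y: "y \<in> carrier R" "y \<notin> m'" for y
    proof -
      have "y \<otimes> r \<notin> m"
        using y by (simp add: m'_def)
      then obtain t where t: "t \<in> carrier R" "\<one> \<ominus> t \<otimes> (y \<otimes> r) \<in> m"
        using maximal_leftE[OF m, of "y \<otimes> r"] y r by auto
      have "r \<otimes> (\<one> \<ominus> t \<otimes> (y \<otimes> r)) \<in> m"
        using t r by (intro lm(4))
      moreover have "(\<one> \<ominus> r \<otimes> t \<otimes> y) \<otimes> r = r \<otimes> (\<one> \<ominus> t \<otimes> (y \<otimes> r))"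
        using t r y by (simp add: ring_normalize)
      ultimately have "\<one> \<ominus> r \<otimes> t \<otimes> y \<in> m'"
        using t r y by (simp add: m'_def)
      moreover have "\<one> = (\<one> \<ominus> r \<otimes> t \<otimes> y) \<oplus> (r \<otimes> t) \<otimes> y"
        using t r y by (simp add: ring_normalize)
      ultimately show ?thesis
        using t r unfolding adjoin_def by blast
    qed
    then have "maximal_left m'"
      using lm' False r by (auto simp: maximal_left_def m'_def)
    then have "x \<in> m'"
      using x jacobsonD by blast
    then show ?thesis
      by (simp add: m'_def)
  qed
  then have "x \<otimes> r \<in> jacobson" if "x \<in> jacobson" "r \<in> carrier R" for x r
    using that by (simp add: jacobson_def)
  then show ?thesis
    using left_ideal_jacobson by (simp add: left_ideal_def)
qed

text \<open>If R(1 - j) were proper, a maximal left ideal above it would contain both j and 1 - j.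
  So 1 - j is left invertible and can be cancelled from (1 - j) x = 0.\<close>

lemma jacobson_quasiregular:
  assumes "j \<in> jacobson" "x \<in> carrier R" "j \<otimes> x = x"
  shows "x = \<zero>"
proof -
  have j: "j \<in> carrier R"
    using assms(1) by (simp add: jacobson_def)
  let ?I = "{a \<otimes> (\<one> \<ominus> j) |a. a \<in> carrier R}"
  have I: "left_ideal R ?I"
    using j by (intro left_ideal_mult left_ideal_carrier) auto
  have "\<one> \<in> ?I"
  proof (rule ccontr)
    assume "\<one> \<notin> ?I"
    then obtain m where m: "maximal_left m" "?I \<subseteq> m"
      using exists_maximal_left[OF I] by blast
    have "\<one> \<ominus> j = \<one> \<otimes> (\<one> \<ominus> j)"
      using j by simp
    then have "\<one> \<ominus> j \<in> m"
      using m(2) one_closed by blast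
    then have "\<one> \<in> m"
      using left_ideal_diffD[OF maximal_leftD(1)[OF m(1)] jacobsonD[OF assms(1) m(1)]] by simp
    then show False
      using maximal_leftD(2)[OF m(1)] by simp
  qed
  then obtain a where a: "a \<in> carrier R" "\<one> = a \<otimes> (\<one> \<ominus> j)"
    by blast
  have "x = a \<otimes> (\<one> \<ominus> j) \<otimes> x"
    using assms(2) a(2)[symmetric] by simp
  also have "\<dots> = a \<otimes> (x \<ominus> j \<otimes> x)"
    using assms(2) j a(1) by (simp add: ring_normalize)
  finally show ?thesis
    using assms(2,3) a(1) by (simp add: ring_normalize)
qed

text \<open>If x is outside a maximal left ideal m, some 1 - r x lies in m, and the identity (1 + r
  x)(1 - r x) + r (x r x) = 1 puts 1 into m.\<close>

lemma jacobson_semiprime: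
  assumes x: "x \<in> carrier R" and "\<And>r. r \<in> carrier R \<Longrightarrow> x \<otimes> r \<otimes> x \<in> jacobson"
  shows "x \<in> jacobson"
proof -
  have "x \<in> m" if m: "maximal_left m" for m
  proof (rule ccontr)
    assume "x \<notin> m"
    then obtain r where r: "r \<in> carrier R" "\<one> \<ominus> r \<otimes> x \<in> m"
      using maximal_leftE[OF m x] by blast
    note lm = left_idealD[OF maximal_leftD(1)[OF m]]
    have "(\<one> \<oplus> r \<otimes> x) \<otimes> (\<one> \<ominus> r \<otimes> x) \<in> m"
      using r x by (intro lm(4)) auto
    moreover have "r \<otimes> (x \<otimes> r \<otimes> x) \<in> m"
      by (rule lm(4)[OF r(1) jacobsonD[OF assms(2)[OF r(1)] m]])
    ultimately have "(\<one> \<oplus> r \<otimes> x) \<otimes> (\<one> \<ominus> r \<otimes> x) \<oplus> r \<otimes> (x \<otimes> r \<otimes> x) \<in> m"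
      by (rule lm(3))
    moreover have "(\<one> \<oplus> r \<otimes> x) \<otimes> (\<one> \<ominus> r \<otimes> x) \<oplus> r \<otimes> (x \<otimes> r \<otimes> x) = \<one>"
      using r x by (simp add: ring_normalize)
    ultimately show False
      using maximal_leftD(2)[OF m] by simp
  qed
  then show ?thesis
    using x by (simp add: jacobson_def)
qed

text \<open>\<open>N k\<close> is the left ideal generated by the products of length
  \<open>k\<close>, that is, the power J^k. If a stable power J^n were nonzero, take
  \<open>L\<close> minimal among the left ideals that it does not kill, and \<open>x\<close> in
  \<open>L\<close> not killed. Stability makes J^n x another such ideal, hence equal to
  \<open>L\<close>, so x = a x with \<open>a\<close> in the radical, which forces x = 0.\<close>

lemma jacobson_nilpotent:
  assumes art: "left_artinian R"
  shows "\<exists>n. products R jacobson n \<subseteq> {\<zero>}"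
proof -
  have JR: "jacobson \<subseteq> carrier R"
    by (auto simp: jacobson_def)
  note PR = products_closed[OF JR]
  define N where "N k = \<Inter>{I. left_ideal R I \<and> products R jacobson k \<subseteq> I}" for k
  have N_sub: "N k \<subseteq> I" if "left_ideal R I" "products R jacobson k \<subseteq> I" for k I
    using that unfolding N_def by blast
  have P_N: "products R jacobson k \<subseteq> N k" for k
    unfolding N_def by blast
  have N_R: "N k \<subseteq> carrier R" for k
    using N_sub[OF left_ideal_carrier PR] .
  have N: "left_ideal R (N k)" for k
  proof -
    have "\<zero> \<in> N k"
      unfolding N_def using left_idealD(2) by blast
    moreover have "x \<oplus> y \<in> N k" if "x \<in> N k" "y \<in> N k" for x y
      using that left_idealD(3) unfolding N_def by blast
    moreover have "a \<otimes> x \<in> N k" if "a \<in> carrier R" "x \<in> N k" for a x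
      using that left_idealD(4) unfolding N_def by blast
    ultimately show ?thesis
      using N_R unfolding left_ideal_def by blast
  qed
  have dec1: "N (Suc k) \<subseteq> N k" for k
  proof (rule N_sub[OF N])
    show "products R jacobson (Suc k) \<subseteq> N k"
    proof clarsimp
      fix x p assume "x \<in> jacobson" "p \<in> products R jacobson k"
      then show "x \<otimes> p \<in> N k"
        using P_N[of k] JR by (intro left_idealD(4)[OF N]) auto
    qed
  qed
  have dec: "N (k + l) \<subseteq> N k" for k l
    by (induction l) (use dec1 in auto)
  have "\<exists>I\<in>range N. \<forall>K\<in>range N. K \<subseteq> I \<longrightarrow> K = I"
    using N by (intro left_artinian_minimal[OF ring_axioms art, of _ "N 0"]) auto
  then obtain m where I: "\<And>k. N k \<subseteq> N m \<Longrightarrow> N k = N m"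
    by auto
  \<comment> \<open>The shift makes the length positive, which puts \<open>N n\<close> inside
    \<open>jacobson\<close>; the empty product is 1.\<close>
  define n where "n = Suc m"
  have stable: "N (n + n) = N n"
    using I[of n] I[of "n + n"] dec[of m "Suc 0"] dec[of m "Suc n"]
    by (simp add: n_def)
  have N_J: "N n \<subseteq> jacobson"
  proof (rule N_sub[OF left_ideal_jacobson])
    show "products R jacobson n \<subseteq> jacobson"
      using PR[of m] right_idealD(4)[OF right_ideal_jacobson] by (auto simp: n_def)
  qed
  have "p = \<zero>" if p: "p \<in> products R jacobson n" for p
  proof (rule ccontr)
    assume "p \<noteq> \<zero>"
    let ?S = "{L. left_ideal R L \<and> (\<exists>q\<in>products R jacobson n. \<exists>l\<in>L. q \<otimes> l \<noteq> \<zero>)}"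
    have "p \<otimes> \<one> \<noteq> \<zero>"
      using p PR[of n] \<open>p \<noteq> \<zero>\<close> by auto
    then have "carrier R \<in> ?S"
      using p one_closed left_ideal_carrier by blast
    then have "\<exists>L\<in>?S. \<forall>K\<in>?S. K \<subseteq> L \<longrightarrow> K = L"
      by (intro left_artinian_minimal[OF ring_axioms art, of _ "carrier R"]) auto
    then obtain L where L: "L \<in> ?S" "\<forall>K\<in>?S. K \<subseteq> L \<longrightarrow> K = L"
      by (elim bexE)
    then obtain q x where q: "q \<in> products R jacobson n" and x: "x \<in> L" and qx: "q \<otimes> x \<noteq> \<zero>"
      by auto
    have lL: "left_ideal R L"
      using L by simp
    have xR: "x \<in> carrier R"
      using left_idealD(1)[OF lL x] .
    let ?L = "{a \<otimes> x |a. a \<in> N n}"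
    have lL': "left_ideal R ?L"
      by (rule left_ideal_mult[OF N xR])
    have "\<exists>q\<in>products R jacobson n. \<exists>l\<in>?L. q \<otimes> l \<noteq> \<zero>"
    proof (rule ccontr)
      assume "\<not> ?thesis"
      then have *: "q \<otimes> (a \<otimes> x) = \<zero>" if "q \<in> products R jacobson n" "a \<in> products R jacobson n" for q a
        using that P_N[of n] by blast
      \<comment> \<open>Products of length n + n would kill \<open>x\<close>; since
        \<open>N (n + n) = N n\<close>, so would those of length \<open>n\<close>, against the
        choice of \<open>x\<close>.\<close>
      have "N (n + n) \<subseteq> {r \<in> carrier R. \<forall>y\<in>{x}. r \<otimes> y = \<zero>}"
      proof (rule N_sub[OF left_ideal_annihilator])
        show "products R jacobson (n + n) \<subseteq> {r \<in> carrier R. \<forall>y\<in>{x}. r \<otimes> y = \<zero>}"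
          using * PR[of n] xR by (auto simp: products_add[OF JR] subset_iff m_assoc)
      qed (use xR in auto)
      then show False
        using qx q P_N[of n] unfolding stable by blast
    qed
    then have "?L \<in> ?S"
      using lL' by blast
    moreover have "?L \<subseteq> L"
      using x left_idealD(4)[OF lL] N_R[of n] by blast
    ultimately have "?L = L"
      using L(2)[THEN bspec] by blast
    then obtain a where "a \<in> N n" "x = a \<otimes> x"
      using x by blast
    then have "x = \<zero>"
      using jacobson_quasiregular[of a x] N_J xR by auto
    then show False
      using qx q PR[of n] by auto
  qed
  then show ?thesis
    by blast
qed

text \<open>The chain condition makes some finite intersection of maximal left ideals minimal, hence
  equal to the radical, and a family of least cardinality with this intersection is irredundant.
  Such a family decomposes R/J into the simple modules R/m.\<close>

lemma jacobson_finite_irredundant: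
  assumes art: "left_artinian R"
  obtains F where "finite F" "\<And>m. m \<in> F \<Longrightarrow> maximal_left m"
    "jacobson = carrier R \<inter> \<Inter>F"
    "\<And>m. m \<in> F \<Longrightarrow> \<exists>x\<in>carrier R. x \<notin> m \<and> (\<forall>m'\<in>F - {m}. x \<in> m')"
proof -
  define \<F> where "\<F> = {F. finite F \<and> (\<forall>m\<in>F. maximal_left m)}"
  have lF: "left_ideal R (carrier R \<inter> \<Inter>F)" if "F \<in> \<F>" for F
    using that left_idealD[OF maximal_leftD(1)] by (auto simp: left_ideal_def \<F>_def)
  let ?S = "(\<lambda>F. carrier R \<inter> \<Inter>F) ` \<F>"
  have "{} \<in> \<F>"
    by (simp add: \<F>_def)
  then have "\<exists>I\<in>?S. \<forall>K\<in>?S. K \<subseteq> I \<longrightarrow> K = I"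
    using lF by (intro left_artinian_minimal[OF ring_axioms art, of _ "carrier R \<inter> \<Inter>{}"]) auto
  then obtain I where I: "I \<in> ?S" "\<forall>K\<in>?S. K \<subseteq> I \<longrightarrow> K = I"
    by (elim bexE)
  then obtain F0 where F0: "F0 \<in> \<F>" "I = carrier R \<inter> \<Inter>F0"
    by auto
  have "I \<subseteq> m" if m: "maximal_left m" for m
  proof -
    have "insert m F0 \<in> \<F>"
      using F0 m by (auto simp: \<F>_def)
    moreover have "carrier R \<inter> \<Inter>(insert m F0) \<subseteq> I"
      using F0 by auto
    ultimately have "carrier R \<inter> \<Inter>(insert m F0) = I"
      using I(2)[THEN bspec, OF imageI] by blast
    then show ?thesis
      by auto
  qed
  then have "carrier R \<inter> \<Inter>F0 = jacobson"
    using F0 by (auto simp: jacobson_def \<F>_def)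
  then have "\<exists>F. (F \<in> \<F> \<and> carrier R \<inter> \<Inter>F = jacobson) \<and>
    (\<forall>G. G \<in> \<F> \<and> carrier R \<inter> \<Inter>G = jacobson \<longrightarrow> card F \<le> card G)"
    using F0(1) by (intro ex_has_least_nat[of _ F0]) simp
  then obtain F where F: "F \<in> \<F>" "carrier R \<inter> \<Inter>F = jacobson"
    and least: "\<And>G. \<lbrakk>G \<in> \<F>; carrier R \<inter> \<Inter>G = jacobson\<rbrakk> \<Longrightarrow> card F \<le> card G"
    by (elim exE conjE) simp
  show thesis
  proof (rule that)
    show "finite F" "\<And>m. m \<in> F \<Longrightarrow> maximal_left m"
      using F(1) by (auto simp: \<F>_def)
    show "jacobson = carrier R \<inter> \<Inter>F"
      using F(2) by simp
    fix m assume m: "m \<in> F"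
    show "\<exists>x\<in>carrier R. x \<notin> m \<and> (\<forall>m'\<in>F - {m}. x \<in> m')"
    proof (rule ccontr)
      assume "\<not> ?thesis"
      then have "carrier R \<inter> \<Inter>(F - {m}) = carrier R \<inter> \<Inter>F"
        by blast
      then have "card F \<le> card (F - {m})"
        using F by (intro least) (auto simp: \<F>_def)
      then show False
        using card_Diff1_less[of F m] m F(1) by (simp add: \<F>_def)
    qed
  qed
qed

text \<open>
  In the ring \<open>R / J\<close> without nilpotent ideals, minimality of the left ideal of an idempotent
  makes its corner a division ring, which in turn makes its right ideal minimal.
\<close>

lemma right_simple_of_left_simple:
  assumes J: "left_ideal R J" "right_ideal R J"
    and semiprime: "\<And>x. \<lbrakk>x \<in> carrier R; \<And>r. r \<in> carrier R \<Longrightarrow> x \<otimes> r \<otimes> x \<in> J\<rbrakk> \<Longrightarrow> x \<in> J"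
    and e: "e \<in> carrier R" "e \<notin> J" "cong_mod J (e \<otimes> e) e"
    and simple: "\<And>r. \<lbrakk>r \<in> carrier R; r \<otimes> e \<notin> J\<rbrakk> \<Longrightarrow> \<exists>s\<in>carrier R. cong_mod J (s \<otimes> (r \<otimes> e)) e"
    and r: "r \<in> carrier R" "e \<otimes> r \<notin> J"
  shows "\<exists>s\<in>carrier R. cong_mod J ((e \<otimes> r) \<otimes> s) e"
proof -
  note trans = cong_mod_trans[OF J(1)] and sym = cong_mod_sym[OF J(1)]
    and mult_l = cong_mod_mult_left[OF J(1)] and mult_r = cong_mod_mult_right[OF J(2)]
  \<comment> \<open>The computation takes place in the corner of \<open>e\<close> modulo
    \<open>J\<close>: by semiprimeness \<open>y = e r t e\<close> is nonzero there, and
    \<open>d\<close> will be its left inverse.\<close>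
  obtain t where t: "t \<in> carrier R" "(e \<otimes> r) \<otimes> t \<otimes> (e \<otimes> r) \<notin> J"
    using semiprime[of "e \<otimes> r"] e r by auto
  define y where "y = (e \<otimes> r \<otimes> t) \<otimes> e"
  have y: "y \<in> carrier R"
    using e r t by (simp add: y_def)
  have "y \<otimes> r \<notin> J"
    using t e r by (simp add: y_def m_assoc)
  then have "y \<notin> J"
    using right_idealD(4)[OF J(2) r(1)] by blast
  then obtain s where s: "s \<in> carrier R" "cong_mod J (s \<otimes> y) e"
    using simple[of "e \<otimes> r \<otimes> t"] e r t by (auto simp: y_def)
  define d where "d = (e \<otimes> s) \<otimes> e"
  have d: "d \<in> carrier R"
    using e s by (simp add: d_def)
  have ey: "cong_mod J (e \<otimes> y) y"
    using mult_r[OF e(3), of "r \<otimes> t \<otimes> e"] e r t by (simp add: y_def m_assoc)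
  have ed: "cong_mod J (e \<otimes> d) d"
    using mult_r[OF e(3), of "s \<otimes> e"] e s by (simp add: d_def m_assoc)
  have "cong_mod J (d \<otimes> y) (e \<otimes> (s \<otimes> y))"
    using mult_l[OF ey, of "e \<otimes> s"] e s y by (simp add: d_def m_assoc)
  then have dy: "cong_mod J (d \<otimes> y) e"
    using mult_l[OF s(2) e(1)] e(3) trans by blast
  have "d \<notin> J"
  proof
    assume "d \<in> J"
    then have "d \<otimes> y \<in> J"
      using right_idealD(4)[OF J(2) y] by blast
    then show False
      using cong_mod_mem[OF J(1) dy] e(2) by blast
  qed
  then obtain z where z: "z \<in> carrier R" "cong_mod J (z \<otimes> d) e"
    using simple[of "e \<otimes> s"] e s by (auto simp: d_def)
  \<comment> \<open>In the corner \<open>d\<close> is a left inverse of \<open>y\<close> and has a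
    left inverse \<open>z\<close> of its own. Inserting e = z d in front of y d gives z (d y) d,
    which reduces to z d and so to \<open>e\<close>: the left inverse \<open>d\<close> is also a
    right inverse.\<close>
  have "cong_mod J (y \<otimes> d) ((e \<otimes> y) \<otimes> d)"
    using mult_r[OF ey d] sym by blast
  moreover have "cong_mod J ((e \<otimes> y) \<otimes> d) (z \<otimes> (d \<otimes> y) \<otimes> d)"
    using sym[OF mult_r[OF z(2), of "y \<otimes> d"]] e y d z by (simp add: m_assoc)
  moreover have "cong_mod J (z \<otimes> (d \<otimes> y) \<otimes> d) (z \<otimes> (e \<otimes> d))"
    using mult_r[OF mult_l[OF dy z(1)] d] e y d z by (simp add: m_assoc)
  moreover have "cong_mod J (z \<otimes> (e \<otimes> d)) (z \<otimes> d)"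
    using mult_l[OF ed z(1)] .
  ultimately have "cong_mod J (y \<otimes> d) e"
    using z(2) trans by blast
  then show ?thesis
    using e r t d by (intro bexI[of _ "t \<otimes> e \<otimes> d"]) (auto simp: y_def m_assoc)
qed

text \<open>Irredundance gives for each \<open>m\<close> in \<open>F\<close> an element
  \<open>e m\<close> that is 1 modulo \<open>m\<close> and lies in all other members. Modulo the
  radical these are the idempotents belonging to the decomposition of R/J into the modules
  R/m.\<close>

theorem left_artinian_semiprimary:
  assumes art: "left_artinian R"
  shows "\<exists>J E. semiprimary R J E"
proof -
  obtain F where F: "finite F" "\<And>m. m \<in> F \<Longrightarrow> maximal_left m" "jacobson = carrier R \<inter> \<Inter>F"
    and irr: "\<And>m. m \<in> F \<Longrightarrow> \<exists>x\<in>carrier R. x \<notin> m \<and> (\<forall>m'\<in>F - {m}. x \<in> m')"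
    using jacobson_finite_irredundant[OF art] by blast
  note lF = left_idealD[OF maximal_leftD(1)[OF F(2)]]
  have "\<exists>e. e \<in> carrier R \<and> \<one> \<ominus> e \<in> m \<and> (\<forall>m'\<in>F - {m}. e \<in> m')" if m: "m \<in> F" for m
  proof -
    obtain x where x: "x \<in> carrier R" "x \<notin> m" "\<And>m'. m' \<in> F - {m} \<Longrightarrow> x \<in> m'"
      using irr[OF m] by blast
    obtain r where "r \<in> carrier R" "\<one> \<ominus> r \<otimes> x \<in> m"
      using maximal_leftE[OF F(2)[OF m] x(1,2)] by blast
    then show ?thesis
      using x lF(4) by (intro exI[of _ "r \<otimes> x"]) auto
  qed
  then obtain e where e: "\<And>m. m \<in> F \<Longrightarrow> e m \<in> carrier R" "\<And>m. m \<in> F \<Longrightarrow> \<one> \<ominus> e m \<in> m"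
    "\<And>m m'. \<lbrakk>m \<in> F; m' \<in> F; m' \<noteq> m\<rbrakk> \<Longrightarrow> e m \<in> m'"
    by (metis DiffI singletonD)
  have J_iff: "x \<in> jacobson \<longleftrightarrow> x \<in> carrier R \<and> (\<forall>m\<in>F. x \<in> m)" for x
    using F(3) by auto
  have e_notin: "e m \<notin> m" if m: "m \<in> F" for m
    using left_ideal_diffD[OF maximal_leftD(1)[OF F(2)[OF m]], of "e m" \<one>] e(2)[OF m]
      maximal_leftD(2)[OF F(2)[OF m]] by auto
  have notin: "e m \<notin> jacobson" if m: "m \<in> F" for m
    using e_notin[OF m] m J_iff by blast
  have e_cong: "cong_mod jacobson x (e m)"
    if m: "m \<in> F" and x: "x \<in> carrier R" "x \<ominus> \<one> \<in> m" "\<And>m'. \<lbrakk>m' \<in> F; m' \<noteq> m\<rbrakk> \<Longrightarrow> x \<in> m'" for m x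
  proof -
    have "x \<ominus> e m \<in> m"
    proof -
      have "(x \<ominus> \<one>) \<oplus> (\<one> \<ominus> e m) \<in> m"
        using lF(3)[OF m x(2) e(2)[OF m]] .
      moreover have "(x \<ominus> \<one>) \<oplus> (\<one> \<ominus> e m) = x \<ominus> e m"
        using x(1) e(1)[OF m] by (simp add: ring_normalize)
      ultimately show ?thesis
        by simp
    qed
    moreover have "x \<ominus> e m \<in> m'" if "m' \<in> F" "m' \<noteq> m" for m'
      using left_ideal_diff[OF maximal_leftD(1)[OF F(2)]] that x(3) e(3) m by simp
    ultimately have "\<forall>m'\<in>F. x \<ominus> e m \<in> m'"
      by blast
    then show ?thesis
      using x(1) e(1)[OF m] unfolding cong_mod_def J_iff by simp
  qed
  have idem: "cong_mod jacobson (e m \<otimes> e m) (e m)" if m: "m \<in> F" for m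
  proof (rule e_cong[OF m])
    have "\<ominus> (e m \<oplus> \<one>) \<otimes> (\<one> \<ominus> e m) \<in> m"
      using e[OF m] by (intro lF(4)[OF m]) auto
    moreover have "\<ominus> (e m \<oplus> \<one>) \<otimes> (\<one> \<ominus> e m) = e m \<otimes> e m \<ominus> \<one>"
      using e(1)[OF m] by (simp add: ring_normalize)
    ultimately show "e m \<otimes> e m \<ominus> \<one> \<in> m"
      by simp
  qed (use e(1)[OF m] e(3)[OF m] lF(4) in auto)
  have left_simple: "\<exists>s\<in>carrier R. cong_mod jacobson (s \<otimes> (r \<otimes> e m)) (e m)"
    if m: "m \<in> F" and r: "r \<in> carrier R" "r \<otimes> e m \<notin> jacobson" for m r
  proof -
    have rm: "r \<otimes> e m \<in> m'" if "m' \<in> F" "m' \<noteq> m" for m'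
      using that r(1) e(3) m lF(4) by auto
    then have "r \<otimes> e m \<notin> m"
      using r e(1)[OF m] J_iff by auto
    then obtain s where s: "s \<in> carrier R" "\<one> \<ominus> s \<otimes> (r \<otimes> e m) \<in> m"
      using maximal_leftE[OF F(2)[OF m], of "r \<otimes> e m"] r(1) e(1)[OF m] by auto
    have "s \<otimes> (r \<otimes> e m) \<ominus> \<one> \<in> m"
      using left_ideal_minus[OF maximal_leftD(1)[OF F(2)[OF m]] s(2)] s(1) r(1) e(1)[OF m]
      by (simp add: ring_normalize)
    then show ?thesis
      using s(1) r(1) e(1)[OF m] rm lF(4) by (intro bexI[of _ s] e_cong[OF m]) auto
  qed
  have "semiprimary R jacobson (e ` F)"
  proof (intro semiprimary.intro semiprimary_axioms.intro)
    fix G assume G: "subgroup G (add_monoid R)" "jacobson \<subseteq> G" "e ` F \<subseteq> G"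
    \<comment> \<open>The partial sums of the \<open>e m\<close> are 1 modulo the ideals already
      used and lie in the remaining ones; for the whole family the sum agrees with 1 modulo
      \<open>jacobson\<close>.\<close>
    have "\<exists>s\<in>G. s \<in> carrier R \<and> (\<forall>m\<in>F'. \<one> \<ominus> s \<in> m) \<and> (\<forall>m\<in>F - F'. s \<in> m)" if "F' \<subseteq> F" for F'
      using finite_subset[OF that F(1)] that
    proof (induction F')
      case empty
      then show ?case
        using subgroup.one_closed[OF G(1)] lF(2) by auto
    next
      case (insert m F')
      then obtain s where s: "s \<in> G" "s \<in> carrier R" "\<And>m. m \<in> F' \<Longrightarrow> \<one> \<ominus> s \<in> m"
        "\<And>m. m \<in> F - F' \<Longrightarrow> s \<in> m"
        by auto
      have m: "m \<in> F" "m \<notin> F'" and F': "F' \<subseteq> F"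
        using insert by auto
      have "s \<oplus> e m \<in> G"
        using subgroup.m_closed[OF G(1) s(1), of "e m"] G(3) m by auto
      moreover have "\<one> \<ominus> (s \<oplus> e m) \<in> m'" if m': "m' \<in> insert m F'" for m'
      proof -
        have m'F: "m' \<in> F"
          using m' m F' by auto
        note lm' = maximal_leftD(1)[OF F(2)[OF m'F]]
        show ?thesis
        proof (cases "m' = m")
          case True
          have "\<one> \<ominus> e m \<ominus> s \<in> m'"
            using e(2)[OF m(1)] s(4)[of m] m left_ideal_diff[OF lm', of "\<one> \<ominus> e m" s] True
            by simp
          moreover have "\<one> \<ominus> e m \<ominus> s = \<one> \<ominus> (s \<oplus> e m)"
            using s(2) e(1)[OF m(1)] by (simp add: ring_normalize)
          ultimately show ?thesis by simp
        next
          case False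
          have "\<one> \<ominus> s \<ominus> e m \<in> m'"
            using False e(3)[OF m(1) m'F] s(3)[of m'] m' left_ideal_diff[OF lm', of "\<one> \<ominus> s" "e m"]
            by simp
          moreover have "\<one> \<ominus> s \<ominus> e m = \<one> \<ominus> (s \<oplus> e m)"
            using s(2) e(1)[OF m(1)] by (simp add: ring_normalize)
          ultimately show ?thesis by simp
        qed
      qed
      moreover have "s \<oplus> e m \<in> m'" if "m' \<in> F - insert m F'" for m'
        using that s(4)[of m'] e(3)[OF m(1), of m'] lF(3)[of m' s "e m"] by simp
      ultimately show ?case
        using s(2) e(1)[OF m(1)] by (intro bexI[of _ "s \<oplus> e m"]) auto
    qed
    from this[of F] obtain s where s: "s \<in> G" "s \<in> carrier R" "\<And>m. m \<in> F \<Longrightarrow> \<one> \<ominus> s \<in> m"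
      by auto
    then have "\<one> \<ominus> s \<in> G"
      using G(2) J_iff by auto
    then have "(\<one> \<ominus> s) \<oplus> s \<in> G"
      using subgroup.m_closed[OF G(1)] s(1) by simp
    then show "\<one> \<in> G"
      using s(2) by (simp add: ring_normalize)
  next
    fix f r assume *: "f \<in> e ` F" "r \<in> carrier R" "f \<otimes> r \<notin> jacobson"
    then obtain m where m: "m \<in> F" "f = e m"
      by auto
    show "\<exists>s\<in>carrier R. cong_mod jacobson (f \<otimes> r \<otimes> s) f"
      using * m e(1)[OF m(1)] notin[OF m(1)] idem[OF m(1)] left_simple[OF m(1)]
      by (intro right_simple_of_left_simple[OF left_ideal_jacobson right_ideal_jacobson jacobson_semiprime])
        simp_all
  next
    show "finite (e ` F)"
      using F(1) by simp
    show "e ` F \<subseteq> carrier R"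
      using e(1) by auto
    show "f \<notin> jacobson" "cong_mod jacobson (f \<otimes> f) f" if "f \<in> e ` F" for f
      using that notin idem by auto
    show "\<exists>s\<in>carrier R. cong_mod jacobson (s \<otimes> (r \<otimes> f)) f"
      if "f \<in> e ` F" "r \<in> carrier R" "r \<otimes> f \<notin> jacobson" for f r
      using that left_simple by auto
  qed (rule ring_axioms left_ideal_jacobson right_ideal_jacobson jacobson_nilpotent[OF art])+
  then show ?thesis
    by blast
qed

end

section \<open>Chain conditions and minimal left ideals\<close>

text \<open>The condition concerns the left ideals between \<open>I\<close> and \<open>K\<close>.
  This relative form can be built up one simple factor at a time, starting from the trivial case K =
  I.\<close>

definition left_dcc :: "('a, 'r) ring_scheme \<Rightarrow> 'a set \<Rightarrow> 'a set \<Rightarrow> bool"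
  where "left_dcc R I K \<longleftrightarrow>
    (\<forall>f :: nat \<Rightarrow> 'a set.
      (\<forall>n. left_ideal R (f n) \<and> I \<subseteq> f n \<and> f n \<subseteq> K \<and> f (Suc n) \<subseteq> f n) \<longrightarrow>
      (\<exists>n. \<forall>k\<ge>n. f k = f n))"

definition left_acc :: "('a, 'r) ring_scheme \<Rightarrow> bool"
  where "left_acc R \<longleftrightarrow>
    (\<forall>f :: nat \<Rightarrow> 'a set. (\<forall>n. left_ideal R (f n) \<and> f n \<subseteq> f (Suc n)) \<longrightarrow> (\<exists>n. \<forall>k\<ge>n. f k = f n))"

lemma left_dccE:
  fixes f :: "nat \<Rightarrow> 'a set"
  assumes "left_dcc R I K" "\<And>n. left_ideal R (f n)" "\<And>n. I \<subseteq> f n" "\<And>n. f n \<subseteq> K"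
    "\<And>n. f (Suc n) \<subseteq> f n"
  obtains n where "\<And>k. k \<ge> n \<Longrightarrow> f k = f n"
proof -
  have "\<exists>n. \<forall>k\<ge>n. f k = f n"
    using assms(2-) by (intro assms(1)[unfolded left_dcc_def, THEN spec, THEN mp]) blast
  then obtain n where n: "\<forall>k\<ge>n. f k = f n" ..
  show thesis
    by (rule that[of n]) (rule n[THEN spec, THEN mp])
qed

context ring
begin

definition left_minimal :: "'a \<Rightarrow> bool"
  where "left_minimal a \<longleftrightarrow> a \<in> carrier R \<and> a \<noteq> \<zero> \<and>
    (\<forall>r\<in>carrier R. r \<otimes> a \<noteq> \<zero> \<longrightarrow> (\<exists>s\<in>carrier R. s \<otimes> (r \<otimes> a) = a))"

lemma left_minimalD:
  assumes "left_minimal a"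
  shows "a \<in> carrier R" "a \<noteq> \<zero>"
    "\<lbrakk>r \<in> carrier R; r \<otimes> a \<noteq> \<zero>\<rbrakk> \<Longrightarrow> \<exists>s\<in>carrier R. s \<otimes> (r \<otimes> a) = a"
  using assms unfolding left_minimal_def by auto

lemma left_ideal_subgroup:
  assumes "left_ideal R I"
  shows "subgroup I (add_monoid R)"
  using assms submodule_iff_left_ideal[of I] submodule.axioms(1)[of I R "regular_module R"]
  by (simp add: regular_module_def subgroup_def m_inv_def)

lemma left_artinian_if_left_dcc:
  assumes "left_dcc R {\<zero>} (carrier R)"
  shows "left_artinian R"
  unfolding left_artinian_def artinian_module_def
proof (intro allI impI)
  fix f :: "nat \<Rightarrow> 'a set"
  assume f: "(\<forall>k. submodule (f k) R (regular_module R)) \<and> (\<forall>k. f (Suc k) \<subseteq> f k)"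
  then have lf: "left_ideal R (f k)" for k
    using submodule_iff_left_ideal by blast
  have "\<zero> \<in> f k" "f k \<subseteq> carrier R" for k
    using lf[of k] by (auto simp: left_ideal_def)
  then obtain n where "\<And>k. k \<ge> n \<Longrightarrow> f k = f n"
    using left_dccE[OF assms, of f] lf f by blast
  then show "\<exists>n. \<forall>k\<ge>n. f k = f n"
    by blast
qed

lemma left_dcc_if_left_artinian:
  assumes "left_artinian R"
  shows "left_dcc R I (carrier R)"
  unfolding left_dcc_def
proof (intro allI impI)
  fix f :: "nat \<Rightarrow> 'a set"
  assume f: "\<forall>n. left_ideal R (f n) \<and> I \<subseteq> f n \<and> f n \<subseteq> carrier R \<and> f (Suc n) \<subseteq> f n"
  have "(\<forall>k. submodule (f k) R (regular_module R)) \<and> (\<forall>k. f (Suc k) \<subseteq> f k)"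
    using f submodule_iff_left_ideal by simp
  then show "\<exists>n. \<forall>k\<ge>n. f k = f n"
    by (rule assms[unfolded left_artinian_def artinian_module_def, THEN spec, THEN mp])
qed

lemma left_dcc_minimal:
  assumes dcc: "left_dcc R I (carrier R)"
    and S: "\<And>K. K \<in> S \<Longrightarrow> left_ideal R K \<and> I \<subseteq> K" and "K\<^sub>0 \<in> S"
  shows "\<exists>K\<in>S. \<forall>L\<in>S. L \<subseteq> K \<longrightarrow> L = K"
proof (rule ccontr)
  assume neg: "\<not> ?thesis"
  have "\<exists>f. \<forall>n. f n \<in> S \<and> f (Suc n) \<subset> f n"
    using neg \<open>K\<^sub>0 \<in> S\<close> by (intro dependent_nat_choice) blast+
  then obtain f where f: "\<And>n. f n \<in> S" "\<And>n. f (Suc n) \<subset> f n"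
    by blast
  have lf: "left_ideal R (f n)" "I \<subseteq> f n" "f n \<subseteq> carrier R" "f (Suc n) \<subseteq> f n" for n
    using S[OF f(1)[of n]] f(2)[of n] by (auto simp: left_ideal_def)
  obtain n where n: "\<And>k. k \<ge> n \<Longrightarrow> f k = f n"
    using left_dccE[of R I "carrier R" f, OF dcc lf] by blast
  have "f (Suc n) = f n"
    by (rule n) simp
  then show False
    using f(2)[of n] by simp
qed

text \<open>The factor of K + Rz by K is simple or zero. A descending chain either enters K, or
  every member covers this factor and is then determined by its intersection with K.\<close>

lemma left_dcc_adjoin:
  assumes K: "left_ideal R K" "I \<subseteq> K" and dcc: "left_dcc R I K" and z: "z \<in> carrier R"
    and simple: "\<And>r. \<lbrakk>r \<in> carrier R; r \<otimes> z \<notin> K\<rbrakk> \<Longrightarrow> \<exists>s\<in>carrier R. s \<otimes> (r \<otimes> z) \<ominus> z \<in> K"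
  shows "left_dcc R I (adjoin K z)"
  unfolding left_dcc_def
proof (intro allI impI)
  fix f :: "nat \<Rightarrow> 'a set"
  assume "\<forall>n. left_ideal R (f n) \<and> I \<subseteq> f n \<and> f n \<subseteq> adjoin K z \<and> f (Suc n) \<subseteq> f n"
  then have f: "\<And>n. left_ideal R (f n)" "\<And>n. I \<subseteq> f n" "\<And>n. f n \<subseteq> adjoin K z" "\<And>n. f (Suc n) \<subseteq> f n"
    by auto
  have mono: "f l \<subseteq> f k" if "k \<le> l" for k l
    using that f(4) by (rule lift_Suc_antimono_le[rotated])
  show "\<exists>n. \<forall>k\<ge>n. f k = f n"
  proof (cases "\<exists>m. f m \<subseteq> K")
    case True
    then obtain m where m: "f m \<subseteq> K" ..
    have "f (m + k) \<subseteq> K" for k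
      using m mono[of m "m + k"] by auto
    then obtain n where n: "\<And>k. k \<ge> n \<Longrightarrow> f (m + k) = f (m + n)"
      using left_dccE[OF dcc, of "\<lambda>k. f (m + k)"] f by auto
    have "f k = f (m + n)" if "k \<ge> m + n" for k
      using n[of "k - m"] that by simp
    then show ?thesis
      by blast
  next
    case False
    obtain n where n: "\<And>k. k \<ge> n \<Longrightarrow> f k \<inter> K = f n \<inter> K"
      using left_dccE[OF dcc, of "\<lambda>k. f k \<inter> K"] f K left_ideal_Int by blast
    have "f k = f n" if k: "k \<ge> n" for k
    proof
      show "f k \<subseteq> f n"
        by (rule mono[OF k])
      show "f n \<subseteq> f k"
      proof
        fix x assume x: "x \<in> f n"
        then obtain a r where ar: "x = a \<oplus> r \<otimes> z" "a \<in> K" "r \<in> carrier R"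
          using f(3)[of n] unfolding adjoin_def by blast
        obtain w where w: "w \<in> f k" "w \<notin> K"
          using False by blast
        then obtain b t where bt: "w = b \<oplus> t \<otimes> z" "b \<in> K" "t \<in> carrier R"
          using f(3)[of k] unfolding adjoin_def by blast
        have "t \<otimes> z \<notin> K"
          using w bt left_idealD(3)[OF K(1)] by auto
        then obtain s where s: "s \<in> carrier R" "s \<otimes> (t \<otimes> z) \<ominus> z \<in> K"
          using simple[OF bt(3)] by blast
        have aR: "a \<in> carrier R" "b \<in> carrier R"
          using ar bt left_idealD(1)[OF K(1)] by auto
        \<comment> \<open>Since s t z is z modulo \<open>K\<close>, subtracting r s w removes the
          \<open>z\<close> part of \<open>x\<close>. What remains lies in \<open>f n\<close> and in
          \<open>K\<close>, hence in \<open>f k\<close> by the choice of \<open>n\<close>.\<close>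
        have "x \<ominus> (r \<otimes> s) \<otimes> w = a \<ominus> (r \<otimes> s) \<otimes> b \<ominus> r \<otimes> (s \<otimes> (t \<otimes> z) \<ominus> z)"
          using ar(1,3) bt(1,3) s(1) z aR by (simp add: ring_normalize)
        moreover have "a \<ominus> (r \<otimes> s) \<otimes> b \<ominus> r \<otimes> (s \<otimes> (t \<otimes> z) \<ominus> z) \<in> K"
          using left_ideal_diff[OF K(1)] left_idealD(4)[OF K(1)] ar bt s by simp
        moreover have rsw: "(r \<otimes> s) \<otimes> w \<in> f k"
          using w ar s left_idealD(4)[OF f(1)] by simp
        moreover have "x \<ominus> (r \<otimes> s) \<otimes> w \<in> f n"
          using left_ideal_diff[OF f(1) x] rsw mono[OF k] by blast
        ultimately have "x \<ominus> (r \<otimes> s) \<otimes> w \<in> f k"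
          using n[OF k] by auto
        then show "x \<in> f k"
          using left_ideal_diffD[OF f(1) rsw] left_idealD(1)[OF f(1) x] by blast
      qed
    qed
    then show ?thesis
      by blast
  qed
qed

end

section \<open>Simple factors over a semiprimary ring\<close>

context semiprimary
begin

lemma J_closed: "j \<in> J \<Longrightarrow> j \<in> carrier R"
  using left_idealD(1)[OF J_left] .

lemma E_carrier: "e \<in> E \<Longrightarrow> e \<in> carrier R"
  using E_closed by blast

text \<open>By nilpotency there is a length \<open>k\<close> such that some product \<open>p\<close>
  of \<open>k\<close> elements of \<open>J\<close> leaves p x outside \<open>L\<close>, but no
  product of length \<open>Suc k\<close> does so. In R/L the element p x is nonzero and killed by
  \<open>J\<close>.\<close>

lemma exists_top_layer:
  assumes L: "left_ideal R L" and x: "x \<in> carrier R" "x \<notin> L"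
  obtains p where "p \<in> carrier R" "p \<otimes> x \<notin> L" "\<And>j. j \<in> J \<Longrightarrow> j \<otimes> (p \<otimes> x) \<in> L"
proof -
  have JR: "J \<subseteq> carrier R"
    using J_closed by blast
  obtain n where n: "products R J n \<subseteq> {\<zero>}"
    using nilpotent by blast
  define P where "P k \<longleftrightarrow> (\<forall>p\<in>products R J k. p \<otimes> x \<in> L)" for k
  have "P n"
    using n x left_idealD(2)[OF L] by (auto simp: P_def)
  moreover have "\<not> P 0"
    using x by (simp add: P_def)
  ultimately obtain k where k: "\<not> P k" "P (Suc k)"
    using ex_least_nat_less[of P n] by blast
  then obtain p where p: "p \<in> products R J k" "p \<otimes> x \<notin> L"
    by (auto simp: P_def)
  have pR: "p \<in> carrier R"
    using p products_closed[OF JR] by blast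
  have "j \<otimes> (p \<otimes> x) \<in> L" if j: "j \<in> J" for j
  proof -
    have "j \<otimes> p \<in> products R J (Suc k)"
      using j p by auto
    then have "j \<otimes> p \<otimes> x \<in> L"
      using k(2) unfolding P_def by blast
    then show ?thesis
      using J_closed[OF j] pR x by (simp add: m_assoc)
  qed
  then show thesis
    using that p pR by blast
qed

text \<open>The elements taking \<open>y\<close> into \<open>L\<close> form an additive subgroup
  that contains \<open>J\<close> but not 1, so by \<open>one_generated\<close> it misses some
  element of \<open>E\<close>.\<close>

lemma E_separates:
  assumes L: "left_ideal R L" and y: "y \<in> carrier R" "y \<notin> L" and J: "\<And>j. j \<in> J \<Longrightarrow> j \<otimes> y \<in> L"
  obtains e where "e \<in> E" "e \<otimes> y \<notin> L"
proof -
  let ?G = "{g \<in> carrier R. g \<otimes> y \<in> L}"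
  have "subgroup ?G (add_monoid R)"
  proof (rule group.subgroupI[OF a_group])
    show "?G \<noteq> {}"
      using left_idealD(2)[OF L] y by (auto intro!: exI[of _ \<zero>])
    fix g assume g: "g \<in> ?G"
    then have "(\<ominus> g) \<otimes> y \<in> L"
      using left_ideal_minus[OF L, of "g \<otimes> y"] y by (simp add: l_minus)
    then show "inv\<^bsub>add_monoid R\<^esub> g \<in> ?G"
      using g a_inv_closed[of g] by (simp add: a_inv_def)
  next
    fix g h assume "g \<in> ?G" "h \<in> ?G"
    then show "g \<otimes>\<^bsub>add_monoid R\<^esub> h \<in> ?G"
      using left_idealD(3)[OF L] y by (simp add: l_distr)
  qed auto
  moreover have "J \<subseteq> ?G"
    using J J_closed by auto
  moreover have "\<one> \<notin> ?G"
    using y by simp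
  ultimately have "\<not> E \<subseteq> ?G"
    using one_generated by blast
  then show thesis
    using that E_closed by blast
qed

text \<open>Modulo \<open>L\<close> the element e y generates a simple module, and the condition for
  \<open>r\<close> to kill e y involves only \<open>e\<close> and \<open>J\<close>. So the simple
  modules obtained from one \<open>e\<close> are all isomorphic, whatever \<open>L\<close> and
  \<open>y\<close> are; later maps between them are defined through this.\<close>

lemma annihilator_mod:
  assumes L: "left_ideal R L" and e: "e \<in> E" and y: "y \<in> carrier R" "e \<otimes> y \<notin> L"
    and J: "\<And>j. j \<in> J \<Longrightarrow> j \<otimes> y \<in> L" and r: "r \<in> carrier R"
  shows "r \<otimes> (e \<otimes> y) \<in> L \<longleftrightarrow> r \<otimes> e \<in> J"
    and "r \<otimes> (e \<otimes> y) \<notin> L \<Longrightarrow> \<exists>s\<in>carrier R. s \<otimes> (r \<otimes> (e \<otimes> y)) \<ominus> e \<otimes> y \<in> L"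
proof -
  note eR = E_carrier[OF e]
  have simple: "\<exists>s\<in>carrier R. s \<otimes> (r \<otimes> (e \<otimes> y)) \<ominus> e \<otimes> y \<in> L" if re: "r \<otimes> e \<notin> J"
  proof -
    obtain s where s: "s \<in> carrier R" "cong_mod J (s \<otimes> (r \<otimes> e)) e"
      using E_left_simple[OF e r re] by blast
    then have "(s \<otimes> (r \<otimes> e) \<ominus> e) \<otimes> y \<in> L"
      by (intro J) (simp add: cong_mod_def)
    moreover have "(s \<otimes> (r \<otimes> e) \<ominus> e) \<otimes> y = s \<otimes> (r \<otimes> (e \<otimes> y)) \<ominus> e \<otimes> y"
      using s(1) r eR y(1) by (simp add: ring_normalize)
    ultimately show ?thesis
      using s(1) by auto
  qed
  show *: "r \<otimes> (e \<otimes> y) \<in> L \<longleftrightarrow> r \<otimes> e \<in> J"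
  proof
    assume "r \<otimes> e \<in> J"
    then show "r \<otimes> (e \<otimes> y) \<in> L"
      using J[of "r \<otimes> e"] r eR y by (simp add: m_assoc)
  next
    assume rL: "r \<otimes> (e \<otimes> y) \<in> L"
    show "r \<otimes> e \<in> J"
    proof (rule ccontr)
      assume "r \<otimes> e \<notin> J"
      then obtain s where s: "s \<in> carrier R" "s \<otimes> (r \<otimes> (e \<otimes> y)) \<ominus> e \<otimes> y \<in> L"
        using simple by blast
      then have "e \<otimes> y \<in> L"
        using left_ideal_diffD'[OF L left_idealD(4)[OF L s(1) rL] s(2)] eR y by simp
      then show False
        using y by simp
    qed
  qed
  show "r \<otimes> (e \<otimes> y) \<notin> L \<Longrightarrow> \<exists>s\<in>carrier R. s \<otimes> (r \<otimes> (e \<otimes> y)) \<ominus> e \<otimes> y \<in> L"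
    using simple * by blast
qed

lemma minimal_of_annihilated:
  assumes e: "e \<in> E" and y: "y \<in> carrier R" "e \<otimes> y \<noteq> \<zero>" and J: "\<And>j. j \<in> J \<Longrightarrow> j \<otimes> y = \<zero>"
  shows "left_minimal (e \<otimes> y)"
    and "r \<in> carrier R \<Longrightarrow> r \<otimes> (e \<otimes> y) = \<zero> \<longleftrightarrow> r \<otimes> e \<in> J"
proof -
  note eR = E_carrier[OF e]
  note am = annihilator_mod[OF left_ideal_zero e, of y]
  show "r \<in> carrier R \<Longrightarrow> r \<otimes> (e \<otimes> y) = \<zero> \<longleftrightarrow> r \<otimes> e \<in> J"
    using am(1) y J by simp
  have "\<exists>s\<in>carrier R. s \<otimes> (r \<otimes> (e \<otimes> y)) = e \<otimes> y" if r: "r \<in> carrier R" "r \<otimes> (e \<otimes> y) \<noteq> \<zero>" for r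
  proof -
    obtain s where "s \<in> carrier R" "s \<otimes> (r \<otimes> (e \<otimes> y)) \<ominus> e \<otimes> y = \<zero>"
      using am(2)[OF y(1) _ _ r(1)] y J r by auto
    then show ?thesis
      using r(1) eR y(1) diff_eq_zeroD[of "s \<otimes> (r \<otimes> (e \<otimes> y))" "e \<otimes> y"] by auto
  qed
  then show "left_minimal (e \<otimes> y)"
    using eR y by (simp add: left_minimal_def)
qed

lemma left_socle_essential:
  assumes x: "x \<in> carrier R" "x \<noteq> \<zero>"
  obtains r where "r \<in> carrier R" "left_minimal (r \<otimes> x)"
proof -
  obtain p where p: "p \<in> carrier R" "p \<otimes> x \<noteq> \<zero>" "\<And>j. j \<in> J \<Longrightarrow> j \<otimes> (p \<otimes> x) = \<zero>"
    using exists_top_layer[OF left_ideal_zero x(1)] x(2) by auto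
  obtain e where e: "e \<in> E" "e \<otimes> (p \<otimes> x) \<noteq> \<zero>"
    using E_separates[OF left_ideal_zero, of "p \<otimes> x"] p x by auto
  have "left_minimal (e \<otimes> (p \<otimes> x))"
    using minimal_of_annihilated(1)[OF e(1) _ e(2)] p x by simp
  then show thesis
    using that[of "e \<otimes> p"] p x E_carrier[OF e(1)] by (simp add: m_assoc)
qed

text \<open>Some nonzero p a is killed by \<open>J\<close>, and minimality writes \<open>a\<close>
  as t (p a). As \<open>J\<close> is also a right ideal, j t is again in \<open>J\<close>.\<close>

lemma J_annihilates_minimal:
  assumes a: "left_minimal a" and j: "j \<in> J"
  shows "j \<otimes> a = \<zero>"
proof -
  note aD = left_minimalD[OF a]
  obtain p where p: "p \<in> carrier R" "p \<otimes> a \<noteq> \<zero>" "\<And>j. j \<in> J \<Longrightarrow> j \<otimes> (p \<otimes> a) = \<zero>"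
    using exists_top_layer[OF left_ideal_zero aD(1)] aD(2) by auto
  obtain t where t: "t \<in> carrier R" "t \<otimes> (p \<otimes> a) = a"
    using aD(3)[OF p(1,2)] by blast
  have "(j \<otimes> t) \<otimes> (p \<otimes> a) = \<zero>"
    using j t by (intro p(3) right_idealD(4)[OF J_right])
  moreover have "(j \<otimes> t) \<otimes> (p \<otimes> a) = j \<otimes> (t \<otimes> (p \<otimes> a))"
    using J_closed[OF j] t(1) p(1) aD(1) by (simp add: m_assoc)
  ultimately show ?thesis
    using t(2) by simp
qed

text \<open>Adjoining the finitely many elements of \<open>E\<close> to \<open>J\<close> one at a
  time adds a simple or zero factor each time and ends at R. This rests on the semiprimary data
  alone, so it is available on both sides.\<close>

lemma left_dcc_above_J: "left_dcc R J (carrier R)"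
proof -
  have "\<exists>K. left_ideal R K \<and> J \<subseteq> K \<and> E' \<subseteq> K \<and> left_dcc R J K" if "E' \<subseteq> E" for E'
    using finite_subset[OF that E_finite] that
  proof (induction E')
    case empty
    have "left_dcc R J J"
      unfolding left_dcc_def by blast
    then show ?case
      using J_left by blast
  next
    case (insert e E')
    then obtain K where K: "left_ideal R K" "J \<subseteq> K" "E' \<subseteq> K" "left_dcc R J K"
      by auto
    have e: "e \<in> E" "e \<in> carrier R"
      using insert E_carrier by auto
    have "left_dcc R J (adjoin K e)"
    proof (rule left_dcc_adjoin[OF K(1,2,4) e(2)])
      fix r assume "r \<in> carrier R" "r \<otimes> e \<notin> K"
      then show "\<exists>s\<in>carrier R. s \<otimes> (r \<otimes> e) \<ominus> e \<in> K"
        using E_left_simple[OF e(1), of r] K(2) by (auto simp: cong_mod_def)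
    qed
    then show ?case
      using left_ideal_adjoin[OF K(1) e(2)] adjoin_base[OF K(1) e(2)] adjoin_elem[OF K(1) e(2)] K
      by (intro exI[of _ "adjoin K e"]) auto
  qed
  then obtain K where K: "left_ideal R K" "J \<subseteq> K" "E \<subseteq> K" "left_dcc R J K"
    by blast
  have "\<one> \<in> K"
    using one_generated[OF left_ideal_subgroup[OF K(1)] K(2,3)] .
  then have "x \<in> K" if "x \<in> carrier R" for x
    using left_idealD(4)[OF K(1) that] that by force
  then have "K = carrier R"
    using left_idealD(1)[OF K(1)] by blast
  then show ?thesis
    using K(4) by simp
qed

text \<open>If R were not left artinian, every left ideal with the descending chain condition below
  it would be proper, and could be enlarged by one simple factor without losing that condition.
  Repeating this gives a strictly ascending chain.\<close>

lemma left_artinian_if_left_acc: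
  assumes acc: "left_acc R"
  shows "left_artinian R"
proof (rule ccontr)
  assume "\<not> left_artinian R"
  then have neg: "\<not> left_dcc R {\<zero>} (carrier R)"
    using left_artinian_if_left_dcc by blast
  let ?P = "\<lambda>L. left_ideal R L \<and> left_dcc R {\<zero>} L"
  have step: "\<exists>L'. ?P L' \<and> L \<subset> L'" if L: "left_ideal R L" "left_dcc R {\<zero>} L" for L
  proof -
    have "L \<noteq> carrier R"
      using L neg by blast
    then obtain x where x: "x \<in> carrier R" "x \<notin> L"
      using left_idealD(1)[OF L(1)] by blast
    obtain p where p: "p \<in> carrier R" "p \<otimes> x \<notin> L" "\<And>j. j \<in> J \<Longrightarrow> j \<otimes> (p \<otimes> x) \<in> L"
      using exists_top_layer[OF L(1) x] by blast
    have px: "p \<otimes> x \<in> carrier R"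
      using p x by simp
    obtain e where e: "e \<in> E" "e \<otimes> (p \<otimes> x) \<notin> L"
      using E_separates[OF L(1) px p(2,3)] by blast
    define z where "z = e \<otimes> (p \<otimes> x)"
    have z: "z \<in> carrier R" "z \<notin> L"
      using px e E_carrier[OF e(1)] by (auto simp: z_def)
    have "left_dcc R {\<zero>} (adjoin L z)"
    proof (rule left_dcc_adjoin[OF L(1) _ L(2) z(1)])
      show "{\<zero>} \<subseteq> L"
        using left_idealD(2)[OF L(1)] by simp
      show "\<exists>s\<in>carrier R. s \<otimes> (r \<otimes> z) \<ominus> z \<in> L" if "r \<in> carrier R" "r \<otimes> z \<notin> L" for r
        using annihilator_mod(2)[OF L(1) e(1) px e(2) p(3) that(1)] that(2) unfolding z_def by blast
    qed
    moreover have "L \<subset> adjoin L z"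
      using adjoin_base[OF L(1) z(1)] adjoin_elem[OF L(1) z(1)] z(2) by blast
    ultimately show ?thesis
      using left_ideal_adjoin[OF L(1) z(1)] by blast
  qed
  have "left_dcc R {\<zero>} {\<zero>}"
    unfolding left_dcc_def by blast
  then have "?P {\<zero>}"
    using left_ideal_zero by simp
  then have "\<exists>f. \<forall>n. ?P (f n) \<and> f n \<subset> f (Suc n)"
    using step by (intro dependent_nat_choice) auto
  then obtain f where f: "\<And>n. left_ideal R (f n)" "\<And>n. f n \<subset> f (Suc n)"
    by blast
  have "\<exists>n. \<forall>k\<ge>n. f k = f n"
    using f by (intro acc[unfolded left_acc_def, THEN spec, THEN mp]) auto
  then obtain n where n: "\<forall>k\<ge>n. f k = f n" ..
  have "f (Suc n) = f n"
    using n[THEN spec, of "Suc n"] by simp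
  then show False
    using f(2)[of n] by simp
qed

end

section \<open>Types of minimal left ideals\<close>

context ring
begin

abbreviation right_minimal :: "'a \<Rightarrow> bool"
  where "right_minimal \<equiv> ring.left_minimal (opposite_ring R)"

lemma right_minimal_iff:
  "right_minimal a \<longleftrightarrow> a \<in> carrier R \<and> a \<noteq> \<zero> \<and>
    (\<forall>r\<in>carrier R. a \<otimes> r \<noteq> \<zero> \<longrightarrow> (\<exists>s\<in>carrier R. (a \<otimes> r) \<otimes> s = a))"
  by (simp add: ring.left_minimal_def[OF opposite_ring])

lemma left_linear_injI:
  assumes I: "left_ideal R I" and f: "left_linear R I f"
    and ker: "\<And>x. \<lbrakk>x \<in> I; f x = \<zero>\<rbrakk> \<Longrightarrow> x = \<zero>"
  shows "inj_on f I"
proof (rule inj_onI)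
  fix x y assume xy: "x \<in> I" "y \<in> I" "f x = f y"
  have m: "\<ominus> y \<in> I"
    using left_ideal_minus[OF I xy(2)] .
  have "f (x \<oplus> \<ominus> y) = \<zero>"
    using left_linearD(2)[OF f xy(1) m] left_linear_minus[OF I f xy(2)] left_linearD(1)[OF f xy(2)] xy(3)
    by (simp add: r_neg)
  then have "x \<oplus> \<ominus> y = \<zero>"
    using ker left_idealD(3)[OF I xy(1) m] by blast
  then show "x = y"
    using diff_eq_zeroD left_idealD(1)[OF I] xy by (simp add: minus_eq)
qed

end

context semiprimary
begin

text \<open>Maps between the left modules generated by \<open>e\<close> and \<open>f\<close> in R/J
  are given by elements e r f. For members of \<open>E\<close>, which generate simple modules, the
  relation says that these modules are isomorphic.\<close>

definition linked :: "'a \<Rightarrow> 'a \<Rightarrow> bool"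
  where "linked e f \<longleftrightarrow> (\<exists>r\<in>carrier R. (e \<otimes> r) \<otimes> f \<notin> J)"

definition block :: "'a \<Rightarrow> 'a set"
  where "block e = {f \<in> E. linked e f}"

text \<open>An element of \<open>E\<close> acts nontrivially on a simple left module exactly when
  that module is isomorphic to the one it generates in R/J. For minimal \<open>a\<close> this set
  therefore records the isomorphism class of Ra.\<close>

definition left_type :: "'a \<Rightarrow> 'a set"
  where "left_type a = {e \<in> E. \<exists>r\<in>carrier R. e \<otimes> (r \<otimes> a) \<noteq> \<zero>}"

definition right_type :: "'a \<Rightarrow> 'a set"
  where "right_type a = {e \<in> E. \<exists>r\<in>carrier R. (a \<otimes> r) \<otimes> e \<noteq> \<zero>}"

lemma linked_refl: "e \<in> E \<Longrightarrow> linked e e"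
  using E_notin[of e] cong_mod_mem[OF J_left E_idem[of e]] E_carrier[of e]
  unfolding linked_def by (intro bexI[of _ \<one>]) auto

lemma linkedE:
  assumes "e \<in> E" "f \<in> carrier R" "linked e f"
  obtains t s where "t \<in> carrier R" "s \<in> carrier R" "cong_mod J ((e \<otimes> t) \<otimes> f \<otimes> s) e"
proof -
  obtain t where t: "t \<in> carrier R" "e \<otimes> (t \<otimes> f) \<notin> J"
    using assms E_carrier[of e] unfolding linked_def by (auto simp: m_assoc)
  then obtain s where "s \<in> carrier R" "cong_mod J (e \<otimes> (t \<otimes> f) \<otimes> s) e"
    using E_right_simple[OF assms(1), of "t \<otimes> f"] assms(2) by auto
  then show thesis
    using that t assms E_carrier[of e] by (simp add: m_assoc)
qed

text \<open>Right simplicity of \<open>e\<close> gives e t f s = e modulo \<open>J\<close>;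
  multiplying by \<open>e\<close> on the right shows that f s e cannot lie in
  \<open>J\<close>.\<close>

lemma linked_sym:
  assumes "e \<in> E" "f \<in> E" "linked e f"
  shows "linked f e"
proof -
  note R = E_carrier[OF assms(1)] E_carrier[OF assms(2)]
  obtain t s where ts: "t \<in> carrier R" "s \<in> carrier R" "cong_mod J ((e \<otimes> t) \<otimes> f \<otimes> s) e"
    using linkedE[OF assms(1) R(2) assms(3)] by blast
  have "cong_mod J ((e \<otimes> t) \<otimes> f \<otimes> s \<otimes> e) (e \<otimes> e)"
    using cong_mod_mult_right[OF J_right ts(3) R(1)] .
  then have "(e \<otimes> t) \<otimes> (f \<otimes> s \<otimes> e) \<notin> J"
    using cong_mod_mem[OF J_left] cong_mod_mem[OF J_left E_idem[OF assms(1)]] E_notin[OF assms(1)] R ts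
    by (simp add: m_assoc)
  then have "f \<otimes> s \<otimes> e \<notin> J"
    using left_idealD(4)[OF J_left, of "e \<otimes> t"] R ts by blast
  then show ?thesis
    using ts unfolding linked_def by blast
qed

text \<open>Since \<open>J\<close> kills Ra, computations may be made modulo \<open>J\<close>. If f
  x a is nonzero, then a = s f x a, and e r a being nonzero puts e (r s) f outside \<open>J\<close>.
  Conversely, e = e t f s modulo \<open>J\<close> shows that \<open>f\<close> does not kill
  Ra.\<close>

lemma left_type_eq_block:
  assumes a: "left_minimal a" and e: "e \<in> left_type a"
  shows "left_type a = block e"
proof -
  note aD = left_minimalD[OF a]
  have eE: "e \<in> E"
    using e by (simp add: left_type_def)
  note eR = E_carrier[OF eE]
  obtain r where r: "r \<in> carrier R" "e \<otimes> (r \<otimes> a) \<noteq> \<zero>"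
    using e by (auto simp: left_type_def)
  have Ja: "j \<otimes> (x \<otimes> a) = \<zero>" if "j \<in> J" "x \<in> carrier R" for j x
    using J_annihilates_minimal[OF a right_idealD(4)[OF J_right that(2,1)]] J_closed[OF that(1)] that(2) aD(1)
    by (simp add: m_assoc)
  have "f \<in> left_type a \<longleftrightarrow> linked e f" if f: "f \<in> E" for f
  proof
    note fR = E_carrier[OF f]
    assume "f \<in> left_type a"
    then obtain x where x: "x \<in> carrier R" "f \<otimes> (x \<otimes> a) \<noteq> \<zero>"
      by (auto simp: left_type_def)
    then obtain s where s: "s \<in> carrier R" "s \<otimes> (f \<otimes> x \<otimes> a) = a"
      using aD(3)[of "f \<otimes> x"] fR aD(1) by (auto simp: m_assoc)
    have "e \<otimes> (r \<otimes> (s \<otimes> (f \<otimes> x \<otimes> a))) \<noteq> \<zero>"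
      using s r by simp
    then have "(e \<otimes> (r \<otimes> s) \<otimes> f) \<otimes> (x \<otimes> a) \<noteq> \<zero>"
      using eR fR r s x aD(1) by (simp add: m_assoc)
    then have "e \<otimes> (r \<otimes> s) \<otimes> f \<notin> J"
      using Ja x(1) by blast
    then show "linked e f"
      using r s unfolding linked_def by blast
  next
    note fR = E_carrier[OF f]
    assume "linked e f"
    then obtain t s where ts: "t \<in> carrier R" "s \<in> carrier R" "cong_mod J ((e \<otimes> t) \<otimes> f \<otimes> s) e"
      using linkedE[OF eE fR] by blast
    have "((e \<otimes> t) \<otimes> f \<otimes> s \<ominus> e) \<otimes> (r \<otimes> a) = \<zero>"
      using ts(3) r(1) by (intro Ja) (simp_all add: cong_mod_def)
    moreover have "((e \<otimes> t) \<otimes> f \<otimes> s \<ominus> e) \<otimes> (r \<otimes> a) =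
      (e \<otimes> t) \<otimes> (f \<otimes> (s \<otimes> r \<otimes> a)) \<ominus> e \<otimes> (r \<otimes> a)"
      using ts eR fR r aD(1) by (simp add: ring_normalize)
    ultimately have "(e \<otimes> t) \<otimes> (f \<otimes> (s \<otimes> r \<otimes> a)) = e \<otimes> (r \<otimes> a)"
      by (intro diff_eq_zeroD[of "(e \<otimes> t) \<otimes> (f \<otimes> (s \<otimes> r \<otimes> a))"])
        (use ts eR fR r aD(1) in simp_all)
    then have "f \<otimes> (s \<otimes> r \<otimes> a) \<noteq> \<zero>"
      using r(2) ts eR by auto
    then show "f \<in> left_type a"
      using f ts r unfolding left_type_def by blast
  qed
  then show ?thesis
    by (auto simp: block_def left_type_def)
qed

lemma left_type_nonempty:
  assumes a: "left_minimal a"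
  obtains e where "e \<in> left_type a" "e \<otimes> a \<noteq> \<zero>"
proof -
  note aD = left_minimalD[OF a]
  obtain e where "e \<in> E" "e \<otimes> a \<noteq> \<zero>"
    using E_separates[OF left_ideal_zero aD(1)] aD(2) J_annihilates_minimal[OF a] by auto
  moreover have "\<one> \<otimes> a = a"
    using aD by simp
  ultimately show thesis
    using that one_closed unfolding left_type_def by force
qed

text \<open>Passing to the opposite ring reverses \<open>linked\<close>, which is symmetric on
  \<open>E\<close>. So left and right types take values in the same finite set of blocks and can be
  counted against each other.\<close>

lemma right_type_eq_block:
  assumes a: "right_minimal a" and e: "e \<in> right_type a"
  shows "right_type a = block e"
proof -
  interpret op: semiprimary "opposite_ring R" J E
    by (rule opposite)
  have type: "op.left_type a = right_type a"
    by (simp add: op.left_type_def right_type_def)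
  have eE: "e \<in> E"
    using e by (simp add: right_type_def)
  have "op.linked e f \<longleftrightarrow> linked f e" if "f \<in> E" for f
    using that E_carrier eE by (simp add: op.linked_def linked_def m_assoc)
  then have "op.block e = block e"
    using linked_sym eE by (auto simp: op.block_def block_def)
  then show ?thesis
    using op.left_type_eq_block[OF a] e type by simp
qed

lemma right_type_nonempty:
  assumes a: "right_minimal a"
  obtains e where "e \<in> right_type a" "a \<otimes> e \<noteq> \<zero>"
proof -
  interpret op: semiprimary "opposite_ring R" J E
    by (rule opposite)
  have type: "op.left_type a = right_type a"
    by (simp add: op.left_type_def right_type_def)
  show thesis
    by (rule op.left_type_nonempty[OF a]) (use that type in simp)
qed

lemma block_self: "e \<in> E \<Longrightarrow> e \<in> block e"
  by (simp add: block_def linked_refl)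

text \<open>
  If \<open>e\<close> killed the left socle then \<open>e\<^sup>k\<close> would kill every \<open>x\<close> with \<open>J\<^sup>k x = 0\<close>, so \<open>e\<close>
  would be nilpotent.
\<close>

lemma exists_minimal_not_killed:
  assumes e: "e \<in> E"
  obtains a where "left_minimal a" "a \<otimes> e \<noteq> \<zero>"
proof -
  note eR = E_carrier[OF e]
  have JR: "J \<subseteq> carrier R"
    using J_closed by blast
  have "\<exists>a. left_minimal a \<and> a \<otimes> e \<noteq> \<zero>"
  proof (rule ccontr)
    assume "\<nexists>a. left_minimal a \<and> a \<otimes> e \<noteq> \<zero>"
    then have none: "\<And>a. left_minimal a \<Longrightarrow> a \<otimes> e = \<zero>"
      by blast
    \<comment> \<open>The assumption about minimal elements extends to everything killed by
      \<open>J\<close>: by \<open>E_separates\<close>, a nonzero y e would leave some f y e nonzero,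
      with f y minimal.\<close>
    have socle: "y \<otimes> e = \<zero>" if y: "y \<in> carrier R" "\<And>j. j \<in> J \<Longrightarrow> j \<otimes> y = \<zero>" for y
    proof (rule ccontr)
      assume "y \<otimes> e \<noteq> \<zero>"
      moreover have "j \<otimes> (y \<otimes> e) = \<zero>" if "j \<in> J" for j
        using y that J_closed[OF that] eR by (simp add: m_assoc[symmetric])
      ultimately obtain f where f: "f \<in> E" "f \<otimes> (y \<otimes> e) \<noteq> \<zero>"
        using E_separates[OF left_ideal_zero, of "y \<otimes> e"] y eR by auto
      then have ne: "f \<otimes> y \<otimes> e \<noteq> \<zero>"
        using y eR E_carrier[OF f(1)] by (simp add: m_assoc)
      then have "f \<otimes> y \<noteq> \<zero>"
        using eR by auto
      then have "left_minimal (f \<otimes> y)"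
        using minimal_of_annihilated(1)[OF f(1) y(1) _ y(2)] by blast
      then show False
        using none ne by blast
    qed
    have "x \<otimes> e [^] k = \<zero>" if "x \<in> carrier R" "\<And>p. p \<in> products R J k \<Longrightarrow> p \<otimes> x = \<zero>" for x k
      using that
    proof (induction k arbitrary: x)
      case 0
      then have "\<one> \<otimes> x = \<zero>"
        by auto
      then show ?case
        using 0 by simp
    next
      case (Suc k)
      have "j \<otimes> (x \<otimes> e [^] k) = \<zero>" if j: "j \<in> J" for j
      proof -
        have "p \<otimes> (j \<otimes> x) = \<zero>" if p: "p \<in> products R J k" for p
        proof -
          have "p \<otimes> j \<in> products R J (Suc k)"
            using p j unfolding products_Suc_right[OF JR] by blast
          then have "p \<otimes> j \<otimes> x = \<zero>"
            by (rule Suc.prems(2))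
          then show ?thesis
            using p j Suc.prems(1) products_closed[OF JR, of k] J_closed[OF j] by (auto simp: m_assoc subset_iff)
        qed
        then have "(j \<otimes> x) \<otimes> e [^] k = \<zero>"
          using Suc.IH[of "j \<otimes> x"] J_closed[OF j] Suc.prems(1) by simp
        then show ?thesis
          using J_closed[OF j] Suc.prems(1) eR by (simp add: m_assoc)
      qed
      then have "(x \<otimes> e [^] k) \<otimes> e = \<zero>"
        using Suc.prems(1) eR by (intro socle) auto
      then show ?case
        using Suc.prems(1) eR by (simp add: m_assoc)
    qed
    moreover obtain n where "products R J n \<subseteq> {\<zero>}"
      using nilpotent by blast
    ultimately have "\<one> \<otimes> e [^] n = \<zero>"
      by fastforce
    then have "e [^] n = \<zero>"
      using eR by simp
    \<comment> \<open>The congruence with \<open>e\<close> below holds for positive exponents, while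
      \<open>n\<close> itself may be zero.\<close>
    then have "e [^] Suc n = \<zero>"
      using eR by simp
    moreover have "cong_mod J (e [^] Suc k) e" for k
    proof (induction k)
      case 0
      then show ?case
        using eR cong_mod_refl[OF J_left] by simp
    next
      case (Suc k)
      then have "cong_mod J (e [^] Suc k \<otimes> e) (e \<otimes> e)"
        using cong_mod_mult_right[OF J_right _ eR] by blast
      then show ?case
        using cong_mod_trans[OF J_left _ E_idem[OF e]] by simp
    qed
    ultimately have "cong_mod J \<zero> e"
      by metis
    then show False
      using cong_mod_mem[OF J_left] left_idealD(2)[OF J_left] E_notin[OF e] by blast
  qed
  then show thesis
    using that by blast
qed

end

section \<open>Minimal left ideals under the unit extension property\<close>

locale macwilliams = semiprimary +
  assumes extension: "\<lbrakk>left_ideal R I; left_linear R I f; inj_on f I\<rbrakk> \<Longrightarrow>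
    \<exists>u\<in>carrier R. \<exists>v\<in>carrier R. u \<otimes> v = \<one> \<and> v \<otimes> u = \<one> \<and> (\<forall>x\<in>I. f x = x \<otimes> u)"
begin

text \<open>By \<open>ann\<close> the assignment of r b to r a is well defined on Ra. As
  \<open>b\<close> is nonzero, its kernel is a proper submodule of a simple module, so the map is
  injective and \<open>extension\<close> applies.\<close>

lemma minimal_unit:
  assumes a: "left_minimal a" and b: "b \<in> carrier R" "b \<noteq> \<zero>"
    and ann: "\<And>r. \<lbrakk>r \<in> carrier R; r \<otimes> a = \<zero>\<rbrakk> \<Longrightarrow> r \<otimes> b = \<zero>"
  obtains u v where "u \<in> carrier R" "v \<in> carrier R" "u \<otimes> v = \<one>" "v \<otimes> u = \<one>" "b = a \<otimes> u"
proof -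
  note aD = left_minimalD[OF a]
  have "left_linear R {\<zero>} (\<lambda>x. x)"
    by (simp add: left_linear_def)
  then obtain g where g: "left_linear R (adjoin {\<zero>} a) g"
    "\<And>x r. \<lbrakk>x \<in> {\<zero>}; r \<in> carrier R\<rbrakk> \<Longrightarrow> g (x \<oplus> r \<otimes> a) = x \<oplus> r \<otimes> b"
    using extend_adjoin[OF left_ideal_zero _ aD(1) b(1)] ann by (metis singletonD)
  have g': "g (r \<otimes> a) = r \<otimes> b" if "r \<in> carrier R" for r
    using g(2)[of \<zero> r] that aD b by simp
  have lA: "left_ideal R (adjoin {\<zero>} a)"
    by (rule left_ideal_adjoin[OF left_ideal_zero aD(1)])
  have "inj_on g (adjoin {\<zero>} a)"
  proof (rule left_linear_injI[OF lA g(1)])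
    fix x assume "x \<in> adjoin {\<zero>} a" "g x = \<zero>"
    then obtain r where r: "r \<in> carrier R" "x = r \<otimes> a" "r \<otimes> b = \<zero>"
      using aD g' by (auto simp: adjoin_def)
    show "x = \<zero>"
    proof (rule ccontr)
      assume "x \<noteq> \<zero>"
      then obtain s where s: "s \<in> carrier R" "s \<otimes> (r \<otimes> a) = a"
        using aD(3)[OF r(1)] r(2) by blast
      have "(s \<otimes> r \<ominus> \<one>) \<otimes> a = \<zero>"
        using s r(1) aD(1) by (simp add: ring_normalize)
      then have "(s \<otimes> r \<ominus> \<one>) \<otimes> b = \<zero>"
        using s(1) r(1) by (intro ann) auto
      then have "s \<otimes> (r \<otimes> b) \<ominus> b = \<zero>"
        using s(1) r(1) b(1) by (simp add: ring_normalize)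
      then show False
        using r(3) s(1) b by (simp add: minus_eq)
    qed
  qed
  then obtain u v where uv: "u \<in> carrier R" "v \<in> carrier R" "u \<otimes> v = \<one>" "v \<otimes> u = \<one>"
    "\<And>x. x \<in> adjoin {\<zero>} a \<Longrightarrow> g x = x \<otimes> u"
    using extension[OF lA g(1)] by blast
  have "g a = a \<otimes> u"
    using uv(5) adjoin_elem[OF left_ideal_zero aD(1)] by blast
  then have "b = a \<otimes> u"
    using g'[of \<one>] aD b by simp
  then show thesis
    using that uv by blast
qed

text \<open>Whatever kills \<open>a\<close> on the left kills a r, so \<open>minimal_unit\<close>
  gives a r = a u with a unit \<open>u\<close>, and its inverse takes a r back to
  \<open>a\<close>.\<close>

lemma right_minimal_if_left_minimal:
  assumes a: "left_minimal a"
  shows "right_minimal a"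
  unfolding right_minimal_iff
proof (intro conjI ballI impI)
  note aD = left_minimalD[OF a]
  show "a \<in> carrier R" "a \<noteq> \<zero>"
    using aD by auto
  fix r assume r: "r \<in> carrier R" "a \<otimes> r \<noteq> \<zero>"
  have "x \<otimes> (a \<otimes> r) = \<zero>" if "x \<in> carrier R" "x \<otimes> a = \<zero>" for x
    using that r aD by (simp add: m_assoc[symmetric])
  then obtain u v where "u \<in> carrier R" "v \<in> carrier R" "u \<otimes> v = \<one>" "a \<otimes> r = a \<otimes> u"
    using minimal_unit[OF a _ r(2)] r(1) aD(1) by (metis m_closed)
  then show "\<exists>s\<in>carrier R. a \<otimes> r \<otimes> s = a"
    using aD(1) by (intro bexI[of _ v]) (simp_all add: m_assoc)
qed

text \<open>Suitable nonzero multiples e r a and e s b have the same left annihilator, determined by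
  \<open>e\<close>, so a unit carries one to the other, and minimality recovers \<open>b\<close>
  from e s b. The two-sided form of the result is what compares the right types of \<open>a\<close>
  and \<open>b\<close>.\<close>

lemma factor_of_left_type:
  assumes a: "left_minimal a" and b: "left_minimal b" and e: "e \<in> left_type a" "e \<in> left_type b"
  obtains p u where "p \<in> carrier R" "u \<in> carrier R" "b = p \<otimes> (a \<otimes> u)"
proof -
  note aD = left_minimalD[OF a] and bD = left_minimalD[OF b]
  have eE: "e \<in> E"
    using e by (simp add: left_type_def)
  note eR = E_carrier[OF eE]
  have *: "left_minimal (e \<otimes> (r \<otimes> c)) \<and>
      (\<forall>x\<in>carrier R. x \<otimes> (e \<otimes> (r \<otimes> c)) = \<zero> \<longleftrightarrow> x \<otimes> e \<in> J)"
    if c: "left_minimal c" "r \<in> carrier R" "e \<otimes> (r \<otimes> c) \<noteq> \<zero>" for c r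
  proof -
    have "j \<otimes> (r \<otimes> c) = \<zero>" if "j \<in> J" for j
      using J_annihilates_minimal[OF c(1) right_idealD(4)[OF J_right c(2) that]] J_closed[OF that] c(2)
        left_minimalD(1)[OF c(1)] by (simp add: m_assoc)
    then show ?thesis
      using minimal_of_annihilated[OF eE, of "r \<otimes> c"] c left_minimalD(1)[OF c(1)] by simp
  qed
  obtain r where r: "r \<in> carrier R" "e \<otimes> (r \<otimes> a) \<noteq> \<zero>"
    using e(1) by (auto simp: left_type_def)
  obtain s where s: "s \<in> carrier R" "e \<otimes> (s \<otimes> b) \<noteq> \<zero>"
    using e(2) by (auto simp: left_type_def)
  obtain u where u: "u \<in> carrier R" "e \<otimes> (s \<otimes> b) = e \<otimes> (r \<otimes> a) \<otimes> u"
    using minimal_unit[of "e \<otimes> (r \<otimes> a)" "e \<otimes> (s \<otimes> b)"] *[OF a r] *[OF b s] s(2)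
      left_minimalD(1) by metis
  obtain t where t: "t \<in> carrier R" "t \<otimes> (e \<otimes> s \<otimes> b) = b"
    using bD(3)[of "e \<otimes> s"] s eR bD(1) by (auto simp: m_assoc)
  have "b = t \<otimes> (e \<otimes> (r \<otimes> a) \<otimes> u)"
    using t s eR bD(1) by (simp add: u(2)[symmetric] m_assoc)
  then have "b = (t \<otimes> e \<otimes> r) \<otimes> (a \<otimes> u)"
    using t(1) eR r(1) aD(1) u(1) by (simp add: m_assoc)
  then show thesis
    using that t(1) eR r(1) u(1) by (metis m_closed)
qed

lemma right_type_le:
  assumes a: "left_minimal a" and b: "left_minimal b" and e: "e \<in> left_type a" "e \<in> left_type b"
  shows "right_type b \<subseteq> right_type a"
proof
  note aD = left_minimalD[OF a]
  obtain p u where pu: "p \<in> carrier R" "u \<in> carrier R" "b = p \<otimes> (a \<otimes> u)"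
    using factor_of_left_type[OF a b e] by blast
  fix f assume "f \<in> right_type b"
  then obtain x where f: "f \<in> E" and x: "x \<in> carrier R" "(b \<otimes> x) \<otimes> f \<noteq> \<zero>"
    by (auto simp: right_type_def)
  have "(b \<otimes> x) \<otimes> f = p \<otimes> ((a \<otimes> (u \<otimes> x)) \<otimes> f)"
    using pu x(1) aD(1) E_carrier[OF f] by (simp add: m_assoc)
  then have "(a \<otimes> (u \<otimes> x)) \<otimes> f \<noteq> \<zero>"
    using x(2) pu(1) by auto
  then show "f \<in> right_type a"
    using f pu x unfolding right_type_def by blast
qed

text \<open>
  The left type of a minimal element determines its right type, and every block is a right type;
  since there are finitely many blocks, this correspondence is a bijection.
\<close>

lemma type_bijection:
  obtains h where "\<And>C. C \<in> block ` E \<Longrightarrow> \<exists>a. left_minimal a \<and> right_type a = C \<and> left_type a = h C"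
    "h ` block ` E = block ` E"
    "\<And>a. left_minimal a \<Longrightarrow> left_type a = h (right_type a)"
proof -
  have right_block: "right_type a = block e" if "left_minimal a" "e \<in> right_type a" for a e
    using right_type_eq_block[OF right_minimal_if_left_minimal] that by blast
  have "\<exists>a. left_minimal a \<and> right_type a = C" if C: "C \<in> block ` E" for C
  proof -
    obtain e where e: "e \<in> E" "C = block e"
      using C by auto
    obtain a where a: "left_minimal a" "a \<otimes> e \<noteq> \<zero>"
      using exists_minimal_not_killed[OF e(1)] by blast
    then have "a \<otimes> \<one> \<otimes> e \<noteq> \<zero>"
      using left_minimalD(1) by simp
    then have "e \<in> right_type a"
      using e(1) one_closed unfolding right_type_def by blast
    then show ?thesis
      using right_block a(1) e(2) by blast
  qed
  then obtain g where g: "\<And>C. C \<in> block ` E \<Longrightarrow> left_minimal (g C)"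
    "\<And>C. C \<in> block ` E \<Longrightarrow> right_type (g C) = C"
    by metis
  \<comment> \<open>\<open>h\<close> runs from right types to left types because every block is
    already known to occur as a right type. It is injective since equal left types force equal right
    types.\<close>
  define h where "h C = left_type (g C)" for C
  have left_block: "left_type a \<in> block ` E" "\<exists>e. e \<in> left_type a" if a: "left_minimal a" for a
  proof -
    obtain e where e: "e \<in> left_type a"
      using left_type_nonempty[OF a] by blast
    then show "left_type a \<in> block ` E" "\<exists>e. e \<in> left_type a"
      using left_type_eq_block[OF a e] by (auto simp: left_type_def)
  qed
  have determines: "right_type a = right_type b"
    if "left_minimal a" "left_minimal b" "left_type a = left_type b" for a b
    using right_type_le[of a b] right_type_le[of b a] left_block(2)[OF that(1)] that by blast
  have "inj_on h (block ` E)"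
    using determines g unfolding h_def by (intro inj_onI) metis
  moreover have "h ` block ` E \<subseteq> block ` E"
    using left_block(1) g(1) by (auto simp: h_def)
  ultimately have surj: "h ` block ` E = block ` E"
    using E_finite by (intro endo_inj_surj) auto
  have "left_type a = h (right_type a)" if a: "left_minimal a" for a
  proof -
    have "left_type a \<in> h ` block ` E"
      using left_block(1)[OF a] surj by simp
    then obtain C where C: "C \<in> block ` E" "left_type a = left_type (g C)"
      by (auto simp: h_def)
    then have "right_type a = C"
      using determines[OF a g(1)[OF C(1)] C(2)] g(2)[OF C(1)] by simp
    then show ?thesis
      using C by (simp add: h_def)
  qed
  moreover have "\<exists>a. left_minimal a \<and> right_type a = C \<and> left_type a = h C" if "C \<in> block ` E" for C
    using g[OF that] h_def by blast
  ultimately show thesis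
    using that surj by blast
qed

text \<open>Surjectivity of \<open>h\<close> means that every simple left module is isomorphic to a
  left ideal of R. These left ideals are the targets of the maps in
  \<open>left_double_annihilator\<close>.\<close>

lemma exists_minimal_of_left_type:
  assumes "e \<in> E"
  obtains a where "left_minimal a" "e \<in> left_type a"
proof -
  obtain h where h: "\<And>C. C \<in> block ` E \<Longrightarrow> \<exists>a. left_minimal a \<and> right_type a = C \<and> left_type a = h C"
    "h ` block ` E = block ` E"
    using type_bijection by metis
  have "block e \<in> h ` block ` E"
    using assms h(2) by simp
  then obtain C where "C \<in> block ` E" "block e = h C"
    by blast
  then obtain a where "left_minimal a" "left_type a = block e"
    using h(1) by metis
  then show thesis
    using that block_self[OF assms] by simp
qed

text \<open>The left type is the value of \<open>h\<close> at the right type, so equal right types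
  force equal left types and \<open>factor_of_left_type\<close> becomes applicable.\<close>

lemma factor_of_right_type:
  assumes a: "left_minimal a" and b: "left_minimal b" and e: "e \<in> right_type a" "e \<in> right_type b"
  obtains p u where "p \<in> carrier R" "u \<in> carrier R" "b = p \<otimes> (a \<otimes> u)"
proof -
  obtain h where h: "\<And>a. left_minimal a \<Longrightarrow> left_type a = h (right_type a)"
    using type_bijection by metis
  have "right_type a = right_type b"
    using right_type_eq_block[OF right_minimal_if_left_minimal[OF a] e(1)] right_type_eq_block[OF right_minimal_if_left_minimal[OF b] e(2)]
    by simp
  then have "left_type a = left_type b"
    using h a b by simp
  moreover obtain f where "f \<in> left_type a"
    using left_type_nonempty[OF a] by blast
  ultimately show thesis
    using factor_of_left_type[OF a b] that by blast
qed

end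

section \<open>Self-injectivity and double annihilators\<close>

context ring
begin

definition right_annihilator :: "'a set \<Rightarrow> 'a set"
  where "right_annihilator X = {y \<in> carrier R. \<forall>x\<in>X. x \<otimes> y = \<zero>}"

definition left_annihilator :: "'a set \<Rightarrow> 'a set"
  where "left_annihilator X = {y \<in> carrier R. \<forall>x\<in>X. y \<otimes> x = \<zero>}"

lemma left_ideal_left_annihilator:
  "X \<subseteq> carrier R \<Longrightarrow> left_ideal R (left_annihilator X)"
  unfolding left_annihilator_def by (rule left_ideal_annihilator)

lemma right_ideal_right_annihilator:
  "X \<subseteq> carrier R \<Longrightarrow> right_ideal R (right_annihilator X)"
  using ring.left_ideal_annihilator[OF opposite_ring, of X] by (simp add: right_annihilator_def)

lemma annihilator_antimono:
  "X \<subseteq> Y \<Longrightarrow> left_annihilator Y \<subseteq> left_annihilator X"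
  "X \<subseteq> Y \<Longrightarrow> right_annihilator Y \<subseteq> right_annihilator X"
  by (auto simp: left_annihilator_def right_annihilator_def)

lemma annihilator_galois:
  assumes "X \<subseteq> carrier R"
  shows "X \<subseteq> left_annihilator (right_annihilator X)" "X \<subseteq> right_annihilator (left_annihilator X)"
  using assms by (auto simp: left_annihilator_def right_annihilator_def)

lemma right_annihilator_carrier: "right_annihilator (carrier R) = {\<zero>}"
  unfolding right_annihilator_def using l_one one_closed by fastforce

end

context semiprimary
begin

text \<open>For a left ideal killed by \<open>J\<close>, inclusion in another left ideal can be
  tested on its minimal elements.\<close>

lemma minimal_generators:
  assumes T: "left_ideal R T" and JT: "\<And>j t. \<lbrakk>j \<in> J; t \<in> T\<rbrakk> \<Longrightarrow> j \<otimes> t = \<zero>"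
    and L: "left_ideal R L" and t: "t \<in> T" "t \<notin> L"
  obtains e where "e \<in> E" "left_minimal (e \<otimes> t)" "e \<otimes> t \<in> T" "e \<otimes> t \<notin> L"
proof -
  have tR: "t \<in> carrier R"
    using left_idealD(1)[OF T t(1)] .
  obtain e where e: "e \<in> E" "e \<otimes> t \<notin> L"
    using E_separates[OF L tR t(2)] JT t(1) left_idealD(2)[OF L] by auto
  then have "e \<otimes> t \<noteq> \<zero>"
    using left_idealD(2)[OF L] by auto
  then have "left_minimal (e \<otimes> t)"
    using minimal_of_annihilated(1)[OF e(1) tR] JT t(1) by blast
  then show thesis
    using that e left_idealD(4)[OF T E_carrier[OF e(1)] t(1)] by blast
qed

end

section \<open>Extension of maps from left ideals\<close>

context macwilliams
begin

text \<open>If t j were nonzero, some left minimal e t would also satisfy e t j nonzero. But left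
  minimal elements are right minimal, and \<open>J\<close> kills those on the right by the opposite
  form of \<open>J_annihilates_minimal\<close>.\<close>

lemma annihilated_by_J:
  assumes T: "left_ideal R T" and JT: "\<And>j t. \<lbrakk>j \<in> J; t \<in> T\<rbrakk> \<Longrightarrow> j \<otimes> t = \<zero>"
    and t: "t \<in> T" and j: "j \<in> J"
  shows "t \<otimes> j = \<zero>"
proof (rule ccontr)
  assume ne: "t \<otimes> j \<noteq> \<zero>"
  interpret op: semiprimary "opposite_ring R" J E
    by (rule opposite)
  let ?L = "left_annihilator {j}"
  have jR: "j \<in> carrier R"
    using J_closed[OF j] .
  have L: "left_ideal R ?L"
    using jR by (intro left_ideal_left_annihilator) auto
  have "t \<notin> ?L"
    using ne by (simp add: left_annihilator_def)
  then obtain e where e: "e \<in> E" "left_minimal (e \<otimes> t)" "e \<otimes> t \<notin> ?L"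
    using minimal_generators[OF T JT L t] by metis
  have "e \<otimes> t \<otimes> j = \<zero>"
    using op.J_annihilates_minimal[OF right_minimal_if_left_minimal[OF e(2)] j] by simp
  then show False
    using e(3) left_minimalD(1)[OF e(2)] by (simp add: left_annihilator_def)
qed

text \<open>
  A unit that fixes \<open>T\<close> pointwise but moves \<open>b\<close> gives \<open>x = u - 1\<close>. Such a unit exists as soon as
  \<open>Rb\<close> has another embedding avoiding \<open>T\<close>; otherwise \<open>bR = {0, b}\<close>, and the bijection between
  left and right types prevents \<open>T\<close> from having the right type of \<open>b\<close>.
\<close>

lemma separate_minimal:
  assumes T: "left_ideal R T" and JT: "\<And>j t. \<lbrakk>j \<in> J; t \<in> T\<rbrakk> \<Longrightarrow> j \<otimes> t = \<zero>"
    and b: "left_minimal b" "b \<notin> T"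
  obtains x where "x \<in> right_annihilator T" "b \<otimes> x \<noteq> \<zero>"
proof -
  note bD = left_minimalD[OF b(1)] and TD = left_idealD[OF T]
  have b_in: "b \<in> T" if r: "r \<in> carrier R" "r \<otimes> b \<in> T" "r \<otimes> b \<noteq> \<zero>" for r
  proof -
    obtain s where "s \<in> carrier R" "s \<otimes> (r \<otimes> b) = b"
      using bD(3)[OF r(1,3)] by blast
    then show ?thesis
      using TD(4)[of s "r \<otimes> b"] r(2) by simp
  qed
  \<comment> \<open>By \<open>ann\<close> the generator \<open>b\<close> may be sent to
    \<open>c\<close>. As Rb meets \<open>T\<close> only in zero, this glues with the identity of
    \<open>T\<close>, and the glued map is injective because \<open>c\<close> is outside
    \<open>T\<close>.\<close>
  have move: "\<exists>x\<in>right_annihilator T. b \<otimes> x \<noteq> \<zero>"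
    if c: "c \<in> carrier R" "c \<noteq> b" "c \<notin> T"
      and ann: "\<And>r. \<lbrakk>r \<in> carrier R; r \<otimes> b = \<zero>\<rbrakk> \<Longrightarrow> r \<otimes> c = \<zero>" for c
  proof -
    have lin: "left_linear R T (\<lambda>x. x)"
      using TD(1) by (simp add: left_linear_def)
    have "r \<otimes> b = r \<otimes> c" if "r \<in> carrier R" "r \<otimes> b \<in> T" for r
      using that b_in b(2) ann by metis
    then obtain g where g: "left_linear R (adjoin T b) g"
      "\<And>t r. \<lbrakk>t \<in> T; r \<in> carrier R\<rbrakk> \<Longrightarrow> g (t \<oplus> r \<otimes> b) = t \<oplus> r \<otimes> c"
      using extend_adjoin[OF T lin bD(1) c(1)] by metis
    have lA: "left_ideal R (adjoin T b)"
      by (rule left_ideal_adjoin[OF T bD(1)])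
    have "inj_on g (adjoin T b)"
    proof (rule left_linear_injI[OF lA g(1)])
      fix x assume "x \<in> adjoin T b" and gx: "g x = \<zero>"
      then obtain t r where x: "x = t \<oplus> r \<otimes> b" "t \<in> T" "r \<in> carrier R"
        unfolding adjoin_def by blast
      have tR: "t \<in> carrier R"
        using TD(1) x(2) .
      have eq: "t \<oplus> r \<otimes> c = \<zero>"
        using g(2) gx x by simp
      have "r \<otimes> b = \<zero>"
      proof (rule ccontr)
        assume "r \<otimes> b \<noteq> \<zero>"
        then obtain s where s: "s \<in> carrier R" "s \<otimes> (r \<otimes> b) = b"
          using bD(3)[OF x(3)] by blast
        have "(s \<otimes> r \<ominus> \<one>) \<otimes> b = \<zero>"
          using s x(3) bD(1) by (simp add: ring_normalize)
        then have "(s \<otimes> r \<ominus> \<one>) \<otimes> c = \<zero>"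
          using s(1) x(3) by (intro ann) auto
        then have "s \<otimes> (r \<otimes> c) \<ominus> c = \<zero>"
          using s(1) x(3) c(1) by (simp add: ring_normalize)
        then have c_eq: "s \<otimes> (r \<otimes> c) = c"
          using diff_eq_zeroD[of "s \<otimes> (r \<otimes> c)" c] s(1) x(3) c(1) by simp
        have "r \<otimes> c = \<ominus> t"
          using minus_equality[of "r \<otimes> c" t] eq x(3) c(1) tR by (simp add: a_comm)
        then have "s \<otimes> (r \<otimes> c) \<in> T"
          using TD(4)[OF s(1)] left_ideal_minus[OF T x(2)] by simp
        then show False
          using c_eq c(3) by simp
      qed
      then show "x = \<zero>"
        using eq ann x tR by simp
    qed
    then obtain u where u: "u \<in> carrier R" "\<And>x. x \<in> adjoin T b \<Longrightarrow> g x = x \<otimes> u"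
      using extension[OF lA g(1)] by blast
    have "t \<otimes> (u \<ominus> \<one>) = \<zero>" if t: "t \<in> T" for t
    proof -
      have "t \<otimes> u = g t"
        using u(2) adjoin_base[OF T bD(1)] t by auto
      also have "g t = t"
        using g(2)[OF t zero_closed] TD(1)[OF t] bD(1) c(1) by simp
      finally show ?thesis
        using u(1) TD(1)[OF t] by (simp add: ring_normalize)
    qed
    moreover have "b \<otimes> (u \<ominus> \<one>) \<noteq> \<zero>"
    proof
      assume "b \<otimes> (u \<ominus> \<one>) = \<zero>"
      then have "b \<otimes> u \<ominus> b = \<zero>"
        using u(1) bD(1) by (simp add: ring_normalize)
      then have "b \<otimes> u = b"
        using diff_eq_zeroD[of "b \<otimes> u" b] u(1) bD(1) by simp
      moreover have "b \<otimes> u = g b"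
        using u(2) adjoin_elem[OF T bD(1)] by simp
      moreover have "g b = c"
        using g(2)[OF TD(2) one_closed] bD(1) c(1) by simp
      ultimately show False
        using c(2) by simp
    qed
    ultimately show ?thesis
      using u(1) by (intro bexI[of _ "u \<ominus> \<one>"]) (auto simp: right_annihilator_def)
  qed
  have "\<exists>x\<in>right_annihilator T. b \<otimes> x \<noteq> \<zero>"
  proof (rule ccontr)
    assume neg: "\<not> ?thesis"
    \<comment> \<open>A value b r other than 0 and b is a candidate for \<open>move\<close> unless
      it lies in \<open>T\<close>; in that case b + b r is a candidate.\<close>
    have bR: "b \<otimes> r = \<zero> \<or> b \<otimes> r = b" if r: "r \<in> carrier R" for r
    proof (rule ccontr)
      assume H: "\<not> ?thesis"
      have "x \<otimes> (b \<otimes> r) = \<zero>" if "x \<in> carrier R" "x \<otimes> b = \<zero>" for x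
        using that r bD(1) by (simp add: m_assoc[symmetric])
      then have brT: "b \<otimes> r \<in> T"
        using move[of "b \<otimes> r"] neg H r bD(1) by auto
      have "x \<otimes> (b \<oplus> b \<otimes> r) = \<zero>" if "x \<in> carrier R" "x \<otimes> b = \<zero>" for x
        using that r bD(1) by (simp add: r_distr m_assoc[symmetric])
      moreover have "b \<oplus> b \<otimes> r \<notin> T"
      proof
        assume "b \<oplus> b \<otimes> r \<in> T"
        then have "(b \<oplus> b \<otimes> r) \<ominus> b \<otimes> r \<in> T"
          using left_ideal_diff[OF T _ brT] by blast
        then show False
          using b(2) r bD(1) by (simp add: ring_normalize)
      qed
      moreover have "b \<oplus> b \<otimes> r \<noteq> b"
        using H add.l_cancel_one'[of b "b \<otimes> r"] r bD(1) by auto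
      ultimately show False
        using move[of "b \<oplus> b \<otimes> r"] neg r bD(1) by blast
    qed
    obtain e where e: "e \<in> right_type b" "b \<otimes> e \<noteq> \<zero>"
      using right_type_nonempty[OF right_minimal_if_left_minimal[OF b(1)]] by blast
    have eE: "e \<in> E"
      using e(1) by (simp add: right_type_def)
    note eR = E_carrier[OF eE]
    \<comment> \<open>Since b e is nonzero, \<open>e\<close> would separate if it killed
      \<open>T\<close>. Otherwise \<open>T\<close> has a minimal element f t with \<open>e\<close>
      in its right type, hence equal to p b u; as b u can only be \<open>b\<close>, the nonzero
      element p b lies in \<open>T\<close>, and so does \<open>b\<close>.\<close>
    have "e \<notin> right_annihilator T"
      using neg e(2) by blast
    then obtain t where t: "t \<in> T" "t \<notin> left_annihilator {e}"
      using eR by (auto simp: right_annihilator_def left_annihilator_def)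
    have lL: "left_ideal R (left_annihilator {e})"
      using eR by (intro left_ideal_left_annihilator) auto
    obtain f where f: "left_minimal (f \<otimes> t)" "f \<otimes> t \<in> T" "f \<otimes> t \<notin> left_annihilator {e}"
      using minimal_generators[OF T JT lL t] by metis
    then have "f \<otimes> t \<otimes> \<one> \<otimes> e \<noteq> \<zero>"
      using left_minimalD(1)[OF f(1)] by (simp add: left_annihilator_def)
    then have "e \<in> right_type (f \<otimes> t)"
      using eE one_closed unfolding right_type_def by blast
    then obtain p u where pu: "p \<in> carrier R" "u \<in> carrier R" "f \<otimes> t = p \<otimes> (b \<otimes> u)"
      using factor_of_right_type[OF b(1) f(1) e(1)] by blast
    then have "f \<otimes> t = p \<otimes> b"
      using bR[OF pu(2)] left_minimalD(2)[OF f(1)] by auto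
    then show False
      using b_in[OF pu(1)] f(2) left_minimalD(2)[OF f(1)] b(2) by simp
  qed
  then show thesis
    using that by blast
qed

text \<open>The chain condition comes from R/J: right annihilators of left ideals inside
  \<open>T\<close> contain \<open>J\<close> by \<open>annihilated_by_J\<close>, and right ideals
  above \<open>J\<close> satisfy the descending condition. So some \<open>K\<close> on which
  \<open>f\<close> is a multiplication has a minimal right annihilator. Adjoining a minimal
  \<open>b\<close> outside \<open>K\<close> would shrink it strictly by
  \<open>separate_minimal\<close>.\<close>

lemma extend_from_socle:
  assumes T: "left_ideal R T" and JT: "\<And>j t. \<lbrakk>j \<in> J; t \<in> T\<rbrakk> \<Longrightarrow> j \<otimes> t = \<zero>"
    and f: "left_linear R T f"
  obtains c where "c \<in> carrier R" "\<And>x. x \<in> T \<Longrightarrow> f x = x \<otimes> c"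
proof -
  note TD = left_idealD[OF T] and fD = left_linearD[OF f]
  interpret op: semiprimary "opposite_ring R" J E
    by (rule opposite)
  let ?P = "\<lambda>K. left_ideal R K \<and> K \<subseteq> T \<and> (\<exists>c\<in>carrier R. \<forall>x\<in>K. f x = x \<otimes> c)"
  let ?S = "{right_annihilator K |K. ?P K}"
  have S: "right_ideal R A \<and> J \<subseteq> A" if A: "A \<in> ?S" for A
  proof -
    obtain K where K: "A = right_annihilator K" "left_ideal R K" "K \<subseteq> T"
      using A by blast
    have "J \<subseteq> right_annihilator K"
      using annihilated_by_J[OF T JT] K(3) J_closed by (auto simp: right_annihilator_def)
    then show ?thesis
      using right_ideal_right_annihilator[of K] left_idealD(1)[OF K(2)] K(1) by blast
  qed
  have "?P {\<zero>}"
    using left_ideal_zero TD(2) left_linear_zero[OF T f] by (auto intro!: bexI[of _ \<zero>])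
  then have "right_annihilator {\<zero>} \<in> ?S"
    by blast
  then have "\<exists>A\<in>?S. \<forall>B\<in>?S. B \<subseteq> A \<longrightarrow> B = A"
    using op.left_dcc_minimal[of J ?S] op.left_dcc_above_J S by simp
  then obtain A where A: "A \<in> ?S" "\<And>B. \<lbrakk>B \<in> ?S; B \<subseteq> A\<rbrakk> \<Longrightarrow> B = A"
    by (elim bexE) simp
  obtain K where K: "?P K" and A_eq: "A = right_annihilator K"
    using A(1) by blast
  have lK: "left_ideal R K" and KT: "K \<subseteq> T"
    using K by auto
  obtain c where c: "c \<in> carrier R" "\<And>x. x \<in> K \<Longrightarrow> f x = x \<otimes> c"
    using K by blast
  have "T \<subseteq> K"
  proof (rule ccontr)
    assume "\<not> T \<subseteq> K"
    then obtain t where t: "t \<in> T" "t \<notin> K"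
      by blast
    obtain e where e: "left_minimal (e \<otimes> t)" "e \<otimes> t \<in> T" "e \<otimes> t \<notin> K"
      using minimal_generators[OF T JT lK t] by metis
    define b where "b = e \<otimes> t"
    have b: "left_minimal b" "b \<in> T" "b \<notin> K"
      using e by (auto simp: b_def)
    note bR = left_minimalD(1)[OF b(1)]
    have JK: "\<And>j t. \<lbrakk>j \<in> J; t \<in> K\<rbrakk> \<Longrightarrow> j \<otimes> t = \<zero>"
      using JT KT by blast
    obtain x where x: "x \<in> right_annihilator K" "b \<otimes> x \<noteq> \<zero>"
      using separate_minimal[OF lK JK b(1,3)] by blast
    have xR: "x \<in> carrier R"
      using x(1) by (simp add: right_annihilator_def)
    obtain y where y: "y \<in> carrier R" "b \<otimes> x \<otimes> y = b"
      using right_minimal_if_left_minimal[OF b(1)] xR x(2) unfolding right_minimal_iff by blast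
    \<comment> \<open>\<open>d\<close> is the error of \<open>c\<close> at \<open>b\<close>.
      Whatever kills \<open>b\<close> on the left kills \<open>d\<close>, so by
      \<open>minimal_unit\<close> a nonzero \<open>d\<close> has the form b w.\<close>
    define d where "d = f b \<ominus> b \<otimes> c"
    have dR: "d \<in> carrier R"
      using fD(1)[OF b(2)] bR c(1) by (simp add: d_def)
    have "\<exists>w\<in>carrier R. d = b \<otimes> w"
    proof (cases "d = \<zero>")
      case True
      then show ?thesis
        using bR by (intro bexI[of _ \<zero>]) auto
    next
      case False
      have "r \<otimes> d = \<zero>" if r: "r \<in> carrier R" "r \<otimes> b = \<zero>" for r
      proof -
        have "r \<otimes> d = f (r \<otimes> b) \<ominus> (r \<otimes> b) \<otimes> c"
          using r(1) fD(1,3) b(2) bR c(1) by (simp add: d_def ring_normalize)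
        then show ?thesis
          using r(2) left_linear_zero[OF T f] c(1) by (simp add: minus_eq)
      qed
      then show ?thesis
        using minimal_unit[OF b(1) dR False] by metis
    qed
    then obtain w where w: "w \<in> carrier R" "d = b \<otimes> w" ..
    \<comment> \<open>The added term vanishes on \<open>K\<close>, because \<open>x\<close> is
      annihilated by \<open>K\<close>, and contributes b x y w = b w = d at
      \<open>b\<close>.\<close>
    define c' where "c' = c \<oplus> x \<otimes> y \<otimes> w"
    have c'R: "c' \<in> carrier R"
      using c(1) xR y(1) w(1) by (simp add: c'_def)
    have "b \<otimes> c' = b \<otimes> c \<oplus> (b \<otimes> x \<otimes> y) \<otimes> w"
      using bR c(1) xR y(1) w(1) by (simp add: c'_def r_distr m_assoc)
    also have "\<dots> = f b"
      using y(2) w(2)[symmetric] fD(1)[OF b(2)] bR c(1) by (simp add: d_def ring_normalize)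
    finally have fb: "f b = b \<otimes> c'"
      by simp
    have fK: "f k = k \<otimes> c'" if k: "k \<in> K" for k
    proof -
      have kR: "k \<in> carrier R" and "k \<otimes> x = \<zero>"
        using left_idealD(1)[OF lK k] x(1) k by (auto simp: right_annihilator_def)
      then have "k \<otimes> (x \<otimes> y \<otimes> w) = \<zero>"
        using xR y(1) w(1) by (simp add: m_assoc[symmetric])
      then show ?thesis
        using c k kR xR y(1) w(1) by (simp add: c'_def r_distr)
    qed
    have "f z = z \<otimes> c'" if zK: "z \<in> adjoin K b" for z
    proof -
      obtain k r where z: "z = k \<oplus> r \<otimes> b" "k \<in> K" "r \<in> carrier R"
        using zK unfolding adjoin_def by blast
      then have "f z = f k \<oplus> r \<otimes> f b"
        using fD(2)[of k "r \<otimes> b"] fD(3) TD(4) b(2) KT by auto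
      then show ?thesis
        using z fK fb left_idealD(1)[OF lK z(2)] bR c'R by (simp add: l_distr m_assoc)
    qed
    then have "?P (adjoin K b)"
      using left_ideal_adjoin[OF lK bR] adjoin_subset[OF T KT b(2)] c'R by blast
    then have "right_annihilator (adjoin K b) \<in> ?S"
      by blast
    then have "right_annihilator (adjoin K b) = right_annihilator K"
      using A(2) annihilator_antimono(2)[OF adjoin_base[OF lK bR]] A_eq by blast
    then have "b \<otimes> x = \<zero>"
      using x(1) adjoin_elem[OF lK bR] by (auto simp: right_annihilator_def)
    then show False
      using x(2) by simp
  qed
  then show thesis
    using that[OF c(1)] c(2) by blast
qed

theorem left_baer: "left_baer R"
  unfolding left_baer_def
proof (intro allI impI)
  fix I f assume "left_ideal R I \<and> left_linear R I f"
  then have I: "left_ideal R I" and f: "left_linear R I f"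
    by auto
  note ID = left_idealD[OF I] and fD = left_linearD[OF f]
  \<comment> \<open>As R/J is semisimple, the elements of \<open>I\<close> killed by
    \<open>J\<close> form its socle.\<close>
  define T where "T = {x \<in> I. \<forall>j\<in>J. j \<otimes> x = \<zero>}"
  have T: "left_ideal R T"
    unfolding left_ideal_def
  proof (intro conjI ballI)
    show "T \<subseteq> carrier R"
      using ID(1) by (auto simp: T_def)
    show "\<zero> \<in> T"
      using ID(2) J_closed by (simp add: T_def)
    show "x \<oplus> y \<in> T" if "x \<in> T" "y \<in> T" for x y
      using that ID(1,3) J_closed by (simp add: T_def r_distr)
    show "a \<otimes> x \<in> T" if a: "a \<in> carrier R" and x: "x \<in> T" for a x
    proof -
      have "j \<otimes> (a \<otimes> x) = \<zero>" if j: "j \<in> J" for j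
        using right_idealD(4)[OF J_right a j] x a J_closed[OF j] ID(1) by (simp add: T_def m_assoc[symmetric])
      then show ?thesis
        using ID(4) a x by (simp add: T_def)
    qed
  qed
  have "left_linear R T f"
    using f by (auto simp: left_linear_def T_def)
  moreover have "\<And>j t. \<lbrakk>j \<in> J; t \<in> T\<rbrakk> \<Longrightarrow> j \<otimes> t = \<zero>"
    by (simp add: T_def)
  ultimately obtain c where c: "c \<in> carrier R" "\<And>x. x \<in> T \<Longrightarrow> f x = x \<otimes> c"
    using extend_from_socle[OF T] by metis
  define h where "h x = x \<oplus> (f x \<ominus> x \<otimes> c)" for x
  have h: "left_linear R I h"
    using ID fD c(1) by (auto simp: left_linear_def h_def ring_normalize)
  have "inj_on h I"
  proof (rule left_linear_injI[OF I h])
    fix x assume x: "x \<in> I" "h x = \<zero>"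
    show "x = \<zero>"
    proof (rule ccontr)
      assume "x \<noteq> \<zero>"
      then obtain r where r: "r \<in> carrier R" "left_minimal (r \<otimes> x)"
        using left_socle_essential[OF ID(1)[OF x(1)]] by blast
      note rx = left_minimalD[OF r(2)]
      have "r \<otimes> x \<in> T"
        using J_annihilates_minimal[OF r(2)] ID(4)[OF r(1) x(1)] by (simp add: T_def)
      then have "h (r \<otimes> x) = r \<otimes> x"
        using c rx(1) by (simp add: h_def ring_normalize)
      moreover have "h (r \<otimes> x) = \<zero>"
        using left_linearD(3)[OF h r(1) x(1)] x(2) r(1) by simp
      ultimately show False
        using rx(2) by simp
    qed
  qed
  then obtain u where u: "u \<in> carrier R" "\<And>x. x \<in> I \<Longrightarrow> h x = x \<otimes> u"
    using extension[OF I h] by blast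
  have "f x = x \<otimes> (u \<ominus> \<one> \<oplus> c)" if x: "x \<in> I" for x
  proof -
    have "x \<otimes> (u \<ominus> \<one> \<oplus> c) = h x \<ominus> x \<oplus> x \<otimes> c"
      using u x ID(1) c(1) by (simp add: ring_normalize)
    also have "\<dots> = f x"
      using x ID(1) fD(1) c(1) by (simp add: h_def ring_normalize)
    finally show ?thesis
      by simp
  qed
  then show "\<exists>c\<in>carrier R. \<forall>x\<in>I. f x = x \<otimes> c"
    using u(1) c(1) by (intro bexI[of _ "u \<ominus> \<one> \<oplus> c"]) auto
qed

text \<open>If \<open>b\<close> were in the double annihilator but outside \<open>L\<close>, some
  multiple z = e p b would generate a simple submodule of R/L. A minimal left ideal of the same type
  gives a map on L + Rz that kills \<open>L\<close> but not \<open>z\<close>. It is multiplication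
  by some \<open>c\<close> with L c = 0, and then b c = 0 contradicts z c being nonzero.\<close>

lemma left_double_annihilator:
  assumes L: "left_ideal R L"
  shows "left_annihilator (right_annihilator L) = L"
proof
  have LR: "L \<subseteq> carrier R"
    using L by (simp add: left_ideal_def)
  show "L \<subseteq> left_annihilator (right_annihilator L)"
    by (rule annihilator_galois(1)[OF LR])
  show "left_annihilator (right_annihilator L) \<subseteq> L"
  proof (rule ccontr)
    assume "\<not> ?thesis"
    then obtain b where b: "b \<in> left_annihilator (right_annihilator L)" "b \<notin> L"
      by blast
    have bR: "b \<in> carrier R"
      using b(1) by (simp add: left_annihilator_def)
    obtain p where p: "p \<in> carrier R" "p \<otimes> b \<notin> L" "\<And>j. j \<in> J \<Longrightarrow> j \<otimes> (p \<otimes> b) \<in> L"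
      using exists_top_layer[OF L bR b(2)] by blast
    have pb: "p \<otimes> b \<in> carrier R"
      using p(1) bR by simp
    obtain e where e: "e \<in> E" "e \<otimes> (p \<otimes> b) \<notin> L"
      using E_separates[OF L pb p(2,3)] by blast
    note eR = E_carrier[OF e(1)]
    obtain a where a: "left_minimal a" "e \<in> left_type a"
      using exists_minimal_of_left_type[OF e(1)] by blast
    note aR = left_minimalD(1)[OF a(1)]
    obtain r where r: "r \<in> carrier R" "e \<otimes> (r \<otimes> a) \<noteq> \<zero>"
      using a(2) by (auto simp: left_type_def)
    have "j \<otimes> (r \<otimes> a) = \<zero>" if j: "j \<in> J" for j
      using J_annihilates_minimal[OF a(1) right_idealD(4)[OF J_right r(1) j]] J_closed[OF j] r(1) aR
      by (simp add: m_assoc)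
    then have ann: "s \<otimes> (e \<otimes> (r \<otimes> a)) = \<zero> \<longleftrightarrow> s \<otimes> e \<in> J" if "s \<in> carrier R" for s
      using minimal_of_annihilated(2)[OF e(1) _ r(2) _ that] r(1) aR by simp
    define z where "z = e \<otimes> (p \<otimes> b)"
    have zR: "z \<in> carrier R"
      using eR pb by (simp add: z_def)
    have lin: "left_linear R L (\<lambda>x. \<zero>)"
      by (simp add: left_linear_def)
    have "\<zero> = s \<otimes> (e \<otimes> (r \<otimes> a))" if "s \<in> carrier R" "s \<otimes> z \<in> L" for s
      using annihilator_mod(1)[OF L e(1) pb e(2) p(3) that(1)] that(2) ann[OF that(1)] by (simp add: z_def)
    then obtain g where g: "left_linear R (adjoin L z) g"
      "\<And>x s. \<lbrakk>x \<in> L; s \<in> carrier R\<rbrakk> \<Longrightarrow> g (x \<oplus> s \<otimes> z) = \<zero> \<oplus> s \<otimes> (e \<otimes> (r \<otimes> a))"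
      using extend_adjoin[OF L lin zR, of "e \<otimes> (r \<otimes> a)"] eR r(1) aR by (metis m_closed)
    obtain c where c: "c \<in> carrier R" "\<And>x. x \<in> adjoin L z \<Longrightarrow> g x = x \<otimes> c"
      using left_baerE[OF left_baer left_ideal_adjoin[OF L zR] g(1)] by blast
    have "x \<otimes> c = \<zero>" if x: "x \<in> L" for x
      using c(2)[of x] adjoin_base[OF L zR] x g(2)[OF x zero_closed] left_idealD(1)[OF L x] zR eR r(1) aR
      by auto
    then have "c \<in> right_annihilator L"
      using c(1) by (simp add: right_annihilator_def)
    then have "b \<otimes> c = \<zero>"
      using b(1) by (simp add: left_annihilator_def)
    then have "z \<otimes> c = \<zero>"
      using eR p(1) bR c(1) by (simp add: z_def m_assoc)
    moreover have "z \<otimes> c = e \<otimes> (r \<otimes> a)"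
      using c(2)[OF adjoin_elem[OF L zR]] g(2)[OF left_idealD(2)[OF L] one_closed] zR eR r(1) aR by simp
    ultimately show False
      using r(2) by simp
  qed
qed

section \<open>Transfer between left and right ideals by annihilators\<close>

lemma left_artinian_if_right_artinian:
  assumes "right_artinian R"
  shows "left_artinian R"
proof (rule left_artinian_if_left_acc)
  interpret op: ring "opposite_ring R"
    by (rule opposite_ring)
  have dcc: "left_dcc (opposite_ring R) {\<zero>} (carrier R)"
    using op.left_dcc_if_left_artinian[of "{\<zero>}"] assms by (simp add: right_artinian_def)
  show "left_acc R"
    unfolding left_acc_def
  proof (intro allI impI)
    fix f :: "nat \<Rightarrow> 'a set"
    assume f: "\<forall>n. left_ideal R (f n) \<and> f n \<subseteq> f (Suc n)"
    have ri: "right_ideal R (right_annihilator (f n))" for n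
      using f by (intro right_ideal_right_annihilator) (auto simp: left_ideal_def)
    have bounds: "{\<zero>} \<subseteq> right_annihilator (f n)" "right_annihilator (f n) \<subseteq> carrier R"
      "right_annihilator (f (Suc n)) \<subseteq> right_annihilator (f n)" for n
      using op.left_idealD(1,2)[OF ri] f annihilator_antimono(2) by auto
    obtain n where n: "\<And>k. k \<ge> n \<Longrightarrow> right_annihilator (f k) = right_annihilator (f n)"
      using left_dccE[of _ _ _ "\<lambda>n. right_annihilator (f n)", OF dcc ri bounds] by blast
    \<comment> \<open>The left ideals are recovered from their right annihilators, so the ascending
      chain stabilizes where the annihilators do.\<close>
    have "f k = f n" if "k \<ge> n" for k
    proof -
      have "left_annihilator (right_annihilator (f k)) = left_annihilator (right_annihilator (f n))"
        using n[OF that] by (rule arg_cong)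
      then show ?thesis
        using left_double_annihilator f by simp
    qed
    then show "\<exists>n. \<forall>k\<ge>n. f k = f n"
      by blast
  qed
qed

text \<open>For \<open>y\<close> in the left annihilator of \<open>K\<close>, the hypothesis on
  \<open>x\<close> makes y x depend only on y a. The resulting map is multiplication by some
  \<open>d\<close>, so x - a d is in the double annihilator of \<open>K\<close>, which is
  \<open>K\<close>.\<close>

lemma right_double_annihilator_adjoin:
  assumes K: "right_ideal R K" "right_annihilator (left_annihilator K) = K" and a: "a \<in> carrier R"
    and x: "x \<in> carrier R" "\<And>y. \<lbrakk>y \<in> left_annihilator K; y \<otimes> a = \<zero>\<rbrakk> \<Longrightarrow> y \<otimes> x = \<zero>"
  shows "x \<in> ring.adjoin (opposite_ring R) K a"
proof -
  interpret op: ring "opposite_ring R"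
    by (rule opposite_ring)
  let ?N = "left_annihilator K"
  have lN: "left_ideal R ?N"
    using op.left_idealD(1)[OF K(1)] by (intro left_ideal_left_annihilator) auto
  note ND = left_idealD[OF lN]
  let ?I = "{y \<otimes> a |y. y \<in> ?N}"
  have lI: "left_ideal R ?I"
    by (rule left_ideal_mult[OF lN a])
  \<comment> \<open>The choice picks an arbitrary \<open>y\<close>; the next step shows that another
    choice gives the same value.\<close>
  define g where "g z = (SOME y. y \<in> ?N \<and> z = y \<otimes> a) \<otimes> x" for z
  have g: "g (y \<otimes> a) = y \<otimes> x" if y: "y \<in> ?N" for y
  proof -
    define y' where "y' = (SOME w. w \<in> ?N \<and> y \<otimes> a = w \<otimes> a)"
    have y': "y' \<in> ?N" "y \<otimes> a = y' \<otimes> a"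
      using someI[of "\<lambda>w. w \<in> ?N \<and> y \<otimes> a = w \<otimes> a" y] y unfolding y'_def by auto
    have "(y' \<ominus> y) \<otimes> a = y' \<otimes> a \<ominus> y \<otimes> a"
      using ND(1) y y'(1) a by (simp add: ring_normalize)
    then have "(y' \<ominus> y) \<otimes> a = \<zero>"
      using y'(2) ND(1)[OF y'(1)] a by (simp add: ring_normalize)
    then have "(y' \<ominus> y) \<otimes> x = \<zero>"
      using left_ideal_diff[OF lN y'(1) y] x(2) by blast
    then have "y' \<otimes> x \<ominus> y \<otimes> x = \<zero>"
      using ND(1) y y'(1) x(1) by (simp add: ring_normalize)
    then have "y' \<otimes> x = y \<otimes> x"
      using diff_eq_zeroD[of "y' \<otimes> x" "y \<otimes> x"] ND(1) y y'(1) x(1) by simp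
    then show ?thesis
      by (simp add: g_def y'_def)
  qed
  have lin: "left_linear R ?I g"
    unfolding left_linear_def
  proof (intro conjI ballI)
    show "g \<in> ?I \<rightarrow> carrier R"
      using g ND(1) x(1) by auto
  next
    fix z w assume "z \<in> ?I" "w \<in> ?I"
    then obtain y v where *: "y \<in> ?N" "v \<in> ?N" "z = y \<otimes> a" "w = v \<otimes> a"
      by blast
    then have "z \<oplus> w = (y \<oplus> v) \<otimes> a"
      using ND(1) a by (simp add: l_distr)
    then show "g (z \<oplus> w) = g z \<oplus> g w"
      using g[OF ND(3)[OF *(1,2)]] g * ND(1) x(1) by (simp add: l_distr)
  next
    fix r z assume r: "r \<in> carrier R" and "z \<in> ?I"
    then obtain y where *: "y \<in> ?N" "z = y \<otimes> a"
      by blast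
    then have "r \<otimes> z = (r \<otimes> y) \<otimes> a"
      using ND(1) a r by (simp add: m_assoc)
    then show "g (r \<otimes> z) = r \<otimes> g z"
      using g[OF ND(4)[OF r *(1)]] g * ND(1) x(1) r by (simp add: m_assoc)
  qed
  obtain d where d: "d \<in> carrier R" "\<forall>z\<in>?I. g z = z \<otimes> d"
    using left_baer[unfolded left_baer_def, THEN spec, THEN spec, THEN mp, OF conjI[OF lI lin]]
    by (elim bexE)
  have "y \<otimes> (x \<ominus> a \<otimes> d) = \<zero>" if y: "y \<in> ?N" for y
  proof -
    have "y \<otimes> x = y \<otimes> a \<otimes> d"
      using g[OF y] d(2)[THEN bspec, of "y \<otimes> a"] y by auto
    then show ?thesis
      using ND(1)[OF y] a d(1) x(1) by (simp add: ring_normalize)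
  qed
  then have "x \<ominus> a \<otimes> d \<in> right_annihilator ?N"
    using a d(1) x(1) by (simp add: right_annihilator_def)
  then have "x \<ominus> a \<otimes> d \<in> K"
    using K(2) by simp
  moreover have "x = (x \<ominus> a \<otimes> d) \<oplus> a \<otimes> d"
    using a d(1) x(1) by (simp add: ring_normalize)
  ultimately show ?thesis
    using d(1) unfolding op.adjoin_def by auto
qed

text \<open>Adjoining one element preserves the double annihilator property, and while it holds, a
  strictly larger right ideal has a strictly smaller left annihilator. A \<open>K\<close> inside
  \<open>I\<close> with minimal left annihilator is therefore all of \<open>I\<close>.\<close>

lemma right_double_annihilator:
  assumes art: "left_artinian R" and I: "right_ideal R I"
  shows "right_annihilator (left_annihilator I) = I"
proof -
  interpret op: ring "opposite_ring R"
    by (rule opposite_ring)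
  let ?P = "\<lambda>K. right_ideal R K \<and> K \<subseteq> I \<and> right_annihilator (left_annihilator K) = K"
  let ?S = "{left_annihilator K |K. ?P K}"
  have S: "left_ideal R A" if "A \<in> ?S" for A
    using that op.left_idealD(1) left_ideal_left_annihilator by (fastforce simp: subset_iff)
  have "left_annihilator {\<zero>} = carrier R"
    by (auto simp: left_annihilator_def)
  then have "?P {\<zero>}"
    using op.left_ideal_zero op.left_idealD(2)[OF I] right_annihilator_carrier by simp
  then have "left_annihilator {\<zero>} \<in> ?S"
    by blast
  then have "\<exists>A\<in>?S. \<forall>B\<in>?S. B \<subseteq> A \<longrightarrow> B = A"
    by (rule left_artinian_minimal[OF ring_axioms art, rotated]) (rule S)
  then obtain A where A: "A \<in> ?S" "\<And>B. \<lbrakk>B \<in> ?S; B \<subseteq> A\<rbrakk> \<Longrightarrow> B = A"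
    by (elim bexE) simp
  obtain K where K: "?P K" "A = left_annihilator K"
    using A(1) by blast
  have rK: "right_ideal R K" "K \<subseteq> I" and KK: "right_annihilator (left_annihilator K) = K"
    using K by auto
  have "I \<subseteq> K"
  proof (rule ccontr)
    assume "\<not> I \<subseteq> K"
    then obtain a where a: "a \<in> I" "a \<notin> K"
      by blast
    have aR: "a \<in> carrier R"
      using op.left_idealD(1)[OF I a(1)] by simp
    let ?K = "op.adjoin K a"
    have rK': "right_ideal R ?K"
      using op.left_ideal_adjoin[OF rK(1)] aR by simp
    have K'R: "?K \<subseteq> carrier R"
      using op.left_idealD(1)[OF rK'] by auto
    have sub: "K \<subseteq> ?K" and aK: "a \<in> ?K"
      using op.adjoin_base[OF rK(1)] op.adjoin_elem[OF rK(1)] aR by auto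
    have "right_annihilator (left_annihilator ?K) \<subseteq> ?K"
    proof
      fix x assume x: "x \<in> right_annihilator (left_annihilator ?K)"
      have xR: "x \<in> carrier R"
        using x by (simp add: right_annihilator_def)
      have "y \<otimes> x = \<zero>" if y: "y \<in> left_annihilator K" "y \<otimes> a = \<zero>" for y
      proof -
        have yR: "y \<in> carrier R"
          using y by (simp add: left_annihilator_def)
        have "y \<otimes> z = \<zero>" if z: "z \<in> ?K" for z
        proof -
          obtain k r where kr: "z = k \<oplus> a \<otimes> r" "k \<in> K" "r \<in> carrier R"
            using z unfolding op.adjoin_def by auto
          then have "y \<otimes> z = y \<otimes> k \<oplus> y \<otimes> a \<otimes> r"
            using yR aR op.left_idealD(1)[OF rK(1) kr(2)] by (simp add: r_distr m_assoc)
          then show ?thesis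
            using y kr by (simp add: left_annihilator_def)
        qed
        then have "y \<in> left_annihilator ?K"
          using yR by (simp add: left_annihilator_def)
        then show ?thesis
          using x by (simp add: right_annihilator_def)
      qed
      then show "x \<in> ?K"
        using right_double_annihilator_adjoin[OF rK(1) KK aR xR] by blast
    qed
    then have KK': "right_annihilator (left_annihilator ?K) = ?K"
      using annihilator_galois(2)[OF K'R] by blast
    have "?P ?K"
      using rK' KK' op.adjoin_subset[OF I rK(2) a(1)] by simp
    then have "left_annihilator ?K \<in> ?S"
      by blast
    then have "left_annihilator ?K = left_annihilator K"
      using A(2) annihilator_antimono(1)[OF sub] K(2) by simp
    then have "?K = K"
      using KK KK' by simp
    then show False
      using aK a(2) by simp
  qed
  then have "I = K"
    using rK(2) by (rule equalityI)
  then show ?thesis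
    using KK by simp
qed

lemma right_artinian_if_left_artinian:
  assumes art: "left_artinian R"
  shows "right_artinian R"
proof -
  interpret op: semiprimary "opposite_ring R" J E
    by (rule opposite)
  have "left_acc (opposite_ring R)"
    unfolding left_acc_def
  proof (intro allI impI)
    fix f :: "nat \<Rightarrow> 'a set"
    assume f: "\<forall>n. right_ideal R (f n) \<and> f n \<subseteq> f (Suc n)"
    have li: "left_ideal R (left_annihilator (f n))" for n
      using f by (intro left_ideal_left_annihilator) (auto simp: left_ideal_def)
    have bounds: "{\<zero>} \<subseteq> left_annihilator (f n)" "left_annihilator (f n) \<subseteq> carrier R"
      "left_annihilator (f (Suc n)) \<subseteq> left_annihilator (f n)" for n
      using left_idealD(1,2)[OF li] f annihilator_antimono(1) by auto
    obtain n where n: "\<And>k. k \<ge> n \<Longrightarrow> left_annihilator (f k) = left_annihilator (f n)"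
      using left_dccE[of _ _ _ "\<lambda>n. left_annihilator (f n)", OF left_dcc_if_left_artinian[OF art] li bounds]
      by blast
    have "f k = f n" if "k \<ge> n" for k
    proof -
      have "right_annihilator (left_annihilator (f k)) = right_annihilator (left_annihilator (f n))"
        using n[OF that] by (rule arg_cong)
      then show ?thesis
        using right_double_annihilator[OF art] f by simp
    qed
    then show "\<exists>n. \<forall>k\<ge>n. f k = f n"
      by blast
  qed
  then show ?thesis
    using op.left_artinian_if_left_acc by (simp add: right_artinian_def)
qed

text \<open>A solution \<open>c\<close> on \<open>K\<close> is corrected at a new element
  \<open>a\<close>. Let N be the left annihilator of \<open>K\<close>. If N a x = 0, then a x lies
  in \<open>K\<close>, so the error d = f a - c a satisfies d x = 0. Hence d is in the double
  annihilator of N a, so d = y a with \<open>y\<close> in N, and c + y works at \<open>a\<close>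
  without disturbing \<open>K\<close>.\<close>

theorem right_baer:
  assumes art: "left_artinian R"
  shows "left_baer (opposite_ring R)"
  unfolding left_baer_def
proof (intro allI impI)
  interpret op: ring "opposite_ring R"
    by (rule opposite_ring)
  fix I f assume "right_ideal R I \<and> left_linear (opposite_ring R) I f"
  then have I: "right_ideal R I" and f: "left_linear (opposite_ring R) I f"
    by auto
  note ID = right_idealD[OF I]
  have fD: "\<And>x. x \<in> I \<Longrightarrow> f x \<in> carrier R" "\<And>x y. \<lbrakk>x \<in> I; y \<in> I\<rbrakk> \<Longrightarrow> f (x \<oplus> y) = f x \<oplus> f y"
    "\<And>a x. \<lbrakk>a \<in> carrier R; x \<in> I\<rbrakk> \<Longrightarrow> f (x \<otimes> a) = f x \<otimes> a"
    using op.left_linearD[OF f] by auto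
  let ?P = "\<lambda>K. right_ideal R K \<and> K \<subseteq> I \<and> (\<exists>c\<in>carrier R. \<forall>x\<in>K. f x = c \<otimes> x)"
  let ?S = "{left_annihilator K |K. ?P K}"
  have S: "left_ideal R A" if "A \<in> ?S" for A
    using that op.left_idealD(1) left_ideal_left_annihilator by (fastforce simp: subset_iff)
  have "?P {\<zero>}"
    using op.left_ideal_zero ID(2) op.left_linear_zero[OF I f] by (auto intro!: bexI[of _ \<zero>])
  then have "left_annihilator {\<zero>} \<in> ?S"
    by blast
  then have "\<exists>A\<in>?S. \<forall>B\<in>?S. B \<subseteq> A \<longrightarrow> B = A"
    by (rule left_artinian_minimal[OF ring_axioms art, rotated]) (rule S)
  then obtain A where A: "A \<in> ?S" "\<And>B. \<lbrakk>B \<in> ?S; B \<subseteq> A\<rbrakk> \<Longrightarrow> B = A"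
    by (elim bexE) simp
  obtain K where K: "?P K" "A = left_annihilator K"
    using A(1) by blast
  have rK: "right_ideal R K" "K \<subseteq> I"
    using K by auto
  note KD = right_idealD[OF rK(1)]
  obtain c where c: "c \<in> carrier R" "\<And>x. x \<in> K \<Longrightarrow> f x = c \<otimes> x"
    using K by blast
  have "I \<subseteq> K"
  proof (rule ccontr)
    assume "\<not> I \<subseteq> K"
    then obtain a where a: "a \<in> I" "a \<notin> K"
      by blast
    note aR = ID(1)[OF a(1)]
    let ?N = "left_annihilator K"
    have KR: "K \<subseteq> carrier R"
      using KD(1) by auto
    have lN: "left_ideal R {y \<otimes> a |y. y \<in> ?N}"
      by (rule left_ideal_mult[OF left_ideal_left_annihilator[OF KR] aR])
    define d where "d = f a \<ominus> c \<otimes> a"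
    have dR: "d \<in> carrier R"
      using fD(1)[OF a(1)] c(1) aR by (simp add: d_def)
    have "d \<otimes> x = \<zero>" if x: "x \<in> right_annihilator {y \<otimes> a |y. y \<in> ?N}" for x
    proof -
      have xR: "x \<in> carrier R"
        using x by (simp add: right_annihilator_def)
      have "y \<otimes> (a \<otimes> x) = \<zero>" if y: "y \<in> ?N" for y
      proof -
        have "y \<otimes> a \<otimes> x = \<zero>"
          using x y unfolding right_annihilator_def by blast
        then show ?thesis
          using y aR xR by (simp add: left_annihilator_def m_assoc)
      qed
      then have "a \<otimes> x \<in> right_annihilator ?N"
        using aR xR by (simp add: right_annihilator_def)
      then have "a \<otimes> x \<in> K"
        using right_double_annihilator[OF art rK(1)] by simp
      then have "f a \<otimes> x = c \<otimes> (a \<otimes> x)"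
        using c(2) fD(3)[OF xR a(1)] by simp
      then show ?thesis
        using fD(1)[OF a(1)] c(1) aR xR by (simp add: d_def ring_normalize)
    qed
    then have "d \<in> left_annihilator (right_annihilator {y \<otimes> a |y. y \<in> ?N})"
      using dR by (simp add: left_annihilator_def)
    then obtain y where y: "y \<in> ?N" "d = y \<otimes> a"
      unfolding left_double_annihilator[OF lN] by blast
    have yR: "y \<in> carrier R"
      using y by (simp add: left_annihilator_def)
    let ?K = "op.adjoin K a"
    have rK': "right_ideal R ?K"
      using op.left_ideal_adjoin[OF rK(1)] aR by simp
    have sub: "K \<subseteq> ?K" and aK: "a \<in> ?K"
      using op.adjoin_base[OF rK(1)] op.adjoin_elem[OF rK(1)] aR by auto
    have fa: "f a = (c \<oplus> y) \<otimes> a"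
    proof -
      have "f a = c \<otimes> a \<oplus> d"
        using fD(1)[OF a(1)] c(1) aR by (simp add: d_def ring_normalize)
      then show ?thesis
        using y(2) c(1) yR aR by (simp add: l_distr)
    qed
    have "f z = (c \<oplus> y) \<otimes> z" if z: "z \<in> ?K" for z
    proof -
      obtain k r where kr: "z = k \<oplus> a \<otimes> r" "k \<in> K" "r \<in> carrier R"
        using z unfolding op.adjoin_def by auto
      have kR: "k \<in> carrier R"
        using KD(1)[OF kr(2)] .
      have "f z = f k \<oplus> f a \<otimes> r"
        using kr fD(2)[of k "a \<otimes> r"] fD(3)[OF kr(3) a(1)] ID(4)[OF kr(3) a(1)] rK(2) by auto
      moreover have "f k = (c \<oplus> y) \<otimes> k"
        using c kr(2) y(1) yR kR by (simp add: left_annihilator_def l_distr)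
      ultimately show ?thesis
        using fa kr kR c(1) yR aR by (simp add: r_distr m_assoc)
    qed
    then have "?P ?K"
      using rK' op.adjoin_subset[OF I rK(2) a(1)] c(1) yR by (auto intro!: bexI[of _ "c \<oplus> y"])
    then have "left_annihilator ?K \<in> ?S"
      by blast
    then have "left_annihilator ?K = left_annihilator K"
      using A(2) annihilator_antimono(1)[OF sub] K(2) by simp
    then have "?K = K"
      using right_double_annihilator[OF art rK'] right_double_annihilator[OF art rK(1)] by simp
    then show False
      using aK a(2) by simp
  qed
  then show "\<exists>c\<in>carrier (opposite_ring R). \<forall>x\<in>I. f x = x \<otimes>\<^bsub>opposite_ring R\<^esub> c"
    using c by auto
qed

end

section \<open>From vectors of length one to elements of the ring\<close>

lemma (in ring) left_MacWilliams_extension: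
  assumes mw: "left_MacWilliams 1 R"
    and I: "left_ideal R I" and f: "left_linear R I f" and inj: "inj_on f I"
  shows "\<exists>u\<in>carrier R. \<exists>v\<in>carrier R. u \<otimes> v = \<one> \<and> v \<otimes> u = \<one> \<and> (\<forall>x\<in>I. f x = x \<otimes> u)"
proof -
  note ID = left_idealD[OF I] and fD = left_linearD[OF f]
  define F where "F = free_module R 1"
  interpret F: left_module R F
    unfolding F_def by (rule left_module_free_module[OF ring_axioms])
  define vec :: "'a \<Rightarrow> nat \<Rightarrow> 'a" where "vec x = (\<lambda>i\<in>{..<1}. x)" for x
  have vec0 [simp]: "vec x 0 = x" for x
    by (simp add: vec_def)
  have carrier: "carrier F = vec ` carrier R"
  proof
    show "carrier F \<subseteq> vec ` carrier R"
    proof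
      fix w assume "w \<in> carrier F"
      then have "w = vec (w 0)" "w 0 \<in> carrier R"
        by (auto simp: F_def free_module_def vec_def fun_eq_iff PiE_iff extensional_def)
      then show "w \<in> vec ` carrier R"
        by blast
    qed
  qed (auto simp: F_def free_module_def vec_def split: if_splits)
  have vec_add: "vec x \<oplus>\<^bsub>F\<^esub> vec y = vec (x \<oplus> y)" for x y
    by (auto simp: F_def free_module_def vec_def fun_eq_iff)
  have vec_smult: "a \<odot>\<^bsub>F\<^esub> vec x = vec (a \<otimes> x)" for a x
    by (auto simp: F_def free_module_def vec_def fun_eq_iff)
  have vec_zero: "\<zero>\<^bsub>F\<^esub> = vec \<zero>"
    by (auto simp: F_def free_module_def vec_def fun_eq_iff)
  have vec_inj: "vec x = vec y \<longleftrightarrow> x = y" for x y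
    by (metis vec0)
  have vec_minus: "\<ominus>\<^bsub>F\<^esub> vec x = vec (\<ominus> x)" if x: "x \<in> carrier R" for x
    using x by (intro F.M.minus_equality) (auto simp: vec_add vec_zero carrier l_neg)
  \<comment> \<open>In length one the weight only tells zero from nonzero, so preserving it means
    having trivial kernel.\<close>
  have weight: "hamming_weight R 1 (vec x) = (if x = \<zero> then 0 else 1)" for x
  proof -
    have "{i. i < 1 \<and> vec x i \<noteq> \<zero>} = (if x = \<zero> then {} else {0})"
      by (auto simp: vec_def)
    then show ?thesis
      by (simp add: hamming_weight_def)
  qed
  let ?L = "vec ` I"
  define h where "h w = vec (f (w 0))" for w :: "nat \<Rightarrow> 'a"
  have "submodule ?L R F"
  proof (intro submodule.intro submodule_axioms.intro)
    show "subgroup ?L (add_monoid F)"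
    proof (rule group.subgroupI[OF F.M.a_group])
      show "?L \<subseteq> carrier (add_monoid F)"
        using ID(1) by (auto simp: carrier)
      show "?L \<noteq> {}"
        using ID(2) by auto
      fix w assume "w \<in> ?L"
      then obtain x where x: "w = vec x" "x \<in> I"
        by blast
      then have "\<ominus>\<^bsub>F\<^esub> w \<in> ?L"
        using vec_minus ID(1) left_ideal_minus[OF I] by simp
      then show "inv\<^bsub>add_monoid F\<^esub> w \<in> ?L"
        by (simp only: a_inv_def)
    next
      fix w z assume "w \<in> ?L" "z \<in> ?L"
      then show "w \<otimes>\<^bsub>add_monoid F\<^esub> z \<in> ?L"
        using ID(3) by (auto simp: vec_add)
    qed
    fix a w assume "a \<in> carrier R" "w \<in> ?L"
    then show "a \<odot>\<^bsub>F\<^esub> w \<in> ?L"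
      using ID(4) by (auto simp: vec_smult)
  qed
  moreover have "h \<in> module_hom R (F\<lparr>carrier := ?L\<rparr>) F"
    using fD by (auto simp: module_hom_def h_def carrier vec_add vec_smult)
  moreover have "\<forall>w\<in>?L. hamming_weight R 1 (h w) = hamming_weight R 1 w"
  proof
    fix w assume "w \<in> ?L"
    then obtain x where x: "w = vec x" "x \<in> I"
      by blast
    have "f x = \<zero> \<longleftrightarrow> x = \<zero>"
      using inj_onD[OF inj, of x \<zero>] x(2) ID(2) left_linear_zero[OF I f] by auto
    then show "hamming_weight R 1 (h w) = hamming_weight R 1 w"
      unfolding x(1) h_def weight vec0 by simp
  qed
  ultimately obtain g where g: "g \<in> module_auto R F" "\<forall>x\<in>?L. g x = h x"
    using mw[unfolded left_MacWilliams_def, folded F_def, THEN spec, THEN spec, of ?L h] by blast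
  have g_smult: "g (a \<odot>\<^bsub>F\<^esub> w) = a \<odot>\<^bsub>F\<^esub> g w" if "a \<in> carrier R" "w \<in> carrier F" for a w
    using g(1) that by (simp add: module_auto_def module_hom_def)
  have bij: "bij_betw g (carrier F) (carrier F)"
    using g(1) by (simp add: module_auto_def)
  have one: "vec \<one> \<in> carrier F"
    by (simp add: carrier)
  then have "g (vec \<one>) \<in> vec ` carrier R"
    using bij_betwE[OF bij] carrier by blast
  then obtain u where u: "u \<in> carrier R" "g (vec \<one>) = vec u"
    by blast
  have g_vec: "g (vec x) = vec (x \<otimes> u)" if "x \<in> carrier R" for x
    using g_smult[OF that one] u that by (simp add: vec_smult)
  obtain v where v: "v \<in> carrier R" "g (vec v) = vec \<one>"
    using bij_betw_imp_surj_on[OF bij] one unfolding carrier by (metis imageE)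
  have vu: "v \<otimes> u = \<one>"
    using v g_vec vec_inj by simp
  \<comment> \<open>Since \<open>g\<close> is right multiplication by \<open>u\<close>, surjectivity
    gave v u = 1. Now u v and 1 both have image \<open>u\<close>, and injectivity gives u v =
    1.\<close>
  have "g (vec (u \<otimes> v)) = g (vec \<one>)"
    using u v vu by (simp add: g_vec m_assoc)
  then have "vec (u \<otimes> v) = vec \<one>"
    by (rule inj_onD[OF bij_betw_imp_inj_on[OF bij]]) (use u(1) v(1) carrier in auto)
  then have uv: "u \<otimes> v = \<one>"
    using vec_inj by blast
  have "f x = x \<otimes> u" if x: "x \<in> I" for x
  proof -
    have "vec (f x) = vec (x \<otimes> u)"
      using g(2) x g_vec[OF ID(1)[OF x]] by (simp add: h_def)
    then show ?thesis
      using vec_inj by blast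
  qed
  then show ?thesis
    using u(1) v(1) uv vu by blast
qed

theorem corollary2p6:
  fixes R :: "('a, 'r) ring_scheme"
  assumes "ring R"
    and "right_artinian R \<or> left_artinian R"
    and "left_MacWilliams 1 R"
  shows "quasi_frobenius TYPE('b) TYPE('c) R"
proof -
  interpret ring R by fact
  have "\<exists>J E. semiprimary R J E"
    using assms(2)
  proof
    \<comment> \<open>The data is constructed in the opposite ring and brought back by
      \<open>semiprimary.opposite\<close>, the double opposite being R.\<close>
    assume "right_artinian R"
    then obtain J E where "semiprimary (opposite_ring R) J E"
      using ring.left_artinian_semiprimary[OF opposite_ring] unfolding right_artinian_def by blast
    then show ?thesis
      using semiprimary.opposite by fastforce
  qed (rule left_artinian_semiprimary)
  then obtain J E where "semiprimary R J E"
    by blast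
  then interpret macwilliams R J E
    by (intro macwilliams.intro macwilliams_axioms.intro left_MacWilliams_extension assms)
  have left: "left_artinian R"
    using assms(2) left_artinian_if_right_artinian by blast
  show ?thesis
    unfolding quasi_frobenius_def right_self_injective_def
    using left right_artinian_if_left_artinian[OF left] assms(1)
      baer_criterion[OF assms(1) left_baer] baer_criterion[OF opposite_ring right_baer[OF left]]
    by blast
qed

end
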